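(* In the setting and with the notation of the context, let $r_2$ be a Richardson element of $\mathfrak{a}_{S,T}$, let $r\in\mathfrak{n}_U$ satisfy $[\mathfrak{p}^+_U,r]=\mathfrak{n}_U$, and write $r=r_1+r_2'+r_d$ with $r_1\in\mathfrak{n}_{\mathfrak{c}}$, $r_2'\in\mathfrak{n}'_{\mathfrak{a}}$, $r_d\in\mathfrak{d}_U$. If $$\mathrm{stab}_{\mathfrak{a}_U}(r_2')_{|\mathfrak{l}}=\mathrm{stab}_{\mathfrak{a}_{S,T}}(r_2)_{|\mathfrak{l}},$$ then $\mathfrak{q}_{S,T}$ has a Richardson element.
   Context: The ground field is $\mathbb{C}$. Let $\mathfrak{g}$ be a simple Lie algebra of type $\mathbb{B}_n$, $\mathbb{C}_n$ or $\mathbb{D}_n$ with Cartan subalgebra $\mathfrak{h}$ contained in a fixed Borel subalgebra, root system $\Phi=\Phi^+\cup\Phi^-$, simple roots $\Pi=\{\alpha_1,\dots,\alpha_n\}$ and root spaces $\mathfrak{g}_\alpha$. Numbering of the Dynkin diagram: in types $\mathbb{B}$ and $\mathbb{C}$ it is the chain $n - (n-1) - \cdots - 2 - 1$ with the double edge between $2$ and $1$, where $\alpha_1$ is short in type $\mathbb{B}$ and long in type $\mathbb{C}$; in type $\mathbb{D}$ it is the chain $n - \cdots - 4 - 3$ with $3$ joined also to both $1$ and $2$. The support of a root is the set of simple roots with nonzero coefficient in it; for a set $S$ of simple roots, $\Phi_S$ is the set of roots with support contained in $S$ and $\Phi_S^\pm=\Phi_S\cap\Phi^\pm$. Let $S,T\subset\Pi$,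 neither equal to $\emptyset$ or $\Pi$. The standard seaweed is $\mathfrak{q}_{S,T}=\mathfrak{h}\oplus\bigoplus_{\alpha\in\Phi_S^+\cup\Phi_T^-}\mathfrak{g}_\alpha$; its nilpotent radical is $\mathfrak{n}_{S,T}=\bigoplus_{\alpha\in(\Phi_S^+\cup\Phi_T^-)\setminus\Phi_{S\cap T}}\mathfrak{g}_\alpha$. A Richardson element of a seaweed (or parabolic) algebra $\mathfrak{q}$ with nilpotent radical $\mathfrak{n}$ is an $x\in\mathfrak{n}$ with $[\mathfrak{q},x]=\mathfrak{n}$. Let $e_i,f_i,\overline{h}_i=[e_i,f_i]$ be Chevalley generators. Define $h_1=\frac12\overline{h}_1$ in type $\mathbb{B}$, $h_1=\overline{h}_1$ in type $\mathbb{C}$, $h_1=\frac12(\overline{h}_1-\overline{h}_2)$ in type $\mathbb{D}$, and $h_i=\overline{h}_i+h_{i-1}$ for $i\ge2$. Put $\mathfrak{h}_i=\mathbb{C}h_i$. Let $\epsilon=\min\{i\mid\alpha_i\notin S\}$, $\eta=\min\{i\mid\alpha_i\notin T\}$ and, assuming $\epsilon\ge\eta$, $\omega=\max\{i\mid i\le\epsilon,\ \alpha_i\notin T\}$. Standing assumptions: $\epsilon\ge\eta$; $\epsilon>\omega$; and in type $\mathbb{D}$: (i) $(\epsilon,\omega)\ne(2,1)$ and (ii) $\eta\neq2$ when $\epsilon>2$. Let $S''=\{\alpha_i\in S\mid i>\omega\}$, $T''=\{\alpha_i\in T\mid i>\omega\}$, $T'=\{\alpha_i\in T\mid i<\epsilon\}$,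 and $$\mathfrak{a}_{S,T}=\bigoplus_{i\ge\omega}\mathfrak{h}_i\oplus\bigoplus_{\alpha\in\Phi^+_{S''}\cup\Phi^-_{T''}}\mathfrak{g}_\alpha,\qquad \mathfrak{c}_{S,T}=\bigoplus_{i<\epsilon}\mathfrak{h}_i\oplus\bigoplus_{\alpha\in\Phi^+_{\{\alpha_i\mid i<\epsilon\}}\cup\Phi^-_{T'}}\mathfrak{g}_\alpha,$$ $$\mathfrak{l}=\bigoplus_{\epsilon>i\ge\omega}\mathfrak{h}_i\oplus\bigoplus_{\alpha\in\Phi_{\{\alpha_i\mid\epsilon>i>\omega\}}}\mathfrak{g}_\alpha .$$ The nilpotent radical of $\mathfrak{a}_{S,T}$ is $\mathfrak{n}_{\mathfrak{a}}=\bigoplus_{\alpha\in(\Phi^+_{S''}\cup\Phi^-_{T''})\setminus\Phi_{S''\cap T''}}\mathfrak{g}_\alpha$, and the nilpotent radical of $\mathfrak{c}_{S,T}$ is $\mathfrak{n}_{\mathfrak{c}}=\bigoplus_{\alpha\in\Phi^+_{\{\alpha_i\mid i<\epsilon\}}\setminus\Phi_{T'}}\mathfrak{g}_\alpha$. Let $\mathfrak{g}'$ be a Lie algebra of the same type (letter) as $\mathfrak{g}$, of rank $n'\ge\epsilon$, with root system $\Phi'$, simple roots $\alpha_1,\dots,\alpha_{n'}$ numbered so that the Dynkin diagram is, in types $\mathbb{B}$ and $\mathbb{C}$, the chain $n'-(n'-1)-\cdots-2-1$ with the double edge between $2$ and $1$, where $\alpha_1$ is short in type $\mathbb{B}$ and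 long in type $\mathbb{C}$, and, in type $\mathbb{D}$, the chain $n'-\cdots-4-3$ with $3$ joined also to both $1$ and $2$, and subspaces $\mathfrak{h}'_i$ of its Cartan subalgebra $\mathfrak{h}'$ defined in the same way as $\mathfrak{h}_i$. Both $\mathfrak{g}$ and $\mathfrak{g}'$ are regarded as subalgebras of a Lie algebra of the same type, with $\mathfrak{g}\subseteq\mathfrak{g}'$ or $\mathfrak{g}'\subseteq\mathfrak{g}$, the inclusions being induced by inclusions of Dynkin diagrams (preserving the numbering). Let $U$ be a set of simple roots of $\mathfrak{g}'$ with $\alpha_\epsilon\notin U$ and $\{\alpha_i\mid i<\epsilon\}\cap U=\{\alpha_i\mid i<\epsilon\}\cap T$. Let $\mathfrak{p}_U^+=\mathfrak{h}'\oplus\bigoplus_{\alpha\in\Phi'^+\cup\Phi'^-_U}\mathfrak{g}'_\alpha$, with nilpotent radical $\mathfrak{n}_U=\bigoplus_{\alpha\in\Phi'^+\setminus\Phi'_U}\mathfrak{g}'_\alpha$. Let $U''=\{\alpha_i\in U\mid i>\omega\}$, $U'=\{\alpha_i\in U\mid i<\epsilon\}$, $$\mathfrak{a}_U=\bigoplus_{i\ge\omega}\mathfrak{h}'_i\oplus\bigoplus_{\alpha\in\Phi'^-_{U''}\cup\Phi'^+_{\{\alpha_i\mid i>\omega\}}}\mathfrak{g}'_\alpha,\qquad \mathfrak{c}_U=\bigoplus_{i<\epsilon}\mathfrak{h}'_i\oplus\bigoplus_{\alpha\in\Phi'^-_{U'}\cup\Phi'^+_{\{\alpha_i\mid i<\epsilon\}}}\mathfrak{g}'_\alpha,$$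 so that $\mathfrak{c}_U=\mathfrak{c}_{S,T}$. Let $\mathfrak{n}'_{\mathfrak{a}}=\bigoplus_{\alpha\in\Phi'^+_{\{\alpha_i\mid i>\omega\}}\setminus\Phi'_{U''}}\mathfrak{g}'_\alpha$ be the nilpotent radical of $\mathfrak{a}_U$, and let $\mathfrak{d}_U\subseteq\mathfrak{p}^+_U$ be the direct sum of all root spaces $\mathfrak{g}'_\alpha$ with $\alpha$ positive such that $\mathfrak{g}'_\alpha$ is contained neither in $\mathfrak{a}_U$ nor in $\mathfrak{c}_U$. One has $\mathfrak{n}_U=\mathfrak{n}'_{\mathfrak{a}}\oplus\mathfrak{n}_{\mathfrak{c}}\oplus\mathfrak{d}_U$. For a Lie algebra $\mathfrak{u}$ and $x\in\mathfrak{u}$, $\mathrm{stab}_{\mathfrak{u}}(x)=\{y\in\mathfrak{u}\mid[y,x]=0\}$. For an element $x$ (or a set of elements), $x_{|\mathfrak{l}}$ denotes its image under the canonical projection onto $\mathfrak{l}$ along the other root spaces and the other subspaces $\mathfrak{h}_i$ (resp. $\mathfrak{h}'_i$). *)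

theory Defs
  imports Complex_Main
begin

section \<open>Complex Lie algebras\<close>

class complex_lie_algebra = ab_group_add +
  fixes scaleC :: "complex \<Rightarrow> 'a \<Rightarrow> 'a"  (infixr "*\<^sub>C" 75)
    and bracket :: "'a \<Rightarrow> 'a \<Rightarrow> 'a"
  assumes scaleC_add_right: "c *\<^sub>C (x + y) = c *\<^sub>C x + c *\<^sub>C y"
    and scaleC_add_left: "(c + d) *\<^sub>C x = c *\<^sub>C x + d *\<^sub>C x"
    and scaleC_scaleC: "c *\<^sub>C (d *\<^sub>C x) = (c * d) *\<^sub>C x"
    and scaleC_one: "1 *\<^sub>C x = x"
    and bracket_add_left: "bracket (x + y) z = bracket x z + bracket y z"
    and bracket_add_right: "bracket x (y + z) = bracket x y + bracket x z"
    and bracket_scaleC_left: "bracket (c *\<^sub>C x) y = c *\<^sub>C bracket x y"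
    and bracket_scaleC_right: "bracket x (c *\<^sub>C y) = c *\<^sub>C bracket x y"
    and bracket_self: "bracket x x = 0"
    and jacobi: "bracket x (bracket y z) + bracket y (bracket z x) + bracket z (bracket x y) = 0"

global_interpretation cvec: vector_space "scaleC :: complex \<Rightarrow> 'a \<Rightarrow> 'a::complex_lie_algebra"
  by unfold_locales (rule scaleC_add_right scaleC_add_left scaleC_scaleC scaleC_one)+

text \<open>The type is only an ambient Lie algebra; the Lie algebras under consideration are
  subalgebras of it.\<close>

definition lie_subalgebra :: "'a::complex_lie_algebra set \<Rightarrow> bool" where
  "lie_subalgebra L \<longleftrightarrow> cvec.subspace L \<and> (\<forall>x\<in>L. \<forall>y\<in>L. bracket x y \<in> L)"

definition lie_ideal :: "'a::complex_lie_algebra set \<Rightarrow> 'a set \<Rightarrow> bool" where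
  "lie_ideal I L \<longleftrightarrow> cvec.subspace I \<and> I \<subseteq> L \<and> (\<forall>x\<in>L. \<forall>y\<in>I. bracket x y \<in> I)"

definition lie_generated :: "'a::complex_lie_algebra set \<Rightarrow> 'a set" where
  "lie_generated X = \<Inter>{K. lie_subalgebra K \<and> X \<subseteq> K}"

definition simple_lie_algebra :: "'a::complex_lie_algebra set \<Rightarrow> bool" where
  "simple_lie_algebra L \<longleftrightarrow>
     lie_subalgebra L \<and>
     (\<exists>B. finite B \<and> cvec.span B = L) \<and>
     (\<exists>x\<in>L. \<exists>y\<in>L. bracket x y \<noteq> 0) \<and>
     (\<forall>I. lie_ideal I L \<longrightarrow> I = {0} \<or> I = L)"

primrec lower_central :: "'a::complex_lie_algebra set \<Rightarrow> nat \<Rightarrow> 'a set" where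
  "lower_central L 0 = L"
| "lower_central L (Suc k) = cvec.span {bracket x y | x y. x \<in> L \<and> y \<in> lower_central L k}"

definition nilpotent_lie_algebra :: "'a::complex_lie_algebra set \<Rightarrow> bool" where
  "nilpotent_lie_algebra L \<longleftrightarrow> lie_subalgebra L \<and> (\<exists>k. lower_central L k = {0})"

definition cartan_subalgebra :: "'a::complex_lie_algebra set \<Rightarrow> 'a set \<Rightarrow> bool" where
  "cartan_subalgebra H L \<longleftrightarrow>
     H \<subseteq> L \<and> nilpotent_lie_algebra H \<and> {x \<in> L. \<forall>h\<in>H. bracket x h \<in> H} = H"

definition stab :: "'a::complex_lie_algebra set \<Rightarrow> 'a \<Rightarrow> 'a set" where
  "stab u x = {y \<in> u. bracket y x = 0}"

definition is_richardson :: "'a::complex_lie_algebra set \<Rightarrow> 'a set \<Rightarrow> 'a \<Rightarrow> bool" where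
  "is_richardson q n x \<longleftrightarrow> x \<in> n \<and> (\<lambda>y. bracket y x) ` q = n"

section \<open>Roots\<close>

text \<open>A linear form on the subspace \<open>H\<close> is represented by the function extending it by zero
  outside \<open>H\<close>.\<close>

definition linear_forms :: "'a::complex_lie_algebra set \<Rightarrow> ('a \<Rightarrow> complex) set" where
  "linear_forms H = {\<mu>.
     (\<forall>x\<in>H. \<forall>y\<in>H. \<mu> (x + y) = \<mu> x + \<mu> y) \<and>
     (\<forall>c. \<forall>x\<in>H. \<mu> (c *\<^sub>C x) = c * \<mu> x) \<and>
     (\<forall>x. x \<notin> H \<longrightarrow> \<mu> x = 0)}"

definition weight_space ::
  "'a::complex_lie_algebra set \<Rightarrow> 'a set \<Rightarrow> ('a \<Rightarrow> complex) \<Rightarrow> 'a set" where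
  "weight_space L H \<mu> = {x \<in> L. \<forall>h\<in>H. bracket h x = \<mu> h *\<^sub>C x}"

definition root_set :: "'a::complex_lie_algebra set \<Rightarrow> 'a set \<Rightarrow> ('a \<Rightarrow> complex) set" where
  "root_set L H = {\<mu> \<in> linear_forms H. \<mu> \<noteq> (\<lambda>_. 0) \<and> weight_space L H \<mu> \<noteq> {0}}"

datatype classical_type = TypeB | TypeC | TypeD

text \<open>The edges of the Dynkin diagram, infinitely extended to the left; a diagram of rank \<open>n\<close>
  consists of the vertices \<open>1, \<dots>, n\<close>.\<close>

definition dynkin_edge :: "classical_type \<Rightarrow> nat \<Rightarrow> nat \<Rightarrow> bool" where
  "dynkin_edge X i j \<longleftrightarrow>
     (if X = TypeD
      then {i, j} = {1, 3} \<or> (\<exists>k\<ge>2. {i, j} = {k, Suc k})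
      else \<exists>k\<ge>1. {i, j} = {k, Suc k})"

text \<open>The entry at \<open>(i, j)\<close> is the value of \<open>\<alpha>\<^sub>j\<close> on the coroot of \<open>\<alpha>\<^sub>i\<close>, hence \<open>-2\<close> on the double
  edge if \<open>\<alpha>\<^sub>i\<close> is the shorter of the two roots.\<close>

definition cartan_entry :: "classical_type \<Rightarrow> nat \<Rightarrow> nat \<Rightarrow> int" where
  "cartan_entry X i j =
     (if i = j then 2
      else if \<not> dynkin_edge X i j then 0
      else if X = TypeB \<and> i = 1 \<and> j = 2 then - 2
      else if X = TypeC \<and> i = 2 \<and> j = 1 then - 2
      else - 1)"

section \<open>Lie algebras of classical type\<close>

text \<open>A Lie algebra with a Cartan subalgebra, numbered simple roots \<open>sroot G i\<close> and Chevalley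
  generators \<open>egen G i\<close>, \<open>fgen G i\<close>, where \<open>i\<close> ranges over \<open>{1..rank G}\<close>. The choice of the simple
  roots is that of a Borel subalgebra. Sets of simple roots are given as sets of indices.\<close>

record 'a pinned_algebra =
  lie_type :: classical_type
  rank :: nat
  alg :: "'a set"
  cartan :: "'a set"
  sroot :: "nat \<Rightarrow> 'a \<Rightarrow> complex"
  egen :: "nat \<Rightarrow> 'a"
  fgen :: "nat \<Rightarrow> 'a"

definition simples :: "'a pinned_algebra \<Rightarrow> nat set" where
  "simples G = {1..rank G}"

definition Phi :: "'a::complex_lie_algebra pinned_algebra \<Rightarrow> ('a \<Rightarrow> complex) set" where
  "Phi G = root_set (alg G) (cartan G)"

definition root_space :: "'a::complex_lie_algebra pinned_algebra \<Rightarrow> ('a \<Rightarrow> complex) \<Rightarrow> 'a set" where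
  "root_space G \<beta> = weight_space (alg G) (cartan G) \<beta>"

definition simple_comb :: "'a pinned_algebra \<Rightarrow> (nat \<Rightarrow> int) \<Rightarrow> 'a \<Rightarrow> complex" where
  "simple_comb G c = (\<lambda>h. \<Sum>i\<in>simples G. of_int (c i) * sroot G i h)"

definition is_root_base :: "'a::complex_lie_algebra pinned_algebra \<Rightarrow> bool" where
  "is_root_base G \<longleftrightarrow>
     (\<forall>i\<in>simples G. sroot G i \<in> Phi G) \<and>
     (\<forall>c::nat \<Rightarrow> complex. (\<forall>h\<in>cartan G. (\<Sum>i\<in>simples G. c i * sroot G i h) = 0)
        \<longrightarrow> (\<forall>i\<in>simples G. c i = 0)) \<and>
     (\<forall>\<beta>\<in>Phi G. \<exists>c. \<beta> = simple_comb G c \<and>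
        ((\<forall>i\<in>simples G. c i \<ge> 0) \<or> (\<forall>i\<in>simples G. c i \<le> 0)))"

definition hbar :: "'a::complex_lie_algebra pinned_algebra \<Rightarrow> nat \<Rightarrow> 'a" where
  "hbar G i = bracket (egen G i) (fgen G i)"

text \<open>By the normalisation below, \<open>hbar G i\<close> is the coroot of \<open>sroot G i\<close>.\<close>

definition are_chevalley_generators :: "'a::complex_lie_algebra pinned_algebra \<Rightarrow> bool" where
  "are_chevalley_generators G \<longleftrightarrow>
     (\<forall>i\<in>simples G. egen G i \<in> root_space G (sroot G i) \<and>
        fgen G i \<in> root_space G (\<lambda>h. - sroot G i h) \<and>
        sroot G i (hbar G i) = 2) \<and>
     lie_generated (egen G ` simples G \<union> fgen G ` simples G) = alg G"

text \<open>The ranks allowed are those for which the diagrams make sense and are connected; this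
  includes \<open>C\<^sub>2 = B\<^sub>2\<close> and \<open>D\<^sub>3 = A\<^sub>3\<close>.\<close>

definition classical_lie_algebra :: "'a::complex_lie_algebra pinned_algebra \<Rightarrow> bool" where
  "classical_lie_algebra G \<longleftrightarrow>
     (if lie_type G = TypeD then 3 else 2) \<le> rank G \<and>
     simple_lie_algebra (alg G) \<and>
     cartan_subalgebra (cartan G) (alg G) \<and>
     is_root_base G \<and>
     are_chevalley_generators G \<and>
     (\<forall>i\<in>simples G. \<forall>j\<in>simples G.
        sroot G j (hbar G i) = of_int (cartan_entry (lie_type G) i j))"

text \<open>Inclusion of Lie algebras induced by the inclusion of Dynkin diagrams.\<close>

definition diagram_inclusion ::
  "'a::complex_lie_algebra pinned_algebra \<Rightarrow> 'a pinned_algebra \<Rightarrow> bool" where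
  "diagram_inclusion G G' \<longleftrightarrow>
     rank G \<le> rank G' \<and> alg G \<subseteq> alg G' \<and>
     (\<forall>i\<in>simples G. egen G i = egen G' i \<and> fgen G i = fgen G' i)"

definition root_coeff ::
  "'a::complex_lie_algebra pinned_algebra \<Rightarrow> ('a \<Rightarrow> complex) \<Rightarrow> nat \<Rightarrow> int" where
  "root_coeff G \<beta> = (THE c. \<beta> = simple_comb G c \<and> (\<forall>i. i \<notin> simples G \<longrightarrow> c i = 0))"

definition supp :: "'a::complex_lie_algebra pinned_algebra \<Rightarrow> ('a \<Rightarrow> complex) \<Rightarrow> nat set" where
  "supp G \<beta> = {i \<in> simples G. root_coeff G \<beta> i \<noteq> 0}"

definition Phi_pos :: "'a::complex_lie_algebra pinned_algebra \<Rightarrow> ('a \<Rightarrow> complex) set" where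
  "Phi_pos G = {\<beta> \<in> Phi G. \<forall>i\<in>simples G. root_coeff G \<beta> i \<ge> 0}"

definition Phi_neg :: "'a::complex_lie_algebra pinned_algebra \<Rightarrow> ('a \<Rightarrow> complex) set" where
  "Phi_neg G = {\<beta> \<in> Phi G. \<forall>i\<in>simples G. root_coeff G \<beta> i \<le> 0}"

definition Phi_on :: "'a::complex_lie_algebra pinned_algebra \<Rightarrow> nat set \<Rightarrow> ('a \<Rightarrow> complex) set" where
  "Phi_on G S = {\<beta> \<in> Phi G. supp G \<beta> \<subseteq> S}"

definition Phi_pos_on :: "'a::complex_lie_algebra pinned_algebra \<Rightarrow> nat set \<Rightarrow> ('a \<Rightarrow> complex) set"
  where "Phi_pos_on G S = Phi_on G S \<inter> Phi_pos G"

definition Phi_neg_on :: "'a::complex_lie_algebra pinned_algebra \<Rightarrow> nat set \<Rightarrow> ('a \<Rightarrow> complex) set"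
  where "Phi_neg_on G S = Phi_on G S \<inter> Phi_neg G"

definition root_sum :: "'a::complex_lie_algebra pinned_algebra \<Rightarrow> ('a \<Rightarrow> complex) set \<Rightarrow> 'a set" where
  "root_sum G A = cvec.span (\<Union>\<beta>\<in>A. root_space G \<beta>)"

primrec hvec :: "'a::complex_lie_algebra pinned_algebra \<Rightarrow> nat \<Rightarrow> 'a" where
  "hvec G 0 = 0"
| "hvec G (Suc k) =
     (if k = 0 then
        (case lie_type G of
           TypeB \<Rightarrow> (1/2) *\<^sub>C hbar G 1
         | TypeC \<Rightarrow> hbar G 1
         | TypeD \<Rightarrow> (1/2) *\<^sub>C (hbar G 1 - hbar G 2))
      else hbar G (Suc k) + hvec G k)"

text \<open>\<open>\<Oplus>\<^bsub>i\<in>I\<^esub> \<hh>\<^sub>i \<oplus> \<Oplus>\<^bsub>\<beta>\<in>A\<^esub> \<gg>\<^sub>\<beta>\<close>\<close>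

definition h_root_sum ::
  "'a::complex_lie_algebra pinned_algebra \<Rightarrow> nat set \<Rightarrow> ('a \<Rightarrow> complex) set \<Rightarrow> 'a set" where
  "h_root_sum G I A = cvec.span (hvec G ` I \<union> (\<Union>\<beta>\<in>A. root_space G \<beta>))"

section \<open>Seaweeds and the auxiliary subalgebras\<close>

definition seaweed ::
  "'a::complex_lie_algebra pinned_algebra \<Rightarrow> nat set \<Rightarrow> nat set \<Rightarrow> 'a set" where
  "seaweed G S T =
     cvec.span (cartan G \<union> (\<Union>\<beta>\<in>Phi_pos_on G S \<union> Phi_neg_on G T. root_space G \<beta>))"

definition seaweed_nil ::
  "'a::complex_lie_algebra pinned_algebra \<Rightarrow> nat set \<Rightarrow> nat set \<Rightarrow> 'a set" where
  "seaweed_nil G S T = root_sum G ((Phi_pos_on G S \<union> Phi_neg_on G T) - Phi_on G (S \<inter> T))"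

definition eps_index :: "'a pinned_algebra \<Rightarrow> nat set \<Rightarrow> nat" where
  "eps_index G S = Min {i \<in> simples G. i \<notin> S}"

definition omega_index :: "'a pinned_algebra \<Rightarrow> nat set \<Rightarrow> nat set \<Rightarrow> nat" where
  "omega_index G S T = Max {i \<in> simples G. i \<le> eps_index G S \<and> i \<notin> T}"

definition above :: "nat set \<Rightarrow> nat \<Rightarrow> nat set" where
  "above S k = {i \<in> S. i > k}"

definition below :: "nat set \<Rightarrow> nat \<Rightarrow> nat set" where
  "below S k = {i \<in> S. i < k}"

text \<open>In the following, \<open>\<epsilon>\<close> and \<open>\<omega>\<close> are parameters because they are computed from \<open>S\<close> and \<open>T\<close>
  in the first of the two Lie algebras but are used in both.\<close>

definition alg_a ::
  "'a::complex_lie_algebra pinned_algebra \<Rightarrow> nat \<Rightarrow> nat set \<Rightarrow> nat set \<Rightarrow> 'a set" where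
  "alg_a G \<omega> S T = h_root_sum G {i \<in> simples G. i \<ge> \<omega>}
     (Phi_pos_on G (above S \<omega>) \<union> Phi_neg_on G (above T \<omega>))"

definition nil_a ::
  "'a::complex_lie_algebra pinned_algebra \<Rightarrow> nat \<Rightarrow> nat set \<Rightarrow> nat set \<Rightarrow> 'a set" where
  "nil_a G \<omega> S T = root_sum G
     ((Phi_pos_on G (above S \<omega>) \<union> Phi_neg_on G (above T \<omega>))
        - Phi_on G (above S \<omega> \<inter> above T \<omega>))"

definition nil_c :: "'a::complex_lie_algebra pinned_algebra \<Rightarrow> nat \<Rightarrow> nat set \<Rightarrow> 'a set" where
  "nil_c G \<epsilon> T = root_sum G (Phi_pos_on G (below (simples G) \<epsilon>) - Phi_on G (below T \<epsilon>))"

definition alg_l :: "'a::complex_lie_algebra pinned_algebra \<Rightarrow> nat \<Rightarrow> nat \<Rightarrow> 'a set" where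
  "alg_l G \<epsilon> \<omega> = h_root_sum G {i \<in> simples G. \<omega> \<le> i \<and> i < \<epsilon>}
     (Phi_on G {i \<in> simples G. \<omega> < i \<and> i < \<epsilon>})"

definition compl_l :: "'a::complex_lie_algebra pinned_algebra \<Rightarrow> nat \<Rightarrow> nat \<Rightarrow> 'a set" where
  "compl_l G \<epsilon> \<omega> = h_root_sum G {i \<in> simples G. \<not> (\<omega> \<le> i \<and> i < \<epsilon>)}
     (Phi G - Phi_on G {i \<in> simples G. \<omega> < i \<and> i < \<epsilon>})"

definition proj_l :: "'a::complex_lie_algebra pinned_algebra \<Rightarrow> nat \<Rightarrow> nat \<Rightarrow> 'a \<Rightarrow> 'a" where
  "proj_l G \<epsilon> \<omega> x = (THE y. y \<in> alg_l G \<epsilon> \<omega> \<and> x - y \<in> compl_l G \<epsilon> \<omega>)"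

definition parabolic :: "'a::complex_lie_algebra pinned_algebra \<Rightarrow> nat set \<Rightarrow> 'a set" where
  "parabolic G U = cvec.span (cartan G \<union> (\<Union>\<beta>\<in>Phi_pos G \<union> Phi_neg_on G U. root_space G \<beta>))"

definition parabolic_nil :: "'a::complex_lie_algebra pinned_algebra \<Rightarrow> nat set \<Rightarrow> 'a set" where
  "parabolic_nil G U = root_sum G (Phi_pos G - Phi_on G U)"

definition par_a :: "'a::complex_lie_algebra pinned_algebra \<Rightarrow> nat \<Rightarrow> nat set \<Rightarrow> 'a set" where
  "par_a G \<omega> U = h_root_sum G {i \<in> simples G. i \<ge> \<omega>}
     (Phi_neg_on G (above U \<omega>) \<union> Phi_pos_on G (above (simples G) \<omega>))"

definition par_nil_a :: "'a::complex_lie_algebra pinned_algebra \<Rightarrow> nat \<Rightarrow> nat set \<Rightarrow> 'a set" where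
  "par_nil_a G \<omega> U = root_sum G
     (Phi_pos_on G (above (simples G) \<omega>) - Phi_on G (above U \<omega>))"

definition par_c :: "'a::complex_lie_algebra pinned_algebra \<Rightarrow> nat \<Rightarrow> nat set \<Rightarrow> 'a set" where
  "par_c G \<epsilon> U = h_root_sum G {i \<in> simples G. i < \<epsilon>}
     (Phi_neg_on G (below U \<epsilon>) \<union> Phi_pos_on G (below (simples G) \<epsilon>))"

definition par_d :: "'a::complex_lie_algebra pinned_algebra \<Rightarrow> nat \<Rightarrow> nat \<Rightarrow> nat set \<Rightarrow> 'a set" where
  "par_d G \<epsilon> \<omega> U = root_sum G
     {\<beta> \<in> Phi_pos G. \<not> root_space G \<beta> \<subseteq> par_a G \<omega> U \<and> \<not> root_space G \<beta> \<subseteq> par_c G \<epsilon> U}"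

end

theory Submission
  imports Defs
begin

text \<open>The Richardson element of the seaweed \<open>\<qq>\<close> is \<open>r\<^sub>2 + r\<^sub>1\<close>, the lower component of the given element
  of the parabolic algebra glued to the given element of \<open>\<aa>\<close>.

  Since \<open>\<alpha>\<^sub>\<epsilon>\<close> is missing in \<open>S\<close> and \<open>\<alpha>\<^sub>\<omega>\<close> in \<open>T\<close>, there is a decomposition \<open>\<qq> = A \<oplus> \<ll> \<oplus> C\<close> with
  \<open>\<aa> = A \<oplus> \<ll>\<close> and \<open>\<cc> = \<ll> \<oplus> C\<close>, the nilradical of \<open>\<qq>\<close> is the sum of the nilradicals \<open>N\<^sub>\<aa>\<close> and \<open>N\<^sub>\<cc>\<close>
  of \<open>\<aa>\<close> and \<open>\<cc>\<close>, and \<open>[A, N\<^sub>\<cc>] = [C, N\<^sub>\<aa>] = 0\<close>. Therefore \<open>a + l + c\<close> sends \<open>r\<^sub>2 + r\<^sub>1\<close> to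
  \<open>[a + l, r\<^sub>2] + [l + c, r\<^sub>1]\<close>, where the two summands are coupled by \<open>l\<close> only. To reach \<open>u + v\<close>, one
  first solves \<open>[a + l, r\<^sub>2] = u\<close>; the solution may be changed by the stabilizer of \<open>r\<^sub>2\<close> in \<open>\<aa>\<close>, so it
  suffices that every \<open>v\<close> in \<open>N\<^sub>\<cc>\<close> has the form \<open>[l + c, r\<^sub>1]\<close> where \<open>l\<close> is the Levi component of an element
  of this stabilizer (\<open>richardson_sum\<close>).

  The parabolic algebra decomposes in the same way as \<open>A' \<oplus> \<ll> \<oplus> C \<oplus> D\<close> with an additional ideal
  \<open>D = \<dd>\<^sub>U\<close>, modulo which \<open>A'\<close> kills \<open>N\<^sub>\<cc>\<close> and \<open>C\<close> kills \<open>N'\<^sub>\<aa>\<close>. An element sending \<open>r\<close> to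
  \<open>v \<in> N\<^sub>\<cc>\<close> thus has components with \<open>[a' + l, r\<^sub>2'] = 0\<close> and \<open>[l + c, r\<^sub>1] = v\<close>
  (\<open>lower_nil_by_stabilizer\<close>). Here \<open>l\<close> is a Levi component of the stabilizer of \<open>r\<^sub>2'\<close>, hence by hypothesis one of
  the stabilizer of \<open>r\<^sub>2\<close>.

  The facts on root systems behind these decompositions are few: all coefficients of a root have the same sign
  (part of the definition of a base), and the support of a root is connected (\<open>root_connected\<close>). The latter,
  and the fact that \<open>\<ll>\<close>, \<open>C\<close> and \<open>N\<^sub>\<cc>\<close> are literally the same in both Lie algebras
  (\<open>cut_algebra_agree\<close>), follow from the description of the positive root spaces by iterated
  brackets of the \<open>e\<^sub>i\<close> (\<open>wspace_positive\<close>); for connectedness one also needs that \<open>e\<^sub>i\<close> and \<open>e\<^sub>j\<close> commute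
  for vertices that are not joined (\<open>egen_commute\<close>).\<close>

section \<open>Brackets and spans\<close>

lemma bracket_zero_left [simp]: "bracket 0 (x::'a::complex_lie_algebra) = 0"
  using bracket_add_left[of 0 0 x] by simp

lemma bracket_zero_right [simp]: "bracket (x::'a::complex_lie_algebra) 0 = 0"
  using bracket_add_right[of x 0 0] by simp

lemma bracket_minus_left: "bracket (- x) y = - bracket (x::'a::complex_lie_algebra) y"
  using bracket_add_left[of x "- x" y] by (simp add: eq_neg_iff_add_eq_0 add.commute)

lemma bracket_minus_right: "bracket x (- y) = - bracket (x::'a::complex_lie_algebra) y"
  using bracket_add_right[of x y "- y"] by (simp add: eq_neg_iff_add_eq_0 add.commute)

lemma bracket_antisym: "bracket x y = - bracket (y::'a::complex_lie_algebra) x"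
proof -
  have "bracket (x + y) (x + y) = bracket x x + bracket x y + (bracket y x + bracket y y)"
    by (simp only: bracket_add_left bracket_add_right ac_simps)
  then show ?thesis by (simp add: bracket_self eq_neg_iff_add_eq_0)
qed

lemma bracket_sum_right:
  "bracket (x::'a::complex_lie_algebra) (sum f F) = (\<Sum>i\<in>F. bracket x (f i))"
  by (induction F rule: infinite_finite_induct) (simp_all add: bracket_add_right)

text \<open>The Jacobi identity in the form in which it is used: every \<open>bracket x\<close> is a derivation.\<close>

lemma bracket_derivation:
  "bracket x (bracket y z) = bracket (bracket x y) z + bracket y (bracket x (z::'a::complex_lie_algebra))"
proof -
  have "bracket x (bracket y z) = - bracket y (bracket z x) - bracket z (bracket x y)"
    using jacobi[of x y z] by (simp add: algebra_simps eq_neg_iff_add_eq_0)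
  also have "\<dots> = bracket y (bracket x z) + bracket (bracket x y) z"
    using bracket_antisym[of z x] bracket_antisym[of z "bracket x y"]
    by (simp add: bracket_minus_right)
  finally show ?thesis by (simp add: add.commute)
qed

lemma bracket_span:
  fixes x y :: "'a::complex_lie_algebra"
  assumes "x \<in> cvec.span X" "y \<in> cvec.span Y" "cvec.subspace Z"
    and XY: "\<And>x y. x \<in> X \<Longrightarrow> y \<in> Y \<Longrightarrow> bracket x y \<in> Z"
  shows "bracket x y \<in> Z"
  using assms(1)
proof (induction rule: cvec.span_induct_alt)
  case base
  show ?case using assms(3) by (simp add: cvec.subspace_0)
next
  case (step c u v)
  have "bracket u y \<in> Z"
    using assms(2)
  proof (induction rule: cvec.span_induct_alt)
    case base
    show ?case using assms(3) by (simp add: cvec.subspace_0)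
  next
    case (step d a b)
    then show ?case using XY[OF \<open>u \<in> X\<close>] assms(3)
      by (simp add: bracket_add_right bracket_scaleC_right cvec.subspace_add cvec.subspace_scale)
  qed
  then show ?case using step assms(3)
    by (simp add: bracket_add_left bracket_scaleC_left cvec.subspace_add cvec.subspace_scale)
qed

lemma span_UN_decomposition:
  fixes X :: "'i \<Rightarrow> 'a::complex_lie_algebra set"
  assumes "x \<in> cvec.span (\<Union>d\<in>A. X d)"
  obtains f F where "finite F" "F \<subseteq> A" "\<And>d. f d \<in> cvec.span (X d)" "\<And>d. d \<notin> F \<Longrightarrow> f d = 0"
    "x = sum f F"
proof -
  have "\<exists>f F. finite F \<and> F \<subseteq> A \<and> (\<forall>d. f d \<in> cvec.span (X d)) \<and> (\<forall>d. d \<notin> F \<longrightarrow> f d = 0) \<and> x = sum f F"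
    using assms
  proof (induction rule: cvec.span_induct_alt)
    case base
    show ?case by (rule exI[of _ "\<lambda>_. 0"], rule exI[of _ "{}"]) (simp add: cvec.span_zero)
  next
    case (step c u v)
    then obtain f F where f: "finite F" "F \<subseteq> A" "\<And>d. f d \<in> cvec.span (X d)"
      "\<And>d. d \<notin> F \<Longrightarrow> f d = 0" "v = sum f F"
      by blast
    from step obtain d where d: "d \<in> A" "u \<in> X d" by blast
    let ?f = "f(d := c *\<^sub>C u + f d)"
    have du: "c *\<^sub>C u + f d \<in> cvec.span (X d)"
      using f(3)[of d] d by (metis cvec.span_add cvec.span_scale cvec.span_base)
    have "c *\<^sub>C u + v = c *\<^sub>C u + sum f (insert d F)"
      using f by (cases "d \<in> F") (simp_all add: insert_absorb)
    also have "sum f (insert d F) = f d + sum f (F - {d})"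
      using f by (simp add: sum.insert_remove)
    also have "c *\<^sub>C u + (f d + sum f (F - {d})) = sum ?f (insert d F)"
      using f by (simp add: sum.insert_remove add.assoc)
    finally have "c *\<^sub>C u + v = sum ?f (insert d F)" .
    moreover have "?f e \<in> cvec.span (X e)" for e
      using f(3)[of e] du by simp
    ultimately show ?case using f d
      by (intro exI[of _ ?f] exI[of _ "insert d F"]) auto
  qed
  then show ?thesis using that by blast
qed

section \<open>Weight spaces indexed by coefficient vectors\<close>

definition lattice :: "'a pinned_algebra \<Rightarrow> (nat \<Rightarrow> int) set" where
  "lattice G = {c. \<forall>i. i \<notin> simples G \<longrightarrow> c i = 0}"

text \<open>Roots are represented by their coefficient vectors with respect to the simple roots. Sign and
  support are then conditions on the vector, and the same vector can be read in two Lie algebras of different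
  rank.\<close>

definition wspace :: "'a::complex_lie_algebra pinned_algebra \<Rightarrow> (nat \<Rightarrow> int) \<Rightarrow> 'a set" where
  "wspace G c = root_space G (simple_comb G c)"

definition root_coeffs :: "'a::complex_lie_algebra pinned_algebra \<Rightarrow> (nat \<Rightarrow> int) set" where
  "root_coeffs G = {c \<in> lattice G. c \<noteq> (\<lambda>_. 0) \<and> wspace G c \<noteq> {0}}"

definition csupp :: "(nat \<Rightarrow> int) \<Rightarrow> nat set" where
  "csupp c = {i. c i \<noteq> 0}"

definition nonneg :: "(nat \<Rightarrow> int) \<Rightarrow> bool" where
  "nonneg c \<longleftrightarrow> (\<forall>i. 0 \<le> c i)"

definition nonpos :: "(nat \<Rightarrow> int) \<Rightarrow> bool" where
  "nonpos c \<longleftrightarrow> (\<forall>i. c i \<le> 0)"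

definition unit_coeff :: "nat \<Rightarrow> nat \<Rightarrow> int" where
  "unit_coeff i = (\<lambda>j. if j = i then 1 else 0)"

lemma finite_simples [simp]: "finite (simples G)"
  by (simp add: simples_def)

lemma simple_comb_add:
  "simple_comb G (\<lambda>i. c i + d i) h = simple_comb G c h + simple_comb G d h"
  by (simp add: simple_comb_def sum.distrib algebra_simps)

lemma simple_comb_minus: "simple_comb G (\<lambda>i. - c i) h = - simple_comb G c h"
  by (simp add: simple_comb_def sum_negf)

lemma simple_comb_zero [simp]: "simple_comb G (\<lambda>_. 0) h = 0"
  by (simp add: simple_comb_def)

lemma simple_comb_unit: "i \<in> simples G \<Longrightarrow> simple_comb G (unit_coeff i) h = sroot G i h"
  by (simp add: simple_comb_def unit_coeff_def if_distrib[of of_int] if_distrib[of "\<lambda>x. x * _"] cong: if_cong)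

lemma lattice_simps [simp]:
  "(\<lambda>_. 0) \<in> lattice G"
  "c \<in> lattice G \<Longrightarrow> d \<in> lattice G \<Longrightarrow> (\<lambda>i. c i + d i) \<in> lattice G"
  "(\<lambda>i. - c i) \<in> lattice G \<longleftrightarrow> c \<in> lattice G"
  "unit_coeff i \<in> lattice G \<longleftrightarrow> i \<in> simples G"
  by (auto simp: lattice_def unit_coeff_def)

lemma wspace_iff:
  "x \<in> wspace G c \<longleftrightarrow> x \<in> alg G \<and> (\<forall>h\<in>cartan G. bracket h x = simple_comb G c h *\<^sub>C x)"
  by (simp add: wspace_def root_space_def weight_space_def)

fun monomial :: "(nat \<Rightarrow> 'a::complex_lie_algebra) \<Rightarrow> nat list \<Rightarrow> 'a" where
  "monomial e [] = 0"
| "monomial e [i] = e i"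
| "monomial e (i # j # w) = bracket (e i) (monomial e (j # w))"

definition word_weight :: "nat list \<Rightarrow> nat \<Rightarrow> int" where
  "word_weight w = (\<lambda>i. int (count_list w i))"

definition words :: "nat set \<Rightarrow> nat list set" where
  "words A = {w. w \<noteq> [] \<and> set w \<subseteq> A}"

lemma monomial_Cons: "w \<noteq> [] \<Longrightarrow> monomial e (i # w) = bracket (e i) (monomial e w)"
  by (cases w) auto

lemma word_weight_Cons: "word_weight (i # w) = (\<lambda>j. unit_coeff i j + word_weight w j)"
  by (auto simp: word_weight_def unit_coeff_def)

lemma word_weight_Nil: "word_weight [] = (\<lambda>_. 0)"
  by (simp add: word_weight_def)

lemma csupp_word_weight: "csupp (word_weight w) = set w"
  by (auto simp: csupp_def word_weight_def count_list_0_iff)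

lemma nonneg_word_weight: "nonneg (word_weight w)"
  by (simp add: nonneg_def word_weight_def)

lemma monomial_cong: "(\<And>i. i \<in> set w \<Longrightarrow> e i = e' i) \<Longrightarrow> monomial e w = monomial e' w"
  by (induction e w rule: monomial.induct) auto

locale classical =
  fixes G :: "'a::complex_lie_algebra pinned_algebra"
  assumes classical: "classical_lie_algebra G"
begin

lemma rank_ge: "(if lie_type G = TypeD then 3 else 2) \<le> rank G"
  and simple_alg: "simple_lie_algebra (alg G)"
  and cartan: "cartan_subalgebra (cartan G) (alg G)"
  and root_base: "is_root_base G"
  and chevalley: "are_chevalley_generators G"
  and sroot_hbar: "i \<in> simples G \<Longrightarrow> j \<in> simples G \<Longrightarrow>
    sroot G j (hbar G i) = of_int (cartan_entry (lie_type G) i j)"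
  using classical by (auto simp: classical_lie_algebra_def)

lemma subspace_alg: "cvec.subspace (alg G)"
  and bracket_alg: "x \<in> alg G \<Longrightarrow> y \<in> alg G \<Longrightarrow> bracket x y \<in> alg G"
  using simple_alg by (auto simp: simple_lie_algebra_def lie_subalgebra_def)

lemma subspace_cartan: "cvec.subspace (cartan G)"
  and cartan_sub: "cartan G \<subseteq> alg G"
  using cartan
  by (auto simp: cartan_subalgebra_def nilpotent_lie_algebra_def lie_subalgebra_def)

lemma sroot_form: "i \<in> simples G \<Longrightarrow> sroot G i \<in> linear_forms (cartan G)"
  using root_base by (auto simp: is_root_base_def Phi_def root_set_def)

lemma sroot_add: "i \<in> simples G \<Longrightarrow> x \<in> cartan G \<Longrightarrow> y \<in> cartan G \<Longrightarrow>
    sroot G i (x + y) = sroot G i x + sroot G i y"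
  and sroot_scale: "i \<in> simples G \<Longrightarrow> x \<in> cartan G \<Longrightarrow> sroot G i (c *\<^sub>C x) = c * sroot G i x"
  and sroot_outside: "i \<in> simples G \<Longrightarrow> x \<notin> cartan G \<Longrightarrow> sroot G i x = 0"
  using sroot_form by (auto simp: linear_forms_def)

lemma simple_comb_form: "simple_comb G c \<in> linear_forms (cartan G)"
  by (simp add: linear_forms_def simple_comb_def sroot_add sroot_scale sroot_outside
      sum.distrib sum_distrib_left algebra_simps)

lemma simple_comb_eqD:
  assumes "\<And>h. h \<in> cartan G \<Longrightarrow> simple_comb G c h = simple_comb G d h" "i \<in> simples G"
  shows "c i = d i"
proof -
  have "\<forall>h\<in>cartan G. (\<Sum>i\<in>simples G. of_int (c i - d i) * sroot G i h) = 0"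
    using assms(1) by (simp add: simple_comb_def algebra_simps sum_subtractf)
  then have "\<forall>i\<in>simples G. (of_int (c i - d i) :: complex) = 0"
    using root_base unfolding is_root_base_def by (elim conjE allE[of _ "\<lambda>i. of_int (c i - d i)"]) blast
  then show ?thesis using assms(2) by simp
qed

lemma lattice_eqI:
  assumes "c \<in> lattice G" "d \<in> lattice G" "\<And>h. h \<in> cartan G \<Longrightarrow> simple_comb G c h = simple_comb G d h"
  shows "c = d"
proof
  fix i
  show "c i = d i"
    using simple_comb_eqD[OF assms(3)] assms(1,2)
    by (cases "i \<in> simples G") (auto simp: lattice_def)
qed

lemma inj_simple_comb: "inj_on (simple_comb G) (lattice G)"
  by (rule inj_onI) (auto intro: lattice_eqI)

lemma subspace_wspace: "cvec.subspace (wspace G c)"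
  using subspace_alg
  by (auto simp: cvec.subspace_def wspace_iff bracket_add_right bracket_scaleC_right
      scaleC_add_right scaleC_scaleC mult.commute)

lemma span_wspace [simp]: "cvec.span (wspace G c) = wspace G c"
  using subspace_wspace by (rule cvec.span_eq_iff[THEN iffD2])

lemma bracket_wspace:
  assumes "x \<in> wspace G c" "y \<in> wspace G d"
  shows "bracket x y \<in> wspace G (\<lambda>i. c i + d i)"
proof -
  have "bracket h (bracket x y) = simple_comb G (\<lambda>i. c i + d i) h *\<^sub>C bracket x y"
    if "h \<in> cartan G" for h
    using assms that
    by (subst bracket_derivation)
      (simp add: wspace_iff bracket_scaleC_left bracket_scaleC_right simple_comb_add scaleC_add_left)
  then show ?thesis using assms bracket_alg by (simp add: wspace_iff)
qed

text \<open>Weight vectors for different weights are linearly independent: applying \<open>ad h - \<mu> h\<close> for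
  the weight \<open>\<mu>\<close> of one summand removes this summand and rescales the others.\<close>

lemma weight_independent:
  assumes "finite F" "F \<subseteq> lattice G" "\<And>c. c \<in> F \<Longrightarrow> x c \<in> wspace G c" "sum x F = 0" "c \<in> F"
  shows "x c = 0"
  using assms
proof (induction F arbitrary: x c rule: finite_induct)
  case empty
  then show ?case by simp
next
  case (insert d F)
  have zero: "x c' = 0" if c': "c' \<in> F" for c'
  proof -
    obtain h where h: "h \<in> cartan G" "simple_comb G c' h \<noteq> simple_comb G d h"
      using lattice_eqI[of c' d] insert.hyps insert.prems(1) c' by blast
    define y where "y c = (simple_comb G c h - simple_comb G d h) *\<^sub>C x c" for c
    have br: "bracket h (x c) = simple_comb G c h *\<^sub>C x c" if "c \<in> insert d F" for c
      using insert.prems(2)[OF that] h by (simp add: wspace_iff)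
    have "sum y F = sum y (insert d F)"
      using insert.hyps by (simp add: y_def)
    also have "\<dots> = (\<Sum>c\<in>insert d F. bracket h (x c)) - (\<Sum>c\<in>insert d F. simple_comb G d h *\<^sub>C x c)"
      unfolding y_def cvec.scale_left_diff_distrib sum_subtractf
      using br by (intro arg_cong2[of _ _ _ _ minus] sum.cong) auto
    also have "\<dots> = bracket h (sum x (insert d F)) - simple_comb G d h *\<^sub>C sum x (insert d F)"
      by (simp only: bracket_sum_right cvec.scale_sum_right)
    also have "\<dots> = 0" using insert.prems(3) by simp
    finally have "sum y F = 0" .
    moreover have "y c \<in> wspace G c" if "c \<in> F" for c
      using insert.prems(2)[of c] that subspace_wspace by (simp add: y_def cvec.subspace_scale)
    ultimately have "y c' = 0" using insert.IH[of y c'] insert.prems(1) c' by blast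
    then show ?thesis using h by (simp add: y_def)
  qed
  then have "sum x F = 0" by simp
  then have "x d = 0" using insert.prems(3) insert.hyps by simp
  then show ?case using zero insert.prems(4) by auto
qed

text \<open>Comparing homogeneous components, which are unique, shows that only the spanning vectors of
  the same weight contribute to a weight vector.\<close>

lemma graded_component:
  assumes "\<And>d. X d \<subseteq> wspace G d" "x \<in> cvec.span (\<Union>d\<in>lattice G. X d)" "x \<in> wspace G c" "c \<in> lattice G"
  shows "x \<in> cvec.span (X c)"
proof -
  obtain f F where f: "finite F" "F \<subseteq> lattice G" "\<And>d. f d \<in> cvec.span (X d)"
      "\<And>d. d \<notin> F \<Longrightarrow> f d = 0" "x = sum f F"
    by (rule span_UN_decomposition[OF assms(2)]) (rule that)
  define g where "g = f(c := f c - x)"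
  have fW: "f d \<in> wspace G d" for d
    using f(3)[of d] cvec.span_mono[OF assms(1)[of d]] by auto
  have "sum g (insert c F) = g c + sum g (F - {c})" using f by (simp add: sum.insert_remove)
  also have "\<dots> = f c + sum f (F - {c}) - x" by (simp add: g_def)
  also have "f c + sum f (F - {c}) = sum f (insert c F)" using f by (simp add: sum.insert_remove)
  also have "\<dots> = x" using f by (cases "c \<in> F") (simp_all add: insert_absorb)
  finally have "sum g (insert c F) = 0" by simp
  moreover have "g d \<in> wspace G d" for d
    using fW assms(3) subspace_wspace by (simp add: g_def cvec.subspace_diff)
  ultimately have "g c = 0"
    using weight_independent[of "insert c F" g c] f(1,2) assms(4) by blast
  then show ?thesis using f(3)[of c] by (simp add: g_def)
qed

lemma graded_disjoint:
  assumes X: "\<And>d. X d \<subseteq> wspace G d" and Y: "\<And>d. Y d \<subseteq> wspace G d"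
    and "\<And>d. d \<in> lattice G \<Longrightarrow> cvec.span (X d) \<inter> cvec.span (Y d) \<subseteq> {0}"
    and "x \<in> cvec.span (\<Union>d\<in>lattice G. X d)" "x \<in> cvec.span (\<Union>d\<in>lattice G. Y d)"
  shows "x = 0"
proof -
  obtain f F where f: "finite F" "F \<subseteq> lattice G" "\<And>d. f d \<in> cvec.span (X d)"
      "\<And>d. d \<notin> F \<Longrightarrow> f d = 0" "x = sum f F"
    by (rule span_UN_decomposition[OF assms(4)]) (rule that)
  obtain g F' where g: "finite F'" "F' \<subseteq> lattice G" "\<And>d. g d \<in> cvec.span (Y d)"
      "\<And>d. d \<notin> F' \<Longrightarrow> g d = 0" "x = sum g F'"
    by (rule span_UN_decomposition[OF assms(5)]) (rule that)
  have fW: "f d \<in> wspace G d" and gW: "g d \<in> wspace G d" for d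
    using f(3)[of d] g(3)[of d] cvec.span_mono[OF X[of d]] cvec.span_mono[OF Y[of d]] by auto
  have "sum f (F \<union> F') = x"
    unfolding f(5) using f(1,4) g(1) by (intro sum.mono_neutral_right) auto
  moreover have "sum g (F \<union> F') = x"
    unfolding g(5) using g(1,4) f(1) by (intro sum.mono_neutral_right) auto
  ultimately have "(\<Sum>d\<in>F \<union> F'. f d - g d) = 0" by (simp add: sum_subtractf)
  moreover have "f d - g d \<in> wspace G d" for d
    using fW gW subspace_wspace by (simp add: cvec.subspace_diff)
  ultimately have eq: "f d = g d" if "d \<in> F \<union> F'" for d
    using weight_independent[of "F \<union> F'" "\<lambda>d. f d - g d" d] f(1,2) g(1,2) that by simp
  then have "f d = 0" if "d \<in> F" for d
    using that eq[of d] assms(3)[of d] f(2) f(3)[of d] g(3)[of d] by fastforce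
  then show ?thesis using f(5) by simp
qed

section \<open>The Cartan subalgebra is the zero weight space\<close>

lemma egen_wspace: "i \<in> simples G \<Longrightarrow> egen G i \<in> wspace G (unit_coeff i)"
  and fgen_wspace: "i \<in> simples G \<Longrightarrow> fgen G i \<in> wspace G (\<lambda>j. - unit_coeff i j)"
  using chevalley
  by (auto simp: are_chevalley_generators_def wspace_iff root_space_def weight_space_def
      simple_comb_unit simple_comb_minus)

lemma alg_least:
  assumes "lie_subalgebra K" "egen G ` simples G \<subseteq> K" "fgen G ` simples G \<subseteq> K"
  shows "alg G \<subseteq> K"
proof -
  have "lie_generated (egen G ` simples G \<union> fgen G ` simples G) = alg G"
    using chevalley by (simp add: are_chevalley_generators_def)
  then show ?thesis using assms unfolding lie_generated_def by blast
qed

lemma alg_weight_sum: "alg G = cvec.span (\<Union>c\<in>lattice G. wspace G c)" (is "_ = ?K")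
proof
  have "lie_subalgebra ?K"
    unfolding lie_subalgebra_def
  proof (intro conjI ballI)
    fix x y assume "x \<in> ?K" "y \<in> ?K"
    then show "bracket x y \<in> ?K"
    proof (rule bracket_span)
      fix x y assume "x \<in> (\<Union>c\<in>lattice G. wspace G c)" "y \<in> (\<Union>c\<in>lattice G. wspace G c)"
      then obtain c d where "c \<in> lattice G" "d \<in> lattice G" "x \<in> wspace G c" "y \<in> wspace G d" by blast
      then show "bracket x y \<in> ?K"
        using bracket_wspace[of x c y d] by (intro cvec.span_base) (auto intro!: bexI[of _ "\<lambda>i. c i + d i"])
    qed simp
  qed simp
  moreover have "egen G ` simples G \<subseteq> ?K" "fgen G ` simples G \<subseteq> ?K"
    using egen_wspace fgen_wspace by (fastforce intro!: cvec.span_base)+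
  ultimately show "alg G \<subseteq> ?K" by (rule alg_least)
  show "?K \<subseteq> alg G"
    using subspace_alg by (intro cvec.span_minimal) (auto simp: wspace_iff)
qed

lemma nilpotent_iterate:
  "h \<in> L \<Longrightarrow> x \<in> L \<Longrightarrow> (bracket h ^^ k) x \<in> lower_central L k"
  by (induction k) (auto intro: cvec.span_base)

text \<open>A nilpotent operator that is diagonalisable vanishes; this makes the Cartan subalgebra
  abelian. Its self-normalisation gives the other inclusion.\<close>

lemma cartan_eq_wspace: "cartan G = wspace G (\<lambda>_. 0)"
proof
  show "wspace G (\<lambda>_. 0) \<subseteq> cartan G"
  proof
    fix x assume x: "x \<in> wspace G (\<lambda>_. 0)"
    then have "bracket x h \<in> cartan G" if "h \<in> cartan G" for h
      using that bracket_antisym[of x h] subspace_cartan by (simp add: wspace_iff cvec.subspace_0)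
    then show "x \<in> cartan G" using x cartan by (auto simp: cartan_subalgebra_def wspace_iff)
  qed
  show "cartan G \<subseteq> wspace G (\<lambda>_. 0)"
  proof
    fix x assume x: "x \<in> cartan G"
    then have "x \<in> cvec.span (\<Union>c\<in>lattice G. wspace G c)" using cartan_sub alg_weight_sum by blast
    then obtain f F where f: "finite F" "F \<subseteq> lattice G" "\<And>d. f d \<in> cvec.span (wspace G d)"
      "\<And>d. d \<notin> F \<Longrightarrow> f d = 0" "x = sum f F"
      by (rule span_UN_decomposition) blast
    have fW: "f d \<in> wspace G d" for d using f(3) by simp
    obtain k where k: "lower_central (cartan G) k = {0}"
      using cartan by (auto simp: cartan_subalgebra_def nilpotent_lie_algebra_def)
    have "bracket h x = 0" if h: "h \<in> cartan G" for h
    proof -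
      have eig: "bracket h (f c) = simple_comb G c h *\<^sub>C f c" for c
        using fW h by (simp add: wspace_iff)
      have pow: "(bracket h ^^ m) x = (\<Sum>c\<in>F. simple_comb G c h ^ m *\<^sub>C f c)" for m
        by (induction m)
          (simp_all add: f(5) scaleC_one bracket_sum_right bracket_scaleC_right eig scaleC_scaleC mult.commute)
      have "(\<Sum>c\<in>F. simple_comb G c h ^ k *\<^sub>C f c) = 0"
        using nilpotent_iterate[OF h x, of k] pow k by simp
      moreover have "simple_comb G c h ^ k *\<^sub>C f c \<in> wspace G c" for c
        using fW subspace_wspace by (simp add: cvec.subspace_scale)
      ultimately have "simple_comb G c h ^ k *\<^sub>C f c = 0" if "c \<in> F" for c
        using weight_independent[of F "\<lambda>c. simple_comb G c h ^ k *\<^sub>C f c" c] f that by blast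
      then have "simple_comb G c h *\<^sub>C f c = 0" if "c \<in> F" for c
        using that by fastforce
      then show ?thesis using f(5) eig by (metis bracket_sum_right sum.neutral)
    qed
    then show "x \<in> wspace G (\<lambda>_. 0)" using x cartan_sub by (auto simp: wspace_iff)
  qed
qed

section \<open>Signs of roots\<close>

lemma root_coeffs_Phi: "Phi G = simple_comb G ` root_coeffs G"
proof
  show "Phi G \<subseteq> simple_comb G ` root_coeffs G"
  proof
    fix \<beta> assume \<beta>: "\<beta> \<in> Phi G"
    then obtain c where c: "\<beta> = simple_comb G c"
      using root_base unfolding is_root_base_def by blast
    define d where "d i = (if i \<in> simples G then c i else 0)" for i
    have d: "\<beta> = simple_comb G d"
      using c by (simp add: simple_comb_def d_def fun_eq_iff)
    have "d \<noteq> (\<lambda>_. 0)"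
      using \<beta> d by (auto simp: Phi_def root_set_def)
    then have "d \<in> root_coeffs G"
      using \<beta> d by (auto simp: root_coeffs_def lattice_def d_def wspace_def root_space_def Phi_def root_set_def)
    then show "\<beta> \<in> simple_comb G ` root_coeffs G" using d by blast
  qed
  show "simple_comb G ` root_coeffs G \<subseteq> Phi G"
  proof safe
    fix c assume c: "c \<in> root_coeffs G"
    have "simple_comb G c \<noteq> (\<lambda>_. 0)"
      using lattice_eqI[of c "\<lambda>_. 0"] c by (auto simp: root_coeffs_def)
    then show "simple_comb G c \<in> Phi G"
      using c simple_comb_form by (auto simp: root_coeffs_def Phi_def root_set_def wspace_def root_space_def)
  qed
qed

lemma root_coeffs_lattice: "c \<in> root_coeffs G \<Longrightarrow> c \<in> lattice G"
  by (simp add: root_coeffs_def)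

lemma root_coeffs_nonzero: "c \<in> root_coeffs G \<Longrightarrow> csupp c \<noteq> {}"
  by (auto simp: root_coeffs_def csupp_def)

lemma root_coeffs_csupp: "c \<in> root_coeffs G \<Longrightarrow> csupp c \<subseteq> simples G"
  by (auto simp: root_coeffs_def lattice_def csupp_def)

lemma root_sign:
  assumes "c \<in> root_coeffs G"
  shows "nonneg c \<or> nonpos c"
proof -
  have "simple_comb G c \<in> Phi G" using assms root_coeffs_Phi by blast
  then obtain d where d: "simple_comb G c = simple_comb G d"
      "(\<forall>i\<in>simples G. d i \<ge> 0) \<or> (\<forall>i\<in>simples G. d i \<le> 0)"
    using root_base unfolding is_root_base_def by blast
  have "c i = d i" if "i \<in> simples G" for i
    using simple_comb_eqD[of c d i] d that by simp
  then show ?thesis using d(2) root_coeffs_lattice[OF assms]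
    unfolding nonneg_def nonpos_def lattice_def by (metis (mono_tags, lifting) mem_Collect_eq order_refl)
qed

lemma wspace_trivial:
  "c \<in> lattice G \<Longrightarrow> c \<noteq> (\<lambda>_. 0) \<Longrightarrow> c \<notin> root_coeffs G \<Longrightarrow> wspace G c = {0}"
  by (simp add: root_coeffs_def)

lemma wspace_mixed:
  assumes "c \<in> lattice G" "c i > 0" "c j < 0"
  shows "wspace G c = {0}"
proof (rule wspace_trivial)
  show "c \<notin> root_coeffs G"
    using root_sign[of c] assms(2,3) unfolding nonneg_def nonpos_def by (meson not_le)
qed (use assms in auto)

lemma hbar_cartan: "i \<in> simples G \<Longrightarrow> hbar G i \<in> cartan G"
  unfolding cartan_eq_wspace hbar_def
  using bracket_wspace[OF egen_wspace[of i] fgen_wspace[of i]] by simp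

lemma bracket_egen_fgen:
  assumes "i \<in> simples G" "j \<in> simples G" "i \<noteq> j"
  shows "bracket (egen G i) (fgen G j) = 0"
proof -
  let ?c = "\<lambda>k. unit_coeff i k + - unit_coeff j k"
  have "?c \<in> lattice G" using assms by (simp add: lattice_def unit_coeff_def)
  then have "wspace G ?c = {0}"
    using assms by (intro wspace_mixed[of _ i j]) (auto simp: unit_coeff_def)
  then show ?thesis using bracket_wspace[OF egen_wspace fgen_wspace, of i j] assms by simp
qed

lemma fgen_egen: 
  assumes "i \<in> simples G" "j \<in> simples G"
  shows "bracket (fgen G i) (egen G j) = (if i = j then - hbar G i else 0)"
  using bracket_egen_fgen[of j i] bracket_antisym[of "fgen G i" "egen G j"] assms
  by (auto simp: hbar_def)

lemma sroot_hbar_self: "i \<in> simples G \<Longrightarrow> sroot G i (hbar G i) = 2"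
  using chevalley by (simp add: are_chevalley_generators_def)

lemma hbar_nonzero: "i \<in> simples G \<Longrightarrow> hbar G i \<noteq> 0"
  using sroot_hbar_self[of i] sroot_scale[of i 0 0] subspace_cartan
  by (auto simp: cvec.subspace_0)

lemma fgen_nonzero: "i \<in> simples G \<Longrightarrow> fgen G i \<noteq> 0"
  using hbar_nonzero[of i] by (auto simp: hbar_def)

lemma hbar_wspace: "i \<in> simples G \<Longrightarrow> x \<in> wspace G c \<Longrightarrow> bracket (hbar G i) x = simple_comb G c (hbar G i) *\<^sub>C x"
  using hbar_cartan by (simp add: wspace_iff)

section \<open>Monomials span the root spaces\<close>

text \<open>The elements mapping \<open>V\<close> into itself form a subalgebra, so that stability is a condition on
  the generators.\<close>

lemma normalizer_alg:
  assumes V: "cvec.subspace V"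
    and e: "\<And>i v. i \<in> simples G \<Longrightarrow> v \<in> V \<Longrightarrow> bracket (egen G i) v \<in> V"
    and f: "\<And>i v. i \<in> simples G \<Longrightarrow> v \<in> V \<Longrightarrow> bracket (fgen G i) v \<in> V"
    and "y \<in> alg G" "v \<in> V"
  shows "bracket y v \<in> V"
proof -
  let ?N = "{y. \<forall>v\<in>V. bracket y v \<in> V}"
  have "cvec.subspace ?N"
    using V by (auto simp: cvec.subspace_def bracket_add_left bracket_scaleC_left)
  moreover have "bracket (bracket x y) v \<in> V" if "x \<in> ?N" "y \<in> ?N" "v \<in> V" for x y v
  proof -
    have "bracket (bracket x y) v = bracket x (bracket y v) - bracket y (bracket x v)"
      using bracket_derivation[of x y v] by simp
    then show ?thesis using that V by (simp add: cvec.subspace_diff)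
  qed
  ultimately have "lie_subalgebra ?N" by (simp add: lie_subalgebra_def)
  then have "alg G \<subseteq> ?N" using e f by (intro alg_least) auto
  then show ?thesis using assms by blast
qed

lemma words_Cons: "i \<in> A \<Longrightarrow> w \<in> words A \<Longrightarrow> i # w \<in> words A"
  and words_single: "i \<in> A \<Longrightarrow> [i] \<in> words A"
  by (auto simp: words_def)

lemma word_weight_nonzero: "w \<in> words A \<Longrightarrow> \<exists>i. word_weight w i \<noteq> 0"
  by (rule exI[of _ "hd w"]) (auto simp: words_def word_weight_def count_list_0_iff)

lemma word_weight_lattice: "w \<in> words (simples G) \<Longrightarrow> word_weight w \<in> lattice G"
  by (auto simp: lattice_def word_weight_def words_def count_list_0_iff)

lemma monomial_wspace:
  "w \<in> words (simples G) \<Longrightarrow> monomial (egen G) w \<in> wspace G (word_weight w)"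
proof (induction w rule: induct_list012)
  case (3 i j w)
  then have "monomial (egen G) (j # w) \<in> wspace G (word_weight (j # w))" "i \<in> simples G"
    by (auto simp: words_def)
  then show ?case
    using bracket_wspace[OF egen_wspace] by (simp add: word_weight_Cons[of i])
qed (use egen_wspace in \<open>auto simp: words_def word_weight_Cons word_weight_Nil\<close>)

text \<open>The derivation \<open>bracket (fgen G i)\<close> turns a letter \<open>e\<^sub>i\<close> of a monomial into a vector of the Cartan
  subalgebra and kills the other letters, so that no monomials in the \<open>f\<^sub>j\<close> arise.\<close>

lemma fgen_monomial:
  assumes "i \<in> simples G" "w \<in> words (simples G)"
  shows "bracket (fgen G i) (monomial (egen G) w)
    \<in> cvec.span (monomial (egen G) ` words (simples G) \<union> hbar G ` simples G)" (is "_ \<in> ?V")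
  using assms(2)
proof (induction w rule: induct_list012)
  case 1
  then show ?case by (simp add: words_def)
next
  case (2 j)
  then show ?case using assms(1)
    by (auto simp: words_def fgen_egen cvec.span_zero intro!: cvec.span_neg intro: cvec.span_base)
next
  case (3 j k w)
  let ?m = "monomial (egen G) (k # w)"
  have w: "k # w \<in> words (simples G)" "j \<in> simples G" using 3 by (auto simp: words_def)
  have m: "?m \<in> ?V" using w by (intro cvec.span_base) blast
  have "bracket (hbar G i) ?m \<in> ?V"
    unfolding hbar_wspace[OF assms(1) monomial_wspace[OF w(1)]]
    using m by (rule cvec.span_scale)
  then have "bracket (bracket (fgen G i) (egen G j)) ?m \<in> ?V"
    using assms(1) w by (auto simp: fgen_egen bracket_minus_left cvec.span_zero cvec.span_neg)
  moreover have "bracket (egen G j) (bracket (fgen G i) ?m) \<in> ?V"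
  proof (rule bracket_span)
    show "egen G j \<in> cvec.span {egen G j}" by (simp add: cvec.span_base)
    show "bracket (fgen G i) ?m \<in> ?V" using 3 w by simp
    fix x y assume "x \<in> {egen G j}" and y: "y \<in> monomial (egen G) ` words (simples G) \<union> hbar G ` simples G"
    then have x: "x = egen G j" by simp
    from y show "bracket x y \<in> ?V"
    proof
      assume "y \<in> monomial (egen G) ` words (simples G)"
      then obtain v where v: "v \<in> words (simples G)" "y = monomial (egen G) v" by blast
      then have "bracket x y = monomial (egen G) (j # v)"
        by (simp add: x monomial_Cons words_def)
      then show ?thesis using words_Cons[OF w(2) v(1)] by (auto intro: cvec.span_base)
    next
      assume "y \<in> hbar G ` simples G"
      then obtain l where l: "l \<in> simples G" "y = hbar G l" by blast
      then have "bracket x y = - (simple_comb G (unit_coeff j) (hbar G l) *\<^sub>C egen G j)"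
        using bracket_antisym[of x y] hbar_wspace[OF l(1) egen_wspace[OF w(2)]] by (simp add: x)
      moreover have "egen G j \<in> ?V"
        using words_single[OF w(2)] by (intro cvec.span_base) force
      ultimately show ?thesis by (simp add: cvec.span_neg cvec.span_scale)
    qed
  qed simp
  ultimately show ?case
    using bracket_derivation[of "fgen G i" "egen G j" ?m] by (simp add: cvec.span_add)
qed

end

text \<open>Exchanging the generators \<open>e\<^sub>i\<close> and \<open>f\<^sub>i\<close> and negating the simple roots gives Chevalley data of
  the same type, so that statements on positive roots transfer to negative roots.\<close>

definition opposite :: "'a::complex_lie_algebra pinned_algebra \<Rightarrow> 'a pinned_algebra" where
  "opposite G = G\<lparr>sroot := (\<lambda>i h. - sroot G i h), egen := fgen G, fgen := egen G\<rparr>"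

lemma opposite_simps [simp]:
  "lie_type (opposite G) = lie_type G" "rank (opposite G) = rank G" "alg (opposite G) = alg G"
  "cartan (opposite G) = cartan G" "sroot (opposite G) i h = - sroot G i h"
  "egen (opposite G) = fgen G" "fgen (opposite G) = egen G" "simples (opposite G) = simples G"
  "Phi (opposite G) = Phi G" "lattice (opposite G) = lattice G"
  by (simp_all add: opposite_def simples_def Phi_def lattice_def)

lemma hbar_opposite [simp]: "hbar (opposite G) i = - hbar G i"
  using bracket_antisym by (simp add: hbar_def)

lemma simple_comb_opposite: "simple_comb (opposite G) c = simple_comb G (\<lambda>i. - c i)"
  by (simp add: simple_comb_def fun_eq_iff)

lemma wspace_opposite: "wspace (opposite G) c = wspace G (\<lambda>i. - c i)"
  by (auto simp: wspace_iff simple_comb_opposite)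

lemma root_space_opposite: "root_space (opposite G) \<beta> = root_space G \<beta>"
  by (simp add: root_space_def)

lemma root_coeffs_opposite: "c \<in> root_coeffs (opposite G) \<longleftrightarrow> (\<lambda>i. - c i) \<in> root_coeffs G"
  by (auto simp: root_coeffs_def wspace_opposite fun_eq_iff)

lemma unit_coeff_nonzero: "(\<lambda>j. - unit_coeff i j) \<noteq> (\<lambda>_. 0)"
  by (auto simp: fun_eq_iff unit_coeff_def)

lemma (in classical) classical_opposite: "classical_lie_algebra (opposite G)"
proof -
  have "is_root_base (opposite G)"
    unfolding is_root_base_def
  proof (intro conjI ballI allI impI)
    fix i assume "i \<in> simples (opposite G)"
    then have i: "i \<in> simples G" by simp
    have "(\<lambda>j. - unit_coeff i j) \<in> root_coeffs G"
      using i fgen_wspace[OF i] fgen_nonzero[OF i]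
      by (auto simp: root_coeffs_def unit_coeff_nonzero)
    then have "simple_comb G (\<lambda>j. - unit_coeff i j) \<in> Phi G" using root_coeffs_Phi by blast
    moreover have "simple_comb G (\<lambda>j. - unit_coeff i j) = sroot (opposite G) i"
      using i by (simp add: fun_eq_iff simple_comb_minus simple_comb_unit)
    ultimately show "sroot (opposite G) i \<in> Phi (opposite G)" by simp
  next
    fix c :: "nat \<Rightarrow> complex" and i
    assume "\<forall>h\<in>cartan (opposite G). (\<Sum>i\<in>simples (opposite G). c i * sroot (opposite G) i h) = 0"
      "i \<in> simples (opposite G)"
    then show "c i = 0" using root_base by (simp add: sum_negf is_root_base_def)
  next
    fix \<beta> assume "\<beta> \<in> Phi (opposite G)"
    then obtain c where c: "\<beta> = simple_comb G c" "c \<in> root_coeffs G"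
      using root_coeffs_Phi by auto
    have "\<beta> = simple_comb (opposite G) (\<lambda>i. - c i)"
      by (simp add: simple_comb_opposite c)
    moreover have "(\<forall>i\<in>simples G. - c i \<ge> 0) \<or> (\<forall>i\<in>simples G. - c i \<le> 0)"
      using root_sign[OF c(2)] by (auto simp: nonneg_def nonpos_def)
    ultimately show "\<exists>c. \<beta> = simple_comb (opposite G) c \<and>
        ((\<forall>i\<in>simples (opposite G). c i \<ge> 0) \<or> (\<forall>i\<in>simples (opposite G). c i \<le> 0))"
      unfolding opposite_simps by blast
  qed
  moreover have "sroot G i (- hbar G j) = - sroot G i (hbar G j)" if "i \<in> simples G" "j \<in> simples G" for i j
    using sroot_scale[OF that(1) hbar_cartan[OF that(2)], of "-1"] by (simp add: scaleC_one)
  moreover have "(\<lambda>h. - sroot (opposite G) i h) = sroot G i" "sroot (opposite G) i = (\<lambda>h. - sroot G i h)" for i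
    by (simp_all add: fun_eq_iff)
  ultimately show ?thesis
    using classical
    by (auto simp: classical_lie_algebra_def are_chevalley_generators_def root_space_opposite
        Un_commute hbar_cartan)
qed

context classical
begin

interpretation opp: classical "opposite G"
  by unfold_locales (rule classical_opposite)

text \<open>This is the triangular decomposition: the span on the right is stable under the generators,
  hence a subalgebra, and it contains them.\<close>

lemma alg_monomials:
  "alg G \<subseteq> cvec.span (monomial (egen G) ` words (simples G) \<union> hbar G ` simples G
     \<union> monomial (fgen G) ` words (simples G))" (is "_ \<subseteq> cvec.span (?E \<union> ?H \<union> ?F)")
proof -
  let ?K = "cvec.span (?E \<union> ?H \<union> ?F)"
  have opp_H: "cvec.span (?F \<union> hbar (opposite G) ` simples G) \<subseteq> ?K"
    by (intro cvec.span_minimal) (auto intro: cvec.span_base cvec.span_neg)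
  have E: "bracket (egen G i) v \<in> ?K" if i: "i \<in> simples G" and "v \<in> ?K" for i v
  proof (rule bracket_span[OF _ that(2)])
    show "egen G i \<in> cvec.span {egen G i}" by (simp add: cvec.span_base)
    fix x y assume "x \<in> {egen G i}" and y: "y \<in> ?E \<union> ?H \<union> ?F"
    then have x: "x = egen G i" by simp
    from y consider (E) w where "w \<in> words (simples G)" "y = monomial (egen G) w"
      | (H) l where "l \<in> simples G" "y = hbar G l"
      | (F) w where "w \<in> words (simples G)" "y = monomial (fgen G) w" by blast
    then show "bracket x y \<in> ?K"
    proof cases
      case E
      then have "bracket x y = monomial (egen G) (i # w)" by (simp add: x monomial_Cons words_def)
      then show ?thesis using words_Cons[OF i E(1)] by (auto intro!: cvec.span_base)
    next
      case H
      have "egen G i \<in> ?K" using words_single[OF i] by (intro cvec.span_base) force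
      moreover have "bracket x y = - (simple_comb G (unit_coeff i) (hbar G l) *\<^sub>C egen G i)"
        using H bracket_antisym[of x y] hbar_wspace[OF H(1) egen_wspace[OF i]] by (simp add: x)
      ultimately show ?thesis by (simp add: cvec.span_neg cvec.span_scale)
    next
      case F
      then show ?thesis using opp.fgen_monomial[of i w] i opp_H by (auto simp: x)
    qed
  qed simp
  have F: "bracket (fgen G i) v \<in> ?K" if i: "i \<in> simples G" and "v \<in> ?K" for i v
  proof (rule bracket_span[OF _ that(2)])
    show "fgen G i \<in> cvec.span {fgen G i}" by (simp add: cvec.span_base)
    fix x y assume "x \<in> {fgen G i}" and y: "y \<in> ?E \<union> ?H \<union> ?F"
    then have x: "x = fgen G i" by simp
    from y consider (E) w where "w \<in> words (simples G)" "y = monomial (egen G) w"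
      | (H) l where "l \<in> simples G" "y = hbar G l"
      | (F) w where "w \<in> words (simples G)" "y = monomial (fgen G) w" by blast
    then show "bracket x y \<in> ?K"
    proof cases
      case F
      then have "bracket x y = monomial (fgen G) (i # w)" by (simp add: x monomial_Cons words_def)
      then show ?thesis using words_Cons[OF i F(1)] by (auto intro!: cvec.span_base)
    next
      case H
      have "fgen G i \<in> ?K" using words_single[OF i] by (intro cvec.span_base) force
      moreover have "bracket x y = - (simple_comb G (\<lambda>j. - unit_coeff i j) (hbar G l) *\<^sub>C fgen G i)"
        using H bracket_antisym[of x y] hbar_wspace[OF H(1) fgen_wspace[OF i]] by (simp add: x)
      ultimately show ?thesis by (simp add: cvec.span_neg cvec.span_scale)
    next
      case E
      have "cvec.span (?E \<union> ?H) \<subseteq> ?K" by (intro cvec.span_mono) blast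
      then show ?thesis using fgen_monomial[OF i E(1)] E by (auto simp: x)
    qed
  qed simp
  have gens: "egen G i \<in> ?K" "fgen G i \<in> ?K" if "i \<in> simples G" for i
    using words_single[OF that] by (force intro!: cvec.span_base)+
  have "bracket y v \<in> ?K" if "y \<in> alg G" "v \<in> ?K" for y v
    by (rule normalizer_alg[OF _ E F that]) simp_all
  moreover have "?K \<subseteq> alg G"
    using monomial_wspace opp.monomial_wspace hbar_cartan cartan_sub
    by (intro cvec.span_minimal subspace_alg) (auto simp: wspace_iff)
  ultimately have "lie_subalgebra ?K" by (auto simp: lie_subalgebra_def)
  then show ?thesis using gens by (intro alg_least) auto
qed

text \<open>The weight of a word in the \<open>e\<^sub>i\<close> is nonnegative, that of a word in the \<open>f\<^sub>i\<close> is nonpositive; the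
  zero weight is left to the \<open>hbar G i\<close>.\<close>

lemma graded_monomials:
  assumes "x \<in> wspace G c" "c \<in> lattice G"
  shows "x \<in> cvec.span ({monomial (egen G) w | w. w \<in> words (simples G) \<and> word_weight w = c}
    \<union> {hbar G i | i. i \<in> simples G \<and> c = (\<lambda>_. 0)}
    \<union> {monomial (fgen G) w | w. w \<in> words (simples G) \<and> (\<lambda>j. - word_weight w j) = c})"
    (is "x \<in> cvec.span (?X c)")
proof (rule graded_component[OF _ _ assms])
  show "?X d \<subseteq> wspace G d" for d
    using monomial_wspace opp.monomial_wspace hbar_cartan cartan_eq_wspace
    by (auto simp: wspace_opposite)
  have "x \<in> cvec.span (monomial (egen G) ` words (simples G) \<union> hbar G ` simples G
     \<union> monomial (fgen G) ` words (simples G))"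
    using assms(1) alg_monomials by (auto simp: wspace_iff)
  moreover have "monomial (egen G) ` words (simples G) \<union> hbar G ` simples G
     \<union> monomial (fgen G) ` words (simples G) \<subseteq> (\<Union>d\<in>lattice G. ?X d)"
  proof (intro Un_least subsetI)
    fix y assume "y \<in> monomial (egen G) ` words (simples G)"
    then obtain w where "w \<in> words (simples G)" "y = monomial (egen G) w" by blast
    then show "y \<in> (\<Union>d\<in>lattice G. ?X d)"
      by (intro UN_I[OF word_weight_lattice[of w]]) auto
  next
    fix y assume "y \<in> hbar G ` simples G"
    then show "y \<in> (\<Union>d\<in>lattice G. ?X d)"
      by (intro UN_I[of "\<lambda>_. 0"]) auto
  next
    fix y assume "y \<in> monomial (fgen G) ` words (simples G)"
    then obtain w where w: "w \<in> words (simples G)" "y = monomial (fgen G) w" by blast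
    show "y \<in> (\<Union>d\<in>lattice G. ?X d)"
      by (rule UN_I[of "\<lambda>j. - word_weight w j"]) (use w word_weight_lattice in auto)
  qed
  ultimately show "x \<in> cvec.span (\<Union>d\<in>lattice G. ?X d)"
    using cvec.span_mono by blast
qed

lemma nonneg_word: "w \<in> words A \<Longrightarrow> nonneg (\<lambda>j. - word_weight w j) \<Longrightarrow> False"
  using csupp_word_weight[of w] nonneg_word_weight[of w]
  by (auto simp: words_def nonneg_def csupp_def) (metis antisym empty_iff list.set_sel(1) mem_Collect_eq)

text \<open>The root space is described by the generators \<open>e\<^sub>i\<close> with \<open>i\<close> in the support alone. The
  comparison of the two Lie algebras and the connectedness of supports rest on this.\<close>

lemma wspace_positive:
  assumes "c \<in> lattice G" "c \<noteq> (\<lambda>_. 0)" "nonneg c"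
  shows "wspace G c = cvec.span {monomial (egen G) w | w. w \<in> words (simples G) \<and> word_weight w = c}"
    (is "_ = cvec.span ?M")
proof
  have "\<not> (w \<in> words (simples G) \<and> (\<lambda>j. - word_weight w j) = c)" for w
    using nonneg_word[of w] assms(3) by auto
  then have "?M \<union> {hbar G i | i. i \<in> simples G \<and> c = (\<lambda>_. 0)}
    \<union> {monomial (fgen G) w | w. w \<in> words (simples G) \<and> (\<lambda>j. - word_weight w j) = c} = ?M"
    using assms(2) by blast
  then show "wspace G c \<subseteq> cvec.span ?M"
    using graded_monomials[of _ c] assms(1) by auto
  show "cvec.span ?M \<subseteq> wspace G c"
    using subspace_wspace monomial_wspace by (intro cvec.span_minimal) auto
qed

lemma cartan_hbar: "cartan G = cvec.span (hbar G ` simples G)"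
proof
  have "word_weight w \<noteq> (\<lambda>_. 0)" "(\<lambda>j. - word_weight w j) \<noteq> (\<lambda>_. 0)" if "w \<in> words (simples G)" for w
  proof -
    obtain i where "word_weight w i \<noteq> 0" using word_weight_nonzero \<open>w \<in> words (simples G)\<close> by blast
    then show "word_weight w \<noteq> (\<lambda>_. 0)" "(\<lambda>j. - word_weight w j) \<noteq> (\<lambda>_. 0)"
      by (auto dest: fun_cong[of _ _ i])
  qed
  then have "{monomial (egen G) w | w. w \<in> words (simples G) \<and> word_weight w = (\<lambda>_. 0)}
    \<union> {hbar G i | i. i \<in> simples G \<and> (\<lambda>_. 0 :: int) = (\<lambda>_::nat. 0)}
    \<union> {monomial (fgen G) w | w. w \<in> words (simples G) \<and> (\<lambda>j. - word_weight w j) = (\<lambda>_. 0)}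
    = hbar G ` simples G" by auto
  then show "cartan G \<subseteq> cvec.span (hbar G ` simples G)"
    using graded_monomials[of _ "\<lambda>_. 0"] by (simp add: cartan_eq_wspace subset_iff)
  show "cvec.span (hbar G ` simples G) \<subseteq> cartan G"
    using subspace_cartan hbar_cartan by (intro cvec.span_minimal) auto
qed

section \<open>Roots have connected support\<close>

lemma dynkin_edge_sym: "dynkin_edge X i j \<longleftrightarrow> dynkin_edge X j i"
  by (simp add: dynkin_edge_def insert_commute)

lemma dynkin_edge_iff:
  "1 \<le> i \<Longrightarrow> 1 \<le> j \<Longrightarrow> dynkin_edge X i j \<longleftrightarrow>
    (if X = TypeD then i = 1 \<and> j = 3 \<or> i = 3 \<and> j = 1 \<or> 2 \<le> i \<and> j = Suc i \<or> 2 \<le> j \<and> i = Suc j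
     else j = Suc i \<or> i = Suc j)"
  by (auto simp: dynkin_edge_def doubleton_eq_iff)

text \<open>The vector \<open>x = [e\<^sub>i, e\<^sub>j]\<close> is annihilated by all \<open>f\<^sub>k\<close>, because the Cartan integers of \<open>i\<close> and \<open>j\<close>
  vanish. Hence the ideal generated by \<open>x\<close> is obtained by applying the \<open>e\<^sub>k\<close> only and has positive
  weights only. It does not contain \<open>f\<^sub>i\<close>, so that by simplicity it is zero.\<close>

lemma egen_commute:
  assumes i: "i \<in> simples G" and j: "j \<in> simples G" and ne: "i \<noteq> j"
    and edge: "\<not> dynkin_edge (lie_type G) i j"
  shows "bracket (egen G i) (egen G j) = 0"
proof -
  define x where "x = bracket (egen G i) (egen G j)"
  define ad where "ad w = foldr (\<lambda>k. bracket (egen G k)) w x" for w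
  define c where "c w = (\<lambda>k. word_weight w k + (unit_coeff i k + unit_coeff j k))" for w
  define A where "A = {w. set w \<subseteq> simples G}"
  let ?I = "cvec.span (ad ` A)"
  have x_W: "x \<in> wspace G (\<lambda>k. unit_coeff i k + unit_coeff j k)"
    unfolding x_def using i j by (intro bracket_wspace egen_wspace)
  have ad_W: "ad w \<in> wspace G (c w)" if "w \<in> A" for w
    using that
  proof (induction w)
    case Nil
    then show ?case using x_W by (simp add: ad_def c_def word_weight_Nil)
  next
    case (Cons k w)
    then show ?case using bracket_wspace[OF egen_wspace[of k], of "ad w" "c w"]
      by (simp add: ad_def A_def c_def word_weight_Cons add.assoc)
  qed
  have entries: "sroot G j (hbar G i) = 0" "sroot G i (hbar G j) = 0"
    using i j ne edge by (auto simp: sroot_hbar cartan_entry_def dynkin_edge_sym[of _ j])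
  have f_x: "bracket (fgen G k) x = 0" if k: "k \<in> simples G" for k
  proof -
    have "bracket (hbar G i) (egen G j) = 0"
      using hbar_wspace[OF i egen_wspace[OF j]] entries j by (simp add: simple_comb_unit)
    moreover have "bracket (egen G i) (hbar G j) = 0"
      using hbar_wspace[OF j egen_wspace[OF i]] entries i bracket_antisym[of "egen G i" "hbar G j"]
      by (simp add: simple_comb_unit)
    ultimately show ?thesis
      using bracket_derivation[of "fgen G k" "egen G i" "egen G j"] i j k
      by (auto simp: x_def fgen_egen bracket_minus_left bracket_minus_right)
  qed
  have e_I: "bracket (egen G k) v \<in> ?I" if k: "k \<in> simples G" and "v \<in> ?I" for k v
  proof (rule bracket_span[OF _ that(2)])
    show "egen G k \<in> cvec.span {egen G k}" by (simp add: cvec.span_base)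
    fix y z assume "y \<in> {egen G k}" "z \<in> ad ` A"
    then obtain w where w: "y = egen G k" "w \<in> A" "z = ad w" by blast
    then have "bracket y z = ad (k # w)" "k # w \<in> A" using k by (simp_all add: ad_def A_def)
    then show "bracket y z \<in> ?I" by (auto intro: cvec.span_base)
  qed simp
  have f_ad: "bracket (fgen G k) (ad w) \<in> ?I" if k: "k \<in> simples G" and "w \<in> A" for k w
    using that(2)
  proof (induction w)
    case Nil
    then show ?case using f_x[OF k] by (simp add: ad_def cvec.span_zero)
  next
    case (Cons l w)
    then have w: "w \<in> A" and l: "l \<in> simples G" by (auto simp: A_def)
    have "bracket (hbar G k) (ad w) \<in> ?I"
      using w by (simp add: hbar_wspace[OF k ad_W] cvec.span_scale cvec.span_base)
    then have "bracket (bracket (fgen G k) (egen G l)) (ad w) \<in> ?I"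
      using k l by (auto simp: fgen_egen bracket_minus_left cvec.span_zero cvec.span_neg)
    moreover have "bracket (egen G l) (bracket (fgen G k) (ad w)) \<in> ?I"
      using e_I[OF l] Cons.IH[OF w] .
    moreover have "ad (l # w) = bracket (egen G l) (ad w)" by (simp add: ad_def)
    ultimately show ?case
      using bracket_derivation[of "fgen G k" "egen G l" "ad w"] by (simp add: cvec.span_add)
  qed
  have f_I: "bracket (fgen G k) v \<in> ?I" if k: "k \<in> simples G" and "v \<in> ?I" for k v
  proof (rule bracket_span[OF _ that(2)])
    show "fgen G k \<in> cvec.span {fgen G k}" by (simp add: cvec.span_base)
  qed (use f_ad[OF k] in auto)
  have "lie_ideal ?I (alg G)"
    unfolding lie_ideal_def
  proof (intro conjI ballI)
    show "?I \<subseteq> alg G"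
      using ad_W subspace_alg by (intro cvec.span_minimal) (auto simp: wspace_iff)
  next
    fix y v assume "y \<in> alg G" "v \<in> ?I"
    then show "bracket y v \<in> ?I" by (intro normalizer_alg[OF _ e_I f_I]) simp_all
  qed simp
  then have "?I = {0} \<or> ?I = alg G"
    using simple_alg by (simp add: simple_lie_algebra_def)
  moreover have "?I \<noteq> alg G"
  proof
    assume "?I = alg G"
    then have "fgen G i \<in> ?I" using fgen_wspace[OF i] by (simp add: wspace_iff)
    moreover have "ad ` A \<subseteq> (\<Union>d\<in>lattice G. {ad w | w. w \<in> A \<and> c w = d})"
    proof
      fix y assume "y \<in> ad ` A"
      then obtain w where w: "w \<in> A" "y = ad w" by blast
      have "c w \<in> lattice G"
        using w i j by (auto simp: A_def c_def lattice_def word_weight_def unit_coeff_def count_list_0_iff)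
      then show "y \<in> (\<Union>d\<in>lattice G. {ad w | w. w \<in> A \<and> c w = d})" using w by blast
    qed
    ultimately have "fgen G i \<in> cvec.span (\<Union>d\<in>lattice G. {ad w | w. w \<in> A \<and> c w = d})"
      using cvec.span_mono by blast
    then have "fgen G i \<in> cvec.span {ad w | w. w \<in> A \<and> c w = (\<lambda>j. - unit_coeff i j)}"
      by (rule graded_component[rotated]) (use fgen_wspace[OF i] i ad_W in auto)
    moreover have "c w \<noteq> (\<lambda>j. - unit_coeff i j)" for w
    proof
      assume "c w = (\<lambda>j. - unit_coeff i j)"
      then have "c w i = - unit_coeff i i" by simp
      then show False by (simp add: c_def word_weight_def unit_coeff_def split: if_splits)
    qed
    ultimately show False using fgen_nonzero[OF i] by simp
  qed
  ultimately have "?I = {0}" by simp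
  moreover have "x \<in> ?I" by (rule cvec.span_base) (auto simp: ad_def A_def intro!: image_eqI[of _ _ "[]"])
  ultimately show ?thesis by (simp add: x_def)
qed

lemma bracket_commuting_monomial:
  "(\<And>j. j \<in> set w \<Longrightarrow> bracket y (egen G j) = 0) \<Longrightarrow> bracket y (monomial (egen G) w) = 0"
proof (induction w rule: induct_list012)
  case (3 j k w)
  then show ?case using bracket_derivation[of y "egen G j" "monomial (egen G) (k # w)"] by simp
qed auto

text \<open>Either the tail of the word already meets both \<open>A\<close> and \<open>B\<close>, or the first letter commutes with
  all letters of the tail.\<close>

lemma monomial_disconnected:
  assumes "A \<subseteq> simples G" "B \<subseteq> simples G" "A \<inter> B = {}"
    and no_edge: "\<And>i j. i \<in> A \<Longrightarrow> j \<in> B \<Longrightarrow> \<not> dynkin_edge (lie_type G) i j"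
    and "set w \<subseteq> A \<union> B" "set w \<inter> A \<noteq> {}" "set w \<inter> B \<noteq> {}"
  shows "monomial (egen G) w = 0"
  using assms(5-7)
proof (induction w)
  case (Cons i w)
  have commute: "bracket (egen G k) (egen G l) = 0" if "k \<in> A \<and> l \<in> B \<or> k \<in> B \<and> l \<in> A" for k l
    using that assms(1-3) no_edge[of k l] no_edge[of l k] egen_commute[of k l] dynkin_edge_sym by blast
  show ?case
  proof (cases "set w \<inter> A \<noteq> {} \<and> set w \<inter> B \<noteq> {}")
    case True
    then have "monomial (egen G) w = 0" "w \<noteq> []" using Cons by auto
    then show ?thesis by (simp add: monomial_Cons)
  next
    case False
    then have "i \<in> A \<and> set w \<subseteq> B \<or> i \<in> B \<and> set w \<subseteq> A" and "w \<noteq> []"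
      using Cons.prems assms(3) by auto
    then show ?thesis
      using bracket_commuting_monomial[of w "egen G i"] commute by (auto simp: monomial_Cons)
  qed
qed simp

text \<open>A nonzero root space contains a nonzero monomial, whose letters form the support.\<close>

lemma positive_root_connected:
  assumes "c \<in> root_coeffs G" "nonneg c"
    and AB: "A \<subseteq> simples G" "B \<subseteq> simples G" "A \<inter> B = {}"
      "\<And>i j. i \<in> A \<Longrightarrow> j \<in> B \<Longrightarrow> \<not> dynkin_edge (lie_type G) i j"
    and "csupp c \<subseteq> A \<union> B"
  shows "csupp c \<subseteq> A \<or> csupp c \<subseteq> B"
proof (rule ccontr)
  assume "\<not> ?thesis"
  then have "csupp c \<inter> A \<noteq> {}" "csupp c \<inter> B \<noteq> {}" using assms(7) by blast+
  then have "monomial (egen G) w = 0" if "word_weight w = c" for w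
    using monomial_disconnected[OF AB, of w] assms(7) that csupp_word_weight[of w] by simp
  then have "cvec.span {monomial (egen G) w | w. w \<in> words (simples G) \<and> word_weight w = c} \<subseteq> {0}"
    by (intro cvec.span_minimal) auto
  then have "wspace G c \<subseteq> {0}"
    using wspace_positive[of c] assms(1,2) by (simp add: root_coeffs_def)
  then show False using assms(1) subspace_wspace[of c] by (auto simp: root_coeffs_def cvec.subspace_def)
qed

end

context classical
begin

interpretation opp: classical "opposite G"
  by unfold_locales (rule classical_opposite)

lemma root_connected:
  assumes "c \<in> root_coeffs G"
    and AB: "A \<subseteq> simples G" "B \<subseteq> simples G" "A \<inter> B = {}"
      "\<And>i j. i \<in> A \<Longrightarrow> j \<in> B \<Longrightarrow> \<not> dynkin_edge (lie_type G) i j"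
    and "csupp c \<subseteq> A \<union> B"
  shows "csupp c \<subseteq> A \<or> csupp c \<subseteq> B"
proof (cases "nonneg c")
  case True
  then show ?thesis using positive_root_connected assms by blast
next
  case False
  then have "nonpos c" using root_sign[OF assms(1)] by blast
  then have "nonneg (\<lambda>i. - c i)" by (simp add: nonneg_def nonpos_def)
  moreover have "(\<lambda>i. - c i) \<in> root_coeffs (opposite G)"
    using assms(1) by (simp add: root_coeffs_opposite)
  moreover have "csupp (\<lambda>i. - c i) = csupp c" by (simp add: csupp_def)
  ultimately show ?thesis using opp.positive_root_connected[of "\<lambda>i. - c i" A B] assms by simp
qed

section \<open>The orthogonal basis of the Cartan subalgebra\<close>

lemma hvec_cartan: "i \<in> simples G \<Longrightarrow> hvec G i \<in> cartan G"
proof (induction i)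
  case 0
  then show ?case by (simp add: simples_def)
next
  case (Suc k)
  have two: "{1, 2} \<subseteq> simples G" using rank_ge by (auto simp: simples_def split: if_splits)
  show ?case
  proof (cases "k = 0")
    case True
    then show ?thesis using two hbar_cartan subspace_cartan
      by (auto simp: cvec.subspace_scale cvec.subspace_diff split: classical_type.split)
  next
    case False
    then have "k \<in> simples G" using Suc.prems by (auto simp: simples_def)
    then show ?thesis using False Suc hbar_cartan[of "Suc k"] subspace_cartan
      by (simp add: cvec.subspace_add)
  qed
qed

lemma cartan_hvec: "cartan G = cvec.span (hvec G ` simples G)"
proof
  have two: "1 \<in> simples G" "2 \<in> simples G" using rank_ge by (auto simp: simples_def split: if_splits)
  have step: "hbar G (Suc k) = hvec G (Suc k) - hvec G k" if "k \<noteq> 0" for k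
    using that by simp
  have hv: "hvec G i \<in> cvec.span (hvec G ` simples G)" if "i \<in> simples G" for i
    using that by (intro cvec.span_base) auto
  have hb: "hbar G i \<in> cvec.span (hvec G ` simples G)" if "i \<in> simples G" "i \<ge> 2" for i
  proof -
    have "i - 1 \<in> simples G" using that by (auto simp: simples_def)
    then have "hvec G i - hvec G (i - 1) \<in> cvec.span (hvec G ` simples G)"
      using hv that(1) by (intro cvec.span_diff)
    then show ?thesis using step[of "i - 1"] that(2) by simp
  qed
  have "hbar G 1 = (case lie_type G of TypeB \<Rightarrow> 2 *\<^sub>C hvec G 1 | TypeC \<Rightarrow> hvec G 1
      | TypeD \<Rightarrow> 2 *\<^sub>C hvec G 1 + hbar G 2)"
    by (auto simp: scaleC_scaleC scaleC_one split: classical_type.split)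
  also have "\<dots> \<in> cvec.span (hvec G ` simples G)"
    using hv[OF two(1)] hb[OF two(2)]
    by (auto intro: cvec.span_add cvec.span_scale simp del: hvec.simps split: classical_type.split)
  finally have "hbar G 1 \<in> cvec.span (hvec G ` simples G)" .
  then have "hbar G i \<in> cvec.span (hvec G ` simples G)" if "i \<in> simples G" for i
    using hb[of i] that by (cases "i = 1") (auto simp: simples_def)
  then show "cartan G \<subseteq> cvec.span (hvec G ` simples G)"
    unfolding cartan_hbar by (intro cvec.span_minimal) auto
  show "cvec.span (hvec G ` simples G) \<subseteq> cartan G"
    using hvec_cartan subspace_cartan by (intro cvec.span_minimal) auto
qed

lemma sroot_diff: "i \<in> simples G \<Longrightarrow> x \<in> cartan G \<Longrightarrow> y \<in> cartan G \<Longrightarrow>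
    sroot G i (x - y) = sroot G i x - sroot G i y"
  using sroot_add[of i x "- y"] sroot_scale[of i y "- 1"] subspace_cartan
  by (simp add: cvec.subspace_neg scaleC_one)

text \<open>In the standard coordinates, in which \<open>\<alpha>\<^sub>j\<close> is the difference of the coordinates \<open>j\<close> and \<open>j - 1\<close>
  for \<open>j \<ge> 2\<close> and \<open>\<alpha>\<^sub>1\<close> is the first coordinate, twice the first coordinate or the sum of the first two,
  \<open>hvec G i\<close> is the \<open>i\<close>-th basis vector.\<close>

lemma sroot_hvec:
  assumes "i \<in> simples G" "j \<in> simples G"
  shows "sroot G j (hvec G i) =
    (if j = 1 then
       (case lie_type G of TypeB \<Rightarrow> if i = 1 then 1 else 0
        | TypeC \<Rightarrow> if i = 1 then 2 else 0
        | TypeD \<Rightarrow> if i = 1 \<or> i = 2 then 1 else 0)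
     else if i = j then 1 else if Suc i = j then - 1 else 0)"
  using assms(1)
proof (induction i)
  case 0
  then show ?case by (simp add: simples_def)
next
  case (Suc k)
  have two: "1 \<in> simples G" "2 \<in> simples G" using rank_ge by (auto simp: simples_def split: if_splits)
  have j: "j \<ge> 1" using assms(2) by (simp add: simples_def)
  show ?case
  proof (cases "k = 0")
    case True
    have "sroot G j (hvec G 1) = (case lie_type G of TypeB \<Rightarrow> 1/2 * sroot G j (hbar G 1)
         | TypeC \<Rightarrow> sroot G j (hbar G 1)
         | TypeD \<Rightarrow> 1/2 * (sroot G j (hbar G 1) - sroot G j (hbar G 2)))"
      using assms(2) two hbar_cartan subspace_cartan
      by (auto simp: sroot_scale sroot_diff cvec.subspace_diff split: classical_type.split)
    then show ?thesis
      using True j two assms(2)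
      by (cases "lie_type G")
        (auto simp: sroot_hbar cartan_entry_def dynkin_edge_iff simp del: hvec.simps split: if_splits)
  next
    case False
    then have k: "k \<in> simples G" using Suc.prems by (auto simp: simples_def)
    have "sroot G j (hvec G (Suc k)) = sroot G j (hbar G (Suc k)) + sroot G j (hvec G k)"
      using False assms(2) hbar_cartan[OF Suc.prems] hvec_cartan[OF k] by (simp add: sroot_add)
    then show ?thesis
      using False j Suc.IH[OF k] sroot_hbar[OF Suc.prems assms(2)]
      by (cases "lie_type G")
        (auto simp: cartan_entry_def dynkin_edge_iff simp del: hvec.simps split: if_splits)
  qed
qed

text \<open>Evaluating \<open>\<alpha>\<^sub>j\<close> for \<open>j \<ge> 2\<close> shows that all coefficients are equal, and \<open>\<alpha>\<^sub>1\<close> shows that they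
  vanish.\<close>

lemma hvec_independent:
  assumes "(\<Sum>i\<in>simples G. a i *\<^sub>C hvec G i) = 0" "i \<in> simples G"
  shows "a i = 0"
proof -
  have sum: "(\<Sum>i\<in>simples G. a i * sroot G j (hvec G i)) = 0" if j: "j \<in> simples G" for j
  proof -
    have "sroot G j (\<Sum>i\<in>F. a i *\<^sub>C hvec G i) = (\<Sum>i\<in>F. a i * sroot G j (hvec G i))"
      if "F \<subseteq> simples G" for F
      using finite_subset[OF that finite_simples] that
    proof (induction F rule: finite_induct)
      case empty
      show ?case using sroot_scale[OF j, of 0 0] subspace_cartan by (simp add: cvec.subspace_0)
    next
      case (insert l F)
      have "a l *\<^sub>C hvec G l \<in> cartan G" "(\<Sum>i\<in>F. a i *\<^sub>C hvec G i) \<in> cartan G"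
        using insert.prems hvec_cartan subspace_cartan
        by (auto intro!: cvec.subspace_sum cvec.subspace_scale)
      then show ?case using insert hvec_cartan by (simp add: sroot_add sroot_scale j)
    qed
    from this[of "simples G"] show ?thesis
      using assms(1) sroot_scale[OF j, of 0 0] subspace_cartan by (simp add: cvec.subspace_0)
  qed
  have two: "1 \<in> simples G" "2 \<in> simples G" using rank_ge by (auto simp: simples_def split: if_splits)
  have rec: "a (Suc k) = a k" if "Suc k \<in> simples G" "k \<ge> 1" for k
  proof -
    have k: "k \<in> simples G" using that by (auto simp: simples_def)
    have "(\<Sum>i\<in>simples G. a i * sroot G (Suc k) (hvec G i)) =
        (\<Sum>i\<in>{k, Suc k}. a i * sroot G (Suc k) (hvec G i))"
      using that k by (intro sum.mono_neutral_right) (auto simp: sroot_hvec)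
    then show ?thesis using sum[OF that(1)] that k by (simp add: sroot_hvec del: hvec.simps)
  qed
  have one: "a 1 = 0"
  proof -
    have "(\<Sum>i\<in>simples G. a i * sroot G 1 (hvec G i)) =
        (\<Sum>i\<in>{1, 2}. a i * sroot G 1 (hvec G i))"
      using two by (intro sum.mono_neutral_right) (auto simp: sroot_hvec split: classical_type.split)
    then have "a 1 * sroot G 1 (hvec G 1) + a 2 * sroot G 1 (hvec G 2) = 0"
      using sum[OF two(1)] by simp
    then show ?thesis
      using two rec[of 1] by (cases "lie_type G") (simp_all add: sroot_hvec numeral_2_eq_2 del: hvec.simps)
  qed
  show ?thesis using assms(2)
  proof (induction i)
    case 0
    then show ?case by (simp add: simples_def)
  next
    case (Suc k)
    then show ?case using one rec[of k] by (cases "k = 0") (auto simp: simples_def)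
  qed
qed

end

section \<open>Subspaces spanned by vectors of the Cartan subalgebra and root spaces\<close>

text \<open>All subspaces in question have this form; statements about them become statements about sets of
  coefficient vectors.\<close>

definition graded_span ::
  "'a::complex_lie_algebra pinned_algebra \<Rightarrow> nat set \<Rightarrow> (nat \<Rightarrow> int) set \<Rightarrow> 'a set" where
  "graded_span G I P = cvec.span (hvec G ` I \<union> (\<Union>c\<in>P. wspace G c))"

lemma subspace_graded_span [simp]: "cvec.subspace (graded_span G I P)"
  by (simp add: graded_span_def)

lemma graded_span_mono: "I \<subseteq> J \<Longrightarrow> P \<subseteq> Q \<Longrightarrow> graded_span G I P \<subseteq> graded_span G J Q"
  unfolding graded_span_def by (intro cvec.span_mono) blast

lemma graded_span_subsetD:
  "x \<in> graded_span G I P \<Longrightarrow> I \<subseteq> J \<Longrightarrow> P \<subseteq> Q \<Longrightarrow> x \<in> graded_span G J Q"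
  using graded_span_mono by blast

lemma graded_span_Un:
  "graded_span G (I \<union> J) (P \<union> Q) =
    {x + y | x y. x \<in> graded_span G I P \<and> y \<in> graded_span G J Q}"
proof -
  have "hvec G ` (I \<union> J) \<union> (\<Union>c\<in>P \<union> Q. wspace G c) =
    (hvec G ` I \<union> (\<Union>c\<in>P. wspace G c)) \<union> (hvec G ` J \<union> (\<Union>c\<in>Q. wspace G c))"
    by blast
  then show ?thesis by (simp only: graded_span_def cvec.span_Un)
qed

context classical
begin

text \<open>In a bracket of root spaces for \<open>a\<close> and \<open>b\<close>, only the weight \<open>a + b\<close> matters, and only if it
  is a root; the case \<open>a + b = 0\<close>, where the bracket lies in the Cartan subalgebra, is excluded.\<close>

lemma bracket_graded_span:
  assumes "x \<in> graded_span G I P" "y \<in> graded_span G {} Q"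
    and I: "I \<subseteq> simples G" and P: "P \<subseteq> root_coeffs G" and Q: "Q \<subseteq> root_coeffs G"
    and hvec: "\<And>i b. i \<in> I \<Longrightarrow> b \<in> Q \<Longrightarrow> b \<in> N \<or> simple_comb G b (hvec G i) = 0"
    and nonzero: "\<And>a b. a \<in> P \<Longrightarrow> b \<in> Q \<Longrightarrow> \<exists>k. a k + b k \<noteq> 0"
    and root: "\<And>a b. a \<in> P \<Longrightarrow> b \<in> Q \<Longrightarrow> (\<lambda>k. a k + b k) \<in> root_coeffs G \<Longrightarrow>
      (\<lambda>k. a k + b k) \<in> N"
  shows "bracket x y \<in> graded_span G {} N"
  using assms(1,2) unfolding graded_span_def
proof (rule bracket_span)
  fix x y
  assume x: "x \<in> hvec G ` I \<union> (\<Union>c\<in>P. wspace G c)" and "y \<in> hvec G ` {} \<union> (\<Union>c\<in>Q. wspace G c)"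
  then obtain b where b: "b \<in> Q" "y \<in> wspace G b" by auto
  from x show "bracket x y \<in> cvec.span (hvec G ` {} \<union> (\<Union>c\<in>N. wspace G c))"
  proof
    assume "x \<in> hvec G ` I"
    then obtain i where i: "i \<in> I" "x = hvec G i" by blast
    then have "bracket x y = simple_comb G b (hvec G i) *\<^sub>C y"
      using b I hvec_cartan[of i] by (auto simp: wspace_iff)
    moreover have "y \<in> cvec.span (hvec G ` {} \<union> (\<Union>c\<in>N. wspace G c))" if "b \<in> N"
      using that b by (intro cvec.span_base) auto
    ultimately show ?thesis
      using hvec[OF i(1) b(1)] cvec.span_scale cvec.span_zero by (cases "b \<in> N") auto
  next
    assume "x \<in> (\<Union>c\<in>P. wspace G c)"
    then obtain a where a: "a \<in> P" "x \<in> wspace G a" by blast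
    let ?c = "\<lambda>k. a k + b k"
    have br: "bracket x y \<in> wspace G ?c" using bracket_wspace a b by blast
    have c: "?c \<in> lattice G" "?c \<noteq> (\<lambda>_. 0)"
      using root_coeffs_lattice[of a] root_coeffs_lattice[of b] a b P Q nonzero[OF a(1) b(1)]
      by (auto simp: subset_iff dest: fun_cong)
    show ?thesis
    proof (cases "?c \<in> root_coeffs G")
      case True
      then show ?thesis using root[OF a(1) b(1)] br by (auto intro!: cvec.span_base)
    next
      case False
      then show ?thesis using wspace_trivial[OF c] br by (simp add: cvec.span_zero)
    qed
  qed
qed simp

lemma span_hvec_coeffs:
  assumes "x \<in> cvec.span (hvec G ` I)" "I \<subseteq> simples G"
  obtains a where "\<And>i. i \<notin> I \<Longrightarrow> a i = 0" "x = (\<Sum>i\<in>simples G. a i *\<^sub>C hvec G i)"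
proof -
  have "\<exists>a. (\<forall>i. i \<notin> I \<longrightarrow> a i = 0) \<and> x = (\<Sum>i\<in>simples G. a i *\<^sub>C hvec G i)"
    using assms(1)
  proof (induction rule: cvec.span_induct_alt)
    case base
    show ?case by (rule exI[of _ "\<lambda>_. 0"]) simp
  next
    case (step c u v)
    then obtain a where a: "\<And>i. i \<notin> I \<Longrightarrow> a i = 0" "v = (\<Sum>i\<in>simples G. a i *\<^sub>C hvec G i)" by blast
    from step obtain k where k: "k \<in> I" "u = hvec G k" by blast
    define b where "b i = (if i = k then c else 0) + a i" for i
    have "(\<Sum>i\<in>simples G. b i *\<^sub>C hvec G i) =
        (\<Sum>i\<in>simples G. (if i = k then c else 0) *\<^sub>C hvec G i) + v"
      by (simp add: b_def a(2) scaleC_add_left sum.distrib)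
    also have "(\<Sum>i\<in>simples G. (if i = k then c else 0) *\<^sub>C hvec G i) = c *\<^sub>C u"
      using k assms(2) by (subst sum.remove[of _ k]) (auto intro: sum.neutral)
    finally have "c *\<^sub>C u + v = (\<Sum>i\<in>simples G. b i *\<^sub>C hvec G i)" by simp
    moreover have "\<forall>i. i \<notin> I \<longrightarrow> b i = 0" using a(1) k by (auto simp: b_def)
    ultimately show ?case by blast
  qed
  then show ?thesis using that by blast
qed

text \<open>The spanning vectors of \<open>graded_span G I P\<close> sorted by weight, the \<open>hvec G i\<close> being those of
  weight zero.\<close>

definition homogeneous_part :: "nat set \<Rightarrow> (nat \<Rightarrow> int) set \<Rightarrow> (nat \<Rightarrow> int) \<Rightarrow> 'a set" where
  "homogeneous_part I P d =
    (if d = (\<lambda>_. 0) then hvec G ` I else if d \<in> P then wspace G d else {})"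

lemma homogeneous_part_wspace: "I \<subseteq> simples G \<Longrightarrow> homogeneous_part I P d \<subseteq> wspace G d"
  using hvec_cartan cartan_eq_wspace by (auto simp: homogeneous_part_def)

lemma graded_span_homogeneous:
  assumes "P \<subseteq> root_coeffs G"
  shows "graded_span G I P = cvec.span (\<Union>d\<in>lattice G. homogeneous_part I P d)"
proof -
  have "hvec G ` I \<union> (\<Union>c\<in>P. wspace G c) = (\<Union>d\<in>lattice G. homogeneous_part I P d)"
  proof (intro equalityI subsetI)
    fix x assume "x \<in> hvec G ` I \<union> (\<Union>c\<in>P. wspace G c)"
    then show "x \<in> (\<Union>d\<in>lattice G. homogeneous_part I P d)"
    proof
      assume "x \<in> hvec G ` I"
      then show ?thesis by (intro UN_I[of "\<lambda>_. 0"]) (simp_all add: homogeneous_part_def)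
    next
      assume "x \<in> (\<Union>c\<in>P. wspace G c)"
      then obtain c where "c \<in> P" "x \<in> wspace G c" by blast
      then show ?thesis using assms
        by (intro UN_I[of c]) (auto simp: homogeneous_part_def root_coeffs_def)
    qed
  next
    fix x assume "x \<in> (\<Union>d\<in>lattice G. homogeneous_part I P d)"
    then show "x \<in> hvec G ` I \<union> (\<Union>c\<in>P. wspace G c)"
      by (auto simp: homogeneous_part_def split: if_splits)
  qed
  then show ?thesis by (simp add: graded_span_def)
qed

text \<open>This translates the defining condition of \<open>par_d\<close>, which refers to inclusions of root spaces.\<close>

lemma wspace_subset_graded_span:
  assumes "c \<in> root_coeffs G" "I \<subseteq> simples G" "P \<subseteq> root_coeffs G"
  shows "wspace G c \<subseteq> graded_span G I P \<longleftrightarrow> c \<in> P"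
proof
  assume sub: "wspace G c \<subseteq> graded_span G I P"
  show "c \<in> P"
  proof (rule ccontr)
    assume "c \<notin> P"
    have "x = 0" if "x \<in> wspace G c" for x
    proof -
      have "x \<in> cvec.span (homogeneous_part I P c)"
        using sub that graded_span_homogeneous[OF assms(3)] homogeneous_part_wspace[OF assms(2)]
          root_coeffs_lattice[OF assms(1)]
        by (intro graded_component[of "homogeneous_part I P"]) auto
      moreover have "homogeneous_part I P c = {}"
        using \<open>c \<notin> P\<close> assms(1) by (simp add: homogeneous_part_def root_coeffs_def)
      ultimately show ?thesis by simp
    qed
    then show False
      using assms(1) subspace_wspace[of c] by (auto simp: root_coeffs_def cvec.subspace_def)
  qed
qed (auto simp: graded_span_def intro!: cvec.span_base)

lemma graded_span_disjoint:
  assumes "x \<in> graded_span G I P" "x \<in> graded_span G J Q"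
    and I: "I \<subseteq> simples G" and J: "J \<subseteq> simples G" and IJ: "I \<inter> J = {}"
    and P: "P \<subseteq> root_coeffs G" and Q: "Q \<subseteq> root_coeffs G" and PQ: "P \<inter> Q = {}"
  shows "x = 0"
proof (rule graded_disjoint)
  show "x \<in> cvec.span (\<Union>d\<in>lattice G. homogeneous_part I P d)"
    "x \<in> cvec.span (\<Union>d\<in>lattice G. homogeneous_part J Q d)"
    using assms(1,2) graded_span_homogeneous P Q by blast+
  show "cvec.span (homogeneous_part I P d) \<inter> cvec.span (homogeneous_part J Q d) \<subseteq> {0}" for d
  proof (cases "d = (\<lambda>_. 0)")
    case True
    have "y = 0" if y: "y \<in> cvec.span (hvec G ` I)" "y \<in> cvec.span (hvec G ` J)" for y
    proof -
      obtain a where a: "\<And>i. i \<notin> I \<Longrightarrow> a i = 0" "y = (\<Sum>i\<in>simples G. a i *\<^sub>C hvec G i)"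
        by (rule span_hvec_coeffs[OF y(1) I]) (rule that)
      obtain b where b: "\<And>i. i \<notin> J \<Longrightarrow> b i = 0" "y = (\<Sum>i\<in>simples G. b i *\<^sub>C hvec G i)"
        by (rule span_hvec_coeffs[OF y(2) J]) (rule that)
      have "(\<Sum>i\<in>simples G. (a i - b i) *\<^sub>C hvec G i) = y - y"
        using a(2) b(2) by (simp add: cvec.scale_left_diff_distrib sum_subtractf)
      then have "a i - b i = 0" if "i \<in> simples G" for i
        using hvec_independent[of "\<lambda>i. a i - b i" i] that by simp
      then have "a i = 0" if "i \<in> simples G" for i
        using a(1)[of i] b(1)[of i] IJ that by (cases "i \<in> I") auto
      then show ?thesis using a(2) by simp
    qed
    then show ?thesis using True by (auto simp: homogeneous_part_def)
  next
    case False
    then show ?thesis using PQ by (auto simp: homogeneous_part_def)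
  qed
qed (use homogeneous_part_wspace I J in auto)

lemma simple_comb_hvec_zero:
  assumes "c \<in> root_coeffs G" "\<And>j. j \<in> csupp c \<Longrightarrow> sroot G j (hvec G i) = 0"
  shows "simple_comb G c (hvec G i) = 0"
  unfolding simple_comb_def
proof (rule sum.neutral, rule ballI)
  fix j assume "j \<in> simples G"
  then show "of_int (c j) * sroot G j (hvec G i) = 0"
    using assms(2)[of j] by (cases "c j = 0") (auto simp: csupp_def)
qed

section \<open>Sets of roots as sets of coefficient vectors\<close>

lemma root_coeff_simple_comb:
  assumes "c \<in> lattice G"
  shows "root_coeff G (simple_comb G c) = c"
  unfolding root_coeff_def
proof (rule the_equality)
  fix d assume "simple_comb G c = simple_comb G d \<and> (\<forall>i. i \<notin> simples G \<longrightarrow> d i = 0)"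
  then show "d = c" using assms by (intro lattice_eqI) (auto simp: lattice_def)
qed (use assms in \<open>auto simp: lattice_def\<close>)

lemma supp_simple_comb: "c \<in> lattice G \<Longrightarrow> supp G (simple_comb G c) = csupp c"
  by (auto simp: supp_def root_coeff_simple_comb csupp_def lattice_def)

lemma Phi_on_image: "Phi_on G S = simple_comb G ` {c \<in> root_coeffs G. csupp c \<subseteq> S}"
  unfolding Phi_on_def root_coeffs_Phi using supp_simple_comb root_coeffs_lattice by auto

lemma Phi_pos_image: "Phi_pos G = simple_comb G ` {c \<in> root_coeffs G. nonneg c}"
proof -
  have "0 \<le> c i" if "c \<in> lattice G" "\<forall>i\<in>simples G. 0 \<le> c i" for c i
    using that by (cases "i \<in> simples G") (auto simp: lattice_def)
  then have "(\<forall>i\<in>simples G. 0 \<le> c i) \<longleftrightarrow> nonneg c" if "c \<in> lattice G" for c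
    using that by (auto simp: nonneg_def)
  then show ?thesis
    unfolding Phi_pos_def root_coeffs_Phi using root_coeff_simple_comb root_coeffs_lattice
    by (auto simp: nonneg_def)
qed

lemma Phi_neg_image: "Phi_neg G = simple_comb G ` {c \<in> root_coeffs G. nonpos c}"
proof -
  have "c i \<le> 0" if "c \<in> lattice G" "\<forall>i\<in>simples G. c i \<le> 0" for c i
    using that by (cases "i \<in> simples G") (auto simp: lattice_def)
  then have "(\<forall>i\<in>simples G. c i \<le> 0) \<longleftrightarrow> nonpos c" if "c \<in> lattice G" for c
    using that by (auto simp: nonpos_def)
  then show ?thesis
    unfolding Phi_neg_def root_coeffs_Phi using root_coeff_simple_comb root_coeffs_lattice
    by (auto simp: nonpos_def)
qed

lemma inj_root_coeffs: "inj_on (simple_comb G) (root_coeffs G)"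
  using inj_simple_comb by (rule inj_on_subset) (auto simp: root_coeffs_def)

lemma image_Int_coeffs:
  "P \<subseteq> root_coeffs G \<Longrightarrow> Q \<subseteq> root_coeffs G \<Longrightarrow>
    simple_comb G ` P \<inter> simple_comb G ` Q = simple_comb G ` (P \<inter> Q)"
  by (rule inj_on_image_Int[OF inj_root_coeffs, symmetric])

lemma image_diff_coeffs:
  "P \<subseteq> root_coeffs G \<Longrightarrow> Q \<subseteq> root_coeffs G \<Longrightarrow>
    simple_comb G ` P - simple_comb G ` Q = simple_comb G ` (P - Q)"
  by (rule inj_on_image_set_diff[OF inj_root_coeffs, symmetric]) auto

lemma Phi_pos_on_image:
  "Phi_pos_on G S = simple_comb G ` {c \<in> root_coeffs G. csupp c \<subseteq> S \<and> nonneg c}"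
  unfolding Phi_pos_on_def Phi_on_image Phi_pos_image
  by (subst image_Int_coeffs) (auto intro!: arg_cong[of _ _ "image _"])

lemma Phi_neg_on_image:
  "Phi_neg_on G S = simple_comb G ` {c \<in> root_coeffs G. csupp c \<subseteq> S \<and> nonpos c}"
  unfolding Phi_neg_on_def Phi_on_image Phi_neg_image
  by (subst image_Int_coeffs) (auto intro!: arg_cong[of _ _ "image _"])

lemma h_root_sum_image: "h_root_sum G I (simple_comb G ` P) = graded_span G I P"
  by (simp add: h_root_sum_def graded_span_def wspace_def)

lemma root_sum_image: "root_sum G (simple_comb G ` P) = graded_span G {} P"
  by (simp add: root_sum_def graded_span_def wspace_def)

lemma span_cartan_image:
  "cvec.span (cartan G \<union> (\<Union>\<beta>\<in>simple_comb G ` P. root_space G \<beta>)) = graded_span G (simples G) P"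
  unfolding graded_span_def wspace_def cvec.span_Un cartan_hvec cvec.span_span by simp

lemmas root_set_images = Phi_pos_on_image Phi_neg_on_image Phi_on_image Phi_pos_image

lemma seaweed_graded: "seaweed G S T = graded_span G (simples G)
    {c \<in> root_coeffs G. csupp c \<subseteq> S \<and> nonneg c \<or> csupp c \<subseteq> T \<and> nonpos c}"
  unfolding seaweed_def root_set_images image_Un[symmetric] span_cartan_image
  by (rule arg_cong[of _ _ "graded_span _ _"]) auto

lemma seaweed_nil_graded: "seaweed_nil G S T = graded_span G {}
    {c \<in> root_coeffs G. (csupp c \<subseteq> S \<and> nonneg c \<or> csupp c \<subseteq> T \<and> nonpos c) \<and> \<not> csupp c \<subseteq> S \<inter> T}"
  unfolding seaweed_nil_def root_set_images image_Un[symmetric]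
  by (subst image_diff_coeffs) (auto simp: root_sum_image intro!: arg_cong[of _ _ "graded_span _ _"])

lemma alg_a_graded: "alg_a G \<omega> S T = graded_span G {i \<in> simples G. i \<ge> \<omega>}
    {c \<in> root_coeffs G. csupp c \<subseteq> above S \<omega> \<and> nonneg c \<or> csupp c \<subseteq> above T \<omega> \<and> nonpos c}"
  unfolding alg_a_def root_set_images image_Un[symmetric] h_root_sum_image
  by (rule arg_cong[of _ _ "graded_span _ _"]) auto

lemma nil_a_graded: "nil_a G \<omega> S T = graded_span G {}
    {c \<in> root_coeffs G. (csupp c \<subseteq> above S \<omega> \<and> nonneg c \<or> csupp c \<subseteq> above T \<omega> \<and> nonpos c)
      \<and> \<not> csupp c \<subseteq> above S \<omega> \<inter> above T \<omega>}"
  unfolding nil_a_def root_set_images image_Un[symmetric]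
  by (subst image_diff_coeffs) (auto simp: root_sum_image intro!: arg_cong[of _ _ "graded_span _ _"])

lemma nil_c_graded: "nil_c G \<epsilon> T = graded_span G {}
    {c \<in> root_coeffs G. csupp c \<subseteq> below (simples G) \<epsilon> \<and> nonneg c \<and> \<not> csupp c \<subseteq> below T \<epsilon>}"
  unfolding nil_c_def root_set_images
  by (subst image_diff_coeffs) (auto simp: root_sum_image intro!: arg_cong[of _ _ "graded_span _ _"])

lemma alg_l_graded: "alg_l G \<epsilon> \<omega> = graded_span G {i \<in> simples G. \<omega> \<le> i \<and> i < \<epsilon>}
    {c \<in> root_coeffs G. csupp c \<subseteq> {i \<in> simples G. \<omega> < i \<and> i < \<epsilon>}}"
  unfolding alg_l_def root_set_images h_root_sum_image by simp

lemma compl_l_graded: "compl_l G \<epsilon> \<omega> = graded_span G {i \<in> simples G. \<not> (\<omega> \<le> i \<and> i < \<epsilon>)}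
    {c \<in> root_coeffs G. \<not> csupp c \<subseteq> {i \<in> simples G. \<omega> < i \<and> i < \<epsilon>}}"
  unfolding compl_l_def root_set_images root_coeffs_Phi
  by (subst image_diff_coeffs) (auto simp: h_root_sum_image intro!: arg_cong[of _ _ "graded_span _ _"])

lemma parabolic_graded: "parabolic G U = graded_span G (simples G)
    {c \<in> root_coeffs G. nonneg c \<or> csupp c \<subseteq> U \<and> nonpos c}"
  unfolding parabolic_def root_set_images image_Un[symmetric] span_cartan_image
  by (rule arg_cong[of _ _ "graded_span _ _"]) auto

lemma parabolic_nil_graded: "parabolic_nil G U = graded_span G {}
    {c \<in> root_coeffs G. nonneg c \<and> \<not> csupp c \<subseteq> U}"
  unfolding parabolic_nil_def root_set_images
  by (subst image_diff_coeffs) (auto simp: root_sum_image intro!: arg_cong[of _ _ "graded_span _ _"])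

lemma par_a_graded: "par_a G \<omega> U = graded_span G {i \<in> simples G. i \<ge> \<omega>}
    {c \<in> root_coeffs G. csupp c \<subseteq> above U \<omega> \<and> nonpos c \<or> csupp c \<subseteq> above (simples G) \<omega> \<and> nonneg c}"
  unfolding par_a_def root_set_images image_Un[symmetric] h_root_sum_image
  by (rule arg_cong[of _ _ "graded_span _ _"]) auto

lemma par_c_graded: "par_c G \<epsilon> U = graded_span G {i \<in> simples G. i < \<epsilon>}
    {c \<in> root_coeffs G. csupp c \<subseteq> below U \<epsilon> \<and> nonpos c \<or> csupp c \<subseteq> below (simples G) \<epsilon> \<and> nonneg c}"
  unfolding par_c_def root_set_images image_Un[symmetric] h_root_sum_image
  by (rule arg_cong[of _ _ "graded_span _ _"]) auto

lemma par_nil_a_graded: "par_nil_a G \<omega> U = graded_span G {}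
    {c \<in> root_coeffs G. csupp c \<subseteq> above (simples G) \<omega> \<and> nonneg c \<and> \<not> csupp c \<subseteq> above U \<omega>}"
  unfolding par_nil_a_def root_set_images
  by (subst image_diff_coeffs) (auto simp: root_sum_image intro!: arg_cong[of _ _ "graded_span _ _"])

lemma nonneg_nonpos: "c \<in> root_coeffs G \<Longrightarrow> nonneg c \<Longrightarrow> nonpos c \<Longrightarrow> False"
  using root_coeffs_nonzero[of c] by (auto simp: nonneg_def nonpos_def csupp_def order_antisym_conv)

lemma par_d_graded: "par_d G \<epsilon> \<omega> U = graded_span G {}
    {c \<in> root_coeffs G. nonneg c \<and> \<not> csupp c \<subseteq> above (simples G) \<omega> \<and> \<not> csupp c \<subseteq> below (simples G) \<epsilon>}"
proof -
  have "root_space G (simple_comb G c) \<subseteq> par_a G \<omega> U \<longleftrightarrow> csupp c \<subseteq> above (simples G) \<omega>"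
    "root_space G (simple_comb G c) \<subseteq> par_c G \<epsilon> U \<longleftrightarrow> csupp c \<subseteq> below (simples G) \<epsilon>"
    if "c \<in> root_coeffs G" "nonneg c" for c
    unfolding par_a_graded par_c_graded wspace_def[symmetric]
    using that nonneg_nonpos[of c] by (subst wspace_subset_graded_span; auto)+
  then have "{\<beta> \<in> Phi_pos G. \<not> root_space G \<beta> \<subseteq> par_a G \<omega> U \<and> \<not> root_space G \<beta> \<subseteq> par_c G \<epsilon> U} =
    simple_comb G ` {c \<in> root_coeffs G. nonneg c \<and> \<not> csupp c \<subseteq> above (simples G) \<omega> \<and>
      \<not> csupp c \<subseteq> below (simples G) \<epsilon>}"
    unfolding Phi_pos_image by auto
  then show ?thesis unfolding par_d_def by (simp only: root_sum_image)
qed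

lemma proj_l_eq:
  assumes "y \<in> alg_l G \<epsilon> \<omega>" "x - y \<in> compl_l G \<epsilon> \<omega>"
  shows "proj_l G \<epsilon> \<omega> x = y"
  unfolding proj_l_def
proof (rule the_equality)
  fix z assume z: "z \<in> alg_l G \<epsilon> \<omega> \<and> x - z \<in> compl_l G \<epsilon> \<omega>"
  have "z - y \<in> alg_l G \<epsilon> \<omega>"
    using z assms(1) by (simp add: alg_l_graded cvec.subspace_diff)
  moreover have "(x - y) - (x - z) \<in> compl_l G \<epsilon> \<omega>"
  proof (rule cvec.subspace_diff)
    show "cvec.subspace (compl_l G \<epsilon> \<omega>)" by (simp only: compl_l_graded subspace_graded_span)
  qed (use z assms(2) in auto)
  ultimately have "z - y = 0"
    unfolding alg_l_graded compl_l_graded by (elim graded_span_disjoint) auto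
  then show "z = y" by simp
qed (use assms in simp)

end

section \<open>Comparison of two Lie algebras with common generators\<close>

lemma positive_wspace_agree:
  assumes "classical G" "classical G'" "c \<in> lattice G" "c \<in> lattice G'" "c \<noteq> (\<lambda>_. 0)" "nonneg c"
    and "\<And>i. i \<in> csupp c \<Longrightarrow> egen G i = egen G' i"
  shows "wspace G c = wspace G' c"
proof -
  have sub: "csupp c \<subseteq> simples G" "csupp c \<subseteq> simples G'"
    using assms(3,4) by (auto simp: lattice_def csupp_def)
  have set: "set w = csupp c" if "word_weight w = c" for w
    using csupp_word_weight[of w] by (simp only: that)
  have word: "w \<in> words (simples G) \<longleftrightarrow> w \<in> words (simples G')" if "word_weight w = c" for w
    using set[OF that] sub by (simp add: words_def)
  have mon: "monomial (egen G) w = monomial (egen G') w" if "word_weight w = c" for w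
    by (rule monomial_cong) (simp add: assms(7) set[OF that])
  have "{monomial (egen G) w | w. w \<in> words (simples G) \<and> word_weight w = c} =
    {monomial (egen G') w | w. w \<in> words (simples G') \<and> word_weight w = c}"
    using word mon by (intro Collect_cong) metis
  then show ?thesis
    by (simp only: classical.wspace_positive[OF assms(1,3,5,6)]
        classical.wspace_positive[OF assms(2,4,5,6)])
qed

text \<open>By \<open>wspace_positive\<close> and its counterpart for negative roots, a root space depends only on the
  generators indexed by the support of the root, although it is defined by the action of a Cartan subalgebra that
  differs in the two Lie algebras.\<close>

lemma wspace_agree:
  assumes G: "classical G" and G': "classical G'"
    and c: "c \<in> root_coeffs G" "csupp c \<subseteq> simples G'"
    and gens: "\<And>i. i \<in> csupp c \<Longrightarrow> egen G i = egen G' i \<and> fgen G i = fgen G' i"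
  shows "wspace G c = wspace G' c"
proof -
  have lat: "c \<in> lattice G" "c \<in> lattice G'" "c \<noteq> (\<lambda>_. 0)"
    using c by (auto simp: root_coeffs_def lattice_def csupp_def)
  show ?thesis
  proof (cases "nonneg c")
    case True
    then show ?thesis using positive_wspace_agree[OF G G' lat] gens by blast
  next
    case False
    then have "nonpos c" using classical.root_sign[OF G c(1)] by blast
    then have neg: "nonneg (\<lambda>i. - c i)" by (simp add: nonneg_def nonpos_def)
    have "classical (opposite G)" "classical (opposite G')"
      using classical.classical_opposite[OF G] classical.classical_opposite[OF G']
      by (simp_all add: classical_def)
    then have "wspace (opposite G) (\<lambda>i. - c i) = wspace (opposite G') (\<lambda>i. - c i)"
      by (rule positive_wspace_agree) (use lat neg gens in \<open>auto simp: csupp_def fun_eq_iff\<close>)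
    then show ?thesis by (simp add: wspace_opposite)
  qed
qed

lemma root_coeffs_agree:
  assumes "classical G" "classical G'" "c \<in> root_coeffs G" "csupp c \<subseteq> simples G'"
    and "\<And>i. i \<in> csupp c \<Longrightarrow> egen G i = egen G' i \<and> fgen G i = fgen G' i"
  shows "c \<in> root_coeffs G'"
  using wspace_agree[OF assms] assms(3,4) by (auto simp: root_coeffs_def lattice_def csupp_def)

text \<open>The bound \<open>max 2 i\<close> is due to type D, where \<open>hvec G 1\<close> involves the second pair of
  generators.\<close>

lemma hvec_agree:
  assumes "lie_type G = lie_type G'" "\<And>j. 1 \<le> j \<Longrightarrow> j \<le> max 2 i \<Longrightarrow> egen G j = egen G' j \<and> fgen G j = fgen G' j"
  shows "hvec G i = hvec G' i"
  using assms(2)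
proof (induction i)
  case (Suc k)
  have "hbar G j = hbar G' j" if "1 \<le> j" "j \<le> max 2 (Suc k)" for j
    using Suc.prems[of j] that by (simp add: hbar_def)
  then have "hbar G 1 = hbar G' 1" "hbar G 2 = hbar G' 2" "hbar G (Suc k) = hbar G' (Suc k)"
    by simp_all
  then show ?case using Suc assms(1) by (cases "k = 0") (auto split: classical_type.split)
qed simp

lemma graded_span_agree:
  assumes "classical G" "classical G'" "\<And>i. i \<in> I \<Longrightarrow> hvec G i = hvec G' i"
    and "\<And>c. c \<in> P \<Longrightarrow> c \<in> root_coeffs G \<and> csupp c \<subseteq> simples G'"
    and "\<And>c i. c \<in> P \<Longrightarrow> i \<in> csupp c \<Longrightarrow> egen G i = egen G' i \<and> fgen G i = fgen G' i"
  shows "graded_span G I P = graded_span G' I P"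
proof -
  have "wspace G c = wspace G' c" if "c \<in> P" for c
    using wspace_agree[OF assms(1,2), of c] assms(4,5) that by blast
  then show ?thesis using assms(3) by (simp add: graded_span_def)
qed

section \<open>Cutting the Dynkin diagram at two vertices\<close>

lemma csupp_add_subset: "csupp (\<lambda>k. a k + b k) \<subseteq> csupp a \<union> csupp b"
  by (auto simp: csupp_def)

lemma csupp_add_nonneg:
  assumes "nonneg a" "nonneg b"
  shows "csupp (\<lambda>k. a k + b k) = csupp a \<union> csupp b"
  using assms by (auto simp: csupp_def nonneg_def add_nonneg_eq_0_iff)

lemma csupp_add_nonpos:
  assumes "nonpos a" "nonpos b"
  shows "csupp (\<lambda>k. a k + b k) = csupp a \<union> csupp b"
  using assms by (auto simp: csupp_def nonpos_def add_nonpos_eq_0_iff)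

lemma nonneg_pos: "nonneg c \<Longrightarrow> k \<in> csupp c \<Longrightarrow> c k > 0"
  by (auto simp: nonneg_def csupp_def order_less_le)

lemma nonpos_neg: "nonpos c \<Longrightarrow> k \<in> csupp c \<Longrightarrow> c k < 0"
  by (auto simp: nonpos_def csupp_def order_less_le)

lemma csupp_iff: "k \<in> csupp c \<longleftrightarrow> c k \<noteq> 0"
  by (simp add: csupp_def)

context classical
begin

lemma root_not_mixed: "c \<in> root_coeffs G \<Longrightarrow> c k > 0 \<Longrightarrow> c l < 0 \<Longrightarrow> False"
  using root_sign[of c] unfolding nonneg_def nonpos_def by (meson not_le)

lemma root_nonneg: "c \<in> root_coeffs G \<Longrightarrow> c k > 0 \<Longrightarrow> nonneg c"
  using root_sign[of c] unfolding nonneg_def nonpos_def by (meson not_le)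

text \<open>Adding a root of the parabolic algebra cannot decrease a coefficient outside \<open>Y\<close>, because its
  negative roots are supported in \<open>Y\<close>; a positive coefficient there forces the sum to be positive.\<close>

lemma parabolic_ideal:
  assumes "I \<subseteq> simples G"
    and x: "x \<in> graded_span G I {c \<in> root_coeffs G. nonneg c \<and> csupp c \<subseteq> X \<or> nonpos c \<and> csupp c \<subseteq> X \<inter> Y}"
    and y: "y \<in> graded_span G {} {c \<in> root_coeffs G. nonneg c \<and> csupp c \<subseteq> X \<and> \<not> csupp c \<subseteq> Y}"
  shows "bracket x y \<in> graded_span G {} {c \<in> root_coeffs G. nonneg c \<and> csupp c \<subseteq> X \<and> \<not> csupp c \<subseteq> Y}"
proof (rule bracket_graded_span[OF x y assms(1)])
  fix a b
  assume "a \<in> {c \<in> root_coeffs G. nonneg c \<and> csupp c \<subseteq> X \<or> nonpos c \<and> csupp c \<subseteq> X \<inter> Y}"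
    and "b \<in> {c \<in> root_coeffs G. nonneg c \<and> csupp c \<subseteq> X \<and> \<not> csupp c \<subseteq> Y}"
  then have a: "nonneg a \<and> csupp a \<subseteq> X \<or> nonpos a \<and> csupp a \<subseteq> X \<inter> Y"
    and b: "nonneg b" "csupp b \<subseteq> X" "\<not> csupp b \<subseteq> Y" by auto
  from b obtain k where k: "k \<in> csupp b" "k \<notin> Y" by blast
  have "a k \<ge> 0"
  proof (cases "nonneg a")
    case False
    then have "a k = 0" using a k(2) by (auto simp: csupp_def)
    then show ?thesis by simp
  qed (simp add: nonneg_def)
  then have pos: "a k + b k > 0" using nonneg_pos[OF b(1) k(1)] by simp
  then show "\<exists>k. a k + b k \<noteq> 0" by (intro exI[of _ k]) simp
  assume root: "(\<lambda>k. a k + b k) \<in> root_coeffs G"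
  have "nonneg (\<lambda>k. a k + b k)" using root_nonneg[OF root, of k] pos by simp
  moreover have "csupp (\<lambda>k. a k + b k) \<subseteq> X" using csupp_add_subset[of a b] a b by blast
  moreover have "k \<in> csupp (\<lambda>k. a k + b k)" using pos by (simp add: csupp_def)
  ultimately show "(\<lambda>k. a k + b k) \<in> {c \<in> root_coeffs G. nonneg c \<and> csupp c \<subseteq> X \<and> \<not> csupp c \<subseteq> Y}"
    using root k(2) by blast
qed auto

end

text \<open>The situation common to \<open>\<gg>\<close>, with \<open>Y = T\<close>, and \<open>\<gg>'\<close>, with \<open>Y = U\<close>.\<close>

locale cut_algebra = classical G for G :: "'a::complex_lie_algebra pinned_algebra" +
  fixes \<epsilon> \<omega> :: nat and Y :: "nat set"
  assumes eps_simple: "\<epsilon> \<in> simples G" and omega_simple: "\<omega> \<in> simples G" and omega_less: "\<omega> < \<epsilon>"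
    and omega_notin: "\<omega> \<notin> Y" and between: "{\<omega><..<\<epsilon>} \<subseteq> Y"
    and typeD_eps: "lie_type G = TypeD \<Longrightarrow> 3 \<le> \<epsilon>"
    and typeD_omega: "lie_type G = TypeD \<Longrightarrow> \<omega> = 2 \<Longrightarrow> 1 \<notin> Y"
begin

lemma cut_vertex:
  assumes c: "c \<in> root_coeffs G" "c k = 0" and k: "k \<in> simples G" "lie_type G = TypeD \<Longrightarrow> k \<noteq> 2"
  shows "csupp c \<subseteq> {..<k} \<or> csupp c \<subseteq> {k<..}"
proof -
  let ?A = "{i \<in> simples G. i < k}" and ?B = "{i \<in> simples G. i > k}"
  have "csupp c \<subseteq> ?A \<or> csupp c \<subseteq> ?B"
  proof (rule root_connected[OF c(1)])
    show "csupp c \<subseteq> ?A \<union> ?B"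
    proof
      fix i assume i: "i \<in> csupp c"
      then have "i \<noteq> k" using c(2) by (auto simp: csupp_def)
      then show "i \<in> ?A \<union> ?B" using i root_coeffs_csupp[OF c(1)] by auto
    qed
    fix i j assume "i \<in> ?A" "j \<in> ?B"
    then show "\<not> dynkin_edge (lie_type G) i j"
      using k(2) by (subst dynkin_edge_iff) (auto simp: simples_def)
  qed auto
  then show ?thesis by auto
qed

lemma cut_eps:
  assumes "c \<in> root_coeffs G" "c \<epsilon> = 0"
  shows "csupp c \<subseteq> {..<\<epsilon>} \<or> csupp c \<subseteq> {\<epsilon><..}"
  using cut_vertex[OF assms eps_simple] typeD_eps by force

text \<open>Removing \<open>\<omega>\<close> disconnects the vertices below \<open>\<omega>\<close> from those above, except in type D for \<open>\<omega> = 2\<close>: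
  the vertices \<open>1\<close> and \<open>3\<close> remain connected when \<open>2\<close> is removed. In that case \<open>1\<close> does not belong to
  \<open>Y\<close>, so that the vertex \<open>1\<close> is removed as well.\<close>

lemma cut_omega:
  assumes c: "c \<in> root_coeffs G" and zero: "\<And>i. i \<le> \<omega> \<Longrightarrow> i \<notin> Y \<Longrightarrow> c i = 0"
  shows "csupp c \<subseteq> {..<\<omega>} \<or> csupp c \<subseteq> {\<omega><..}"
proof (cases "lie_type G = TypeD \<and> \<omega> = 2")
  case True
  then have "c 1 = 0" "c 2 = 0" using zero[of 1] zero[of 2] typeD_omega omega_notin by auto
  moreover have "c 0 = 0" using root_coeffs_lattice[OF c] by (auto simp: lattice_def simples_def)
  ultimately have "i > 2" if "c i \<noteq> 0" for i
    using that by (metis One_nat_def Suc_1 less_2_cases_iff linorder_neqE_nat)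
  then show ?thesis using True by (auto simp: csupp_def)
next
  case False
  then show ?thesis using cut_vertex[OF c _ omega_simple] zero[of \<omega>] omega_notin by blast
qed

text \<open>Here \<open>levi\<close> is \<open>\<ll>\<close>, \<open>lower_rest\<close> is its complement in \<open>\<cc>\<close> and \<open>lower_nil\<close> is the nilradical of
  \<open>\<cc>\<close>.\<close>

abbreviation "levi_roots \<equiv> {c \<in> root_coeffs G. csupp c \<subseteq> {\<omega><..<\<epsilon>}}"

abbreviation "lower_roots \<equiv> {c \<in> root_coeffs G.
  nonneg c \<and> csupp c \<subseteq> {..<\<epsilon>} \<and> \<not> csupp c \<subseteq> {\<omega><..} \<or> nonpos c \<and> csupp c \<subseteq> Y \<inter> {..<\<omega>}}"

abbreviation "lower_nil_roots \<equiv> {c \<in> root_coeffs G. nonneg c \<and> csupp c \<subseteq> {..<\<epsilon>} \<and> \<not> csupp c \<subseteq> Y}"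

definition "levi = graded_span G {i \<in> simples G. \<omega> \<le> i \<and> i < \<epsilon>} levi_roots"

definition "lower_rest = graded_span G {i \<in> simples G. i < \<omega>} lower_roots"

definition "lower_nil = graded_span G {} lower_nil_roots"

lemma lower_nil_roots_omega: "c \<in> lower_nil_roots \<Longrightarrow> \<exists>k\<in>csupp c. k \<le> \<omega>"
  using between by (force simp: subset_iff)

lemma alg_l_levi: "alg_l G \<epsilon> \<omega> = levi"
  unfolding alg_l_graded levi_def
  by (rule arg_cong[of _ _ "graded_span _ _"]) (use root_coeffs_csupp in fastforce)

lemma nil_c_lower: "nil_c G \<epsilon> Y = lower_nil"
  unfolding nil_c_graded lower_nil_def
  by (rule arg_cong[of _ _ "graded_span _ _"]) (use root_coeffs_csupp in \<open>force simp: below_def\<close>)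

lemma bracket_lower_nil:
  assumes "x \<in> levi" "y \<in> lower_rest" "z \<in> lower_nil"
  shows "bracket (x + y) z \<in> lower_nil"
  unfolding lower_nil_def
proof (rule parabolic_ideal)
  show "z \<in> graded_span G {} lower_nil_roots" using assms(3) by (simp add: lower_nil_def)
  let ?P = "{c \<in> root_coeffs G. nonneg c \<and> csupp c \<subseteq> {..<\<epsilon>} \<or> nonpos c \<and> csupp c \<subseteq> {..<\<epsilon>} \<inter> Y}"
  have levi: "levi_roots \<subseteq> ?P"
  proof
    fix c assume c: "c \<in> levi_roots"
    then show "c \<in> ?P" using between root_sign[of c] by auto
  qed
  have "x \<in> graded_span G (simples G) ?P"
    using assms(1) unfolding levi_def by (rule graded_span_subsetD) (use levi in auto)
  moreover have "y \<in> graded_span G (simples G) ?P"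
    using assms(2) unfolding lower_rest_def by (rule graded_span_subsetD) (use omega_less in auto)
  ultimately show "x + y \<in> graded_span G (simples G) ?P"
    by (simp add: cvec.subspace_add)
qed simp

text \<open>In standard coordinates, roots supported below \<open>\<epsilon>\<close> involve only coordinates below \<open>\<epsilon>\<close>, and roots
  supported above \<open>\<omega>\<close> only coordinates from \<open>\<omega>\<close> on.\<close>

lemma hvec_above_eps:
  assumes "i \<in> simples G" "\<epsilon> \<le> i" "c \<in> root_coeffs G" "csupp c \<subseteq> {..<\<epsilon>}"
  shows "simple_comb G c (hvec G i) = 0"
proof (rule simple_comb_hvec_zero[OF assms(3)])
  fix j assume "j \<in> csupp c"
  then have "j \<in> simples G" "j < \<epsilon>" using root_coeffs_csupp[OF assms(3)] assms(4) by auto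
  then show "sroot G j (hvec G i) = 0"
    using assms(1,2) typeD_eps by (subst sroot_hvec) (auto simp: simples_def split: classical_type.split)
qed

lemma hvec_below_omega:
  assumes "i \<in> simples G" "i < \<omega>" "c \<in> root_coeffs G" "csupp c \<subseteq> {\<omega><..}"
  shows "simple_comb G c (hvec G i) = 0"
proof (rule simple_comb_hvec_zero[OF assms(3)])
  fix j assume "j \<in> csupp c"
  then have "j \<in> simples G" "\<omega> < j" using root_coeffs_csupp[OF assms(3)] assms(4) by auto
  then show "sroot G j (hvec G i) = 0"
    using assms(1,2) by (subst sroot_hvec) (auto simp: simples_def)
qed

end

section \<open>The seaweed algebra\<close>

locale seaweed_cut = cut_algebra G \<epsilon> \<omega> T for G :: "'a::complex_lie_algebra pinned_algebra" and \<epsilon> \<omega> T +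
  fixes S :: "nat set"
  assumes eps_notin: "\<epsilon> \<notin> S" and below_eps: "{i \<in> simples G. i < \<epsilon>} \<subseteq> S"
begin

text \<open>Here \<open>upper_rest\<close> is the complement of \<open>\<ll>\<close> in \<open>\<aa>\<close> and \<open>upper_nil\<close> is the nilradical of \<open>\<aa>\<close>.\<close>

abbreviation "upper_roots \<equiv> {c \<in> root_coeffs G. nonneg c \<and> csupp c \<subseteq> S \<inter> {\<epsilon><..}
  \<or> nonpos c \<and> csupp c \<subseteq> T \<inter> {\<omega><..} \<and> \<not> csupp c \<subseteq> {..<\<epsilon>}}"

abbreviation "upper_nil_roots \<equiv> {c \<in> root_coeffs G.
  (nonneg c \<and> csupp c \<subseteq> S \<inter> {\<omega><..} \<or> nonpos c \<and> csupp c \<subseteq> T \<inter> {\<omega><..}) \<and> \<not> csupp c \<subseteq> S \<inter> T}"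

definition "upper_rest = graded_span G {i \<in> simples G. \<epsilon> \<le> i} upper_roots"

definition "upper_nil = graded_span G {} upper_nil_roots"

lemma below_S: "c \<in> root_coeffs G \<Longrightarrow> csupp c \<subseteq> {..<\<epsilon>} \<Longrightarrow> csupp c \<subseteq> S"
  using root_coeffs_csupp[of c] below_eps by blast

lemma cut_S: "c \<in> root_coeffs G \<Longrightarrow> csupp c \<subseteq> S \<Longrightarrow> csupp c \<subseteq> {..<\<epsilon>} \<or> csupp c \<subseteq> {\<epsilon><..}"
  using cut_eps[of c] eps_notin by (auto simp: csupp_def)

lemma cut_T: "c \<in> root_coeffs G \<Longrightarrow> csupp c \<subseteq> T \<Longrightarrow> csupp c \<subseteq> {..<\<omega>} \<or> csupp c \<subseteq> {\<omega><..}"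
  using cut_omega[of c] by (auto simp: csupp_def)

lemma interval_below: "{\<omega><..<\<epsilon>} \<subseteq> {..<\<epsilon>}"
  by auto

lemma interval_roots: "c \<in> root_coeffs G \<Longrightarrow> csupp c \<subseteq> {\<omega><..<\<epsilon>} \<Longrightarrow> csupp c \<subseteq> S \<inter> T"
  using below_S[of c] between by (meson Int_greatest interval_below order_trans)

lemma eps_greater: "{\<epsilon><..} \<subseteq> {\<omega><..}"
  using omega_less by auto

lemma alg_a_decomposition: "alg_a G \<omega> S T = {x + y | x y. x \<in> upper_rest \<and> y \<in> levi}"
proof -
  have "{i \<in> simples G. i \<ge> \<omega>} = {i \<in> simples G. \<epsilon> \<le> i} \<union> {i \<in> simples G. \<omega> \<le> i \<and> i < \<epsilon>}"
    using omega_less by auto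
  moreover have "{c \<in> root_coeffs G. csupp c \<subseteq> above S \<omega> \<and> nonneg c \<or> csupp c \<subseteq> above T \<omega> \<and> nonpos c}
    = upper_roots \<union> levi_roots" (is "?P = _")
  proof (intro equalityI subsetI)
    fix c assume c: "c \<in> ?P"
    show "c \<in> upper_roots \<union> levi_roots"
    proof (cases "csupp c \<subseteq> {..<\<epsilon>}")
      case True
      then show ?thesis using c by (fastforce simp: above_def)
    next
      case False
      then show ?thesis using c cut_S[of c] by (fastforce simp: above_def)
    qed
  next
    fix c assume c: "c \<in> upper_roots \<union> levi_roots"
    then have root: "c \<in> root_coeffs G" by blast
    show "c \<in> ?P"
    proof (cases "c \<in> levi_roots")
      case True
      then have "csupp c \<subseteq> above S \<omega>" "csupp c \<subseteq> above T \<omega>"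
        using interval_roots[of c] by (auto simp: above_def)
      then show ?thesis using root root_sign[OF root] by blast
    next
      case False
      then show ?thesis using c eps_greater by (fastforce simp: above_def)
    qed
  qed
  ultimately show ?thesis
    by (simp only: alg_a_graded graded_span_Un upper_rest_def levi_def)
qed

lemma seaweed_decomposition:
  "seaweed G S T = {x + y | x y. x \<in> alg_a G \<omega> S T \<and> y \<in> lower_rest}"
proof -
  have "simples G = {i \<in> simples G. i \<ge> \<omega>} \<union> {i \<in> simples G. i < \<omega>}" by auto
  moreover have "{c \<in> root_coeffs G. csupp c \<subseteq> S \<and> nonneg c \<or> csupp c \<subseteq> T \<and> nonpos c}
    = {c \<in> root_coeffs G. csupp c \<subseteq> above S \<omega> \<and> nonneg c \<or> csupp c \<subseteq> above T \<omega> \<and> nonpos c}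
      \<union> lower_roots" (is "?P = ?Q \<union> _")
  proof (intro equalityI subsetI)
    fix c assume c: "c \<in> ?P"
    then have root: "c \<in> root_coeffs G" by blast
    from c consider "csupp c \<subseteq> S" "nonneg c" | "csupp c \<subseteq> T" "nonpos c" by blast
    then show "c \<in> ?Q \<union> lower_roots"
    proof cases
      case 1
      then show ?thesis using root cut_S[OF root 1(1)] eps_greater by (auto simp: above_def)
    next
      case 2
      then show ?thesis using root cut_T[OF root 2(1)] by (auto simp: above_def)
    qed
  next
    fix c assume "c \<in> ?Q \<union> lower_roots"
    then show "c \<in> ?P" using below_S[of c] by (auto simp: above_def)
  qed
  ultimately have "seaweed G S T = graded_span G ({i \<in> simples G. i \<ge> \<omega>} \<union> {i \<in> simples G. i < \<omega>})
      (?Q \<union> lower_roots)"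
    by (simp only: seaweed_graded)
  then show ?thesis
    by (simp only: alg_a_graded graded_span_Un lower_rest_def)
qed

lemma nil_a_upper: "nil_a G \<omega> S T = upper_nil"
  unfolding nil_a_graded upper_nil_def
  by (rule arg_cong[of _ _ "graded_span _ _"]) (force simp: above_def)

lemma seaweed_nil_decomposition:
  "seaweed_nil G S T = {x + y | x y. x \<in> upper_nil \<and> y \<in> lower_nil}"
proof -
  have "{c \<in> root_coeffs G. (csupp c \<subseteq> S \<and> nonneg c \<or> csupp c \<subseteq> T \<and> nonpos c) \<and> \<not> csupp c \<subseteq> S \<inter> T}
    = upper_nil_roots \<union> lower_nil_roots" (is "?P = _")
  proof (intro equalityI subsetI)
    fix c assume c: "c \<in> ?P"
    then have root: "c \<in> root_coeffs G" by blast
    from c consider "csupp c \<subseteq> S" "nonneg c" | "csupp c \<subseteq> T" "nonpos c" by blast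
    then show "c \<in> upper_nil_roots \<union> lower_nil_roots"
    proof cases
      case 1
      then show ?thesis using c cut_S[OF root 1(1)] eps_greater by auto
    next
      case 2
      moreover have "\<not> csupp c \<subseteq> {..<\<omega>}"
      proof
        assume "csupp c \<subseteq> {..<\<omega>}"
        then have "csupp c \<subseteq> S" using below_S[OF root] omega_less by force
        then show False using c 2 by blast
      qed
      ultimately show ?thesis using c cut_T[OF root 2(1)] by auto
    qed
  next
    fix c assume "c \<in> upper_nil_roots \<union> lower_nil_roots"
    then show "c \<in> ?P" using below_S[of c] by auto
  qed
  then have "seaweed_nil G S T = graded_span G ({} \<union> {}) (upper_nil_roots \<union> lower_nil_roots)"
    by (simp only: seaweed_nil_graded Un_empty_left)
  then show ?thesis
    by (simp only: graded_span_Un upper_nil_def lower_nil_def)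
qed

lemma upper_rest_compl: "upper_rest \<subseteq> compl_l G \<epsilon> \<omega>"
  unfolding upper_rest_def compl_l_graded
proof (rule graded_span_mono)
  show "upper_roots \<subseteq> {c \<in> root_coeffs G. \<not> csupp c \<subseteq> {i \<in> simples G. \<omega> < i \<and> i < \<epsilon>}}"
  proof
    fix c assume c: "c \<in> upper_roots"
    then show "c \<in> {c \<in> root_coeffs G. \<not> csupp c \<subseteq> {i \<in> simples G. \<omega> < i \<and> i < \<epsilon>}}"
      using root_coeffs_nonzero[of c] by fastforce
  qed
qed auto

lemma graded_span_empty: "graded_span G {} {} = {0}"
  by (simp add: graded_span_def)

lemma disconnected_eps:
  assumes "csupp c = A \<union> B" "A \<subseteq> {..<\<epsilon>}" "B \<subseteq> {\<epsilon><..}" "A \<noteq> {}" "B \<noteq> {}"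
  shows "c \<notin> root_coeffs G"
proof
  assume "c \<in> root_coeffs G"
  moreover have "c \<epsilon> = 0" using assms(1-3) csupp_iff[of \<epsilon> c] by auto
  ultimately have "csupp c \<subseteq> {..<\<epsilon>} \<or> csupp c \<subseteq> {\<epsilon><..}" by (rule cut_eps)
  then show False using assms by fastforce
qed

text \<open>A sum of a root in \<open>upper_rest\<close> and a root in \<open>lower_nil\<close> is never a root: if both are
  positive, the support of the sum is disconnected at \<open>\<epsilon>\<close>; otherwise the sum has a negative coefficient at
  some vertex from \<open>\<epsilon>\<close> on and a positive one at some vertex up to \<open>\<omega>\<close>.\<close>

lemma upper_rest_lower_nil:
  assumes "x \<in> upper_rest" "y \<in> lower_nil"
  shows "bracket x y = 0"
proof -
  have "bracket x y \<in> graded_span G {} {}"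
  proof (rule bracket_graded_span[OF assms[unfolded upper_rest_def lower_nil_def]])
    fix i b assume "i \<in> {i \<in> simples G. \<epsilon> \<le> i}" "b \<in> lower_nil_roots"
    then show "b \<in> {} \<or> simple_comb G b (hvec G i) = 0" using hvec_above_eps[of i b] by auto
  next
    fix a b assume a: "a \<in> upper_roots" and b: "b \<in> lower_nil_roots"
    then have ne: "csupp a \<noteq> {}" "csupp b \<noteq> {}" using root_coeffs_nonzero by auto
    obtain k where k: "k \<in> csupp b" "k \<le> \<omega>" using lower_nil_roots_omega[OF b] by blast
    then have bk: "b k > 0" using b nonneg_pos[of b k] by blast
    have "a k = 0" using a k(2) eps_greater by (fastforce simp: csupp_def)
    then have ck: "a k + b k > 0" using bk by simp
    then show "\<exists>k. a k + b k \<noteq> 0" by (intro exI[of _ k]) simp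
    assume root: "(\<lambda>k. a k + b k) \<in> root_coeffs G"
    from a consider "nonneg a" "csupp a \<subseteq> {\<epsilon><..}"
      | "nonpos a" "\<not> csupp a \<subseteq> {..<\<epsilon>}" by blast
    then have False
    proof cases
      case 1
      then have "csupp (\<lambda>k. a k + b k) = csupp b \<union> csupp a" using csupp_add_nonneg[of a b] b by blast
      then show False using disconnected_eps[of _ "csupp b" "csupp a"] 1 ne b root by blast
    next
      case 2
      then obtain l where l: "l \<in> csupp a" "\<epsilon> \<le> l" by (meson lessThan_iff not_le subsetI)
      then have "a l < 0" using 2 nonpos_neg by blast
      moreover have "b l = 0" using b l(2) by (fastforce simp: csupp_def)
      ultimately have "a l + b l < 0" by simp
      then show False using root_not_mixed[OF root ck] by blast
    qed
    then show "(\<lambda>k. a k + b k) \<in> {}" ..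
  qed auto
  then show ?thesis by (simp add: graded_span_empty)
qed

text \<open>Two positive roots have a sum whose support is disconnected at \<open>\<epsilon>\<close>, two negative roots have
  a sum whose support is disconnected at \<open>\<omega>\<close>, and roots of different sign have a sum with coefficients of both
  signs.\<close>

lemma lower_rest_upper_nil:
  assumes "x \<in> lower_rest" "y \<in> upper_nil"
  shows "bracket x y = 0"
proof -
  have "bracket x y \<in> graded_span G {} {}"
  proof (rule bracket_graded_span[OF assms[unfolded lower_rest_def upper_nil_def]])
    fix i b assume "i \<in> {i \<in> simples G. i < \<omega>}" "b \<in> upper_nil_roots"
    then show "b \<in> {} \<or> simple_comb G b (hvec G i) = 0" using hvec_below_omega[of i b] by auto
  next
    fix a b assume a: "a \<in> lower_roots" and b: "b \<in> upper_nil_roots"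
    then have ne: "csupp a \<noteq> {}" "csupp b \<noteq> {}" and ra: "a \<in> root_coeffs G" and rb: "b \<in> root_coeffs G"
      using root_coeffs_nonzero by auto
    have b_above: "csupp b \<subseteq> {\<omega><..}" using b by blast
    obtain k where k: "k \<in> csupp a" "k \<le> \<omega>"
    proof (cases "nonneg a")
      case True
      then show ?thesis using a that nonneg_nonpos[OF ra] by (auto simp: not_less subset_iff)
    next
      case False
      then show ?thesis using a ne(1) that by fastforce
    qed
    have bk: "b k = 0" using b_above k(2) by (auto simp: csupp_def)
    then show "\<exists>k. a k + b k \<noteq> 0" using k(1) by (intro exI[of _ k]) (simp add: csupp_def)
    assume root: "(\<lambda>k. a k + b k) \<in> root_coeffs G"
    have b_neg: "\<exists>l\<in>csupp b. \<epsilon> \<le> l" if "csupp b \<subseteq> T"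
    proof (rule ccontr)
      assume "\<not> ?thesis"
      then have "csupp b \<subseteq> {..<\<epsilon>}" by (auto simp: not_le)
      then show False using below_S[OF rb] b that by blast
    qed
    have b_pos: "csupp b \<subseteq> {\<epsilon><..}" if "nonneg b"
    proof -
      have "csupp b \<subseteq> S" using that b nonneg_nonpos[OF rb] by blast
      moreover have "\<not> csupp b \<subseteq> {..<\<epsilon>}"
        using interval_roots[OF rb] b b_above by fastforce
      ultimately show ?thesis using cut_S[OF rb] by blast
    qed
    have a_below: "csupp a \<subseteq> {..<\<epsilon>}" using a omega_less by force
    have False
    proof (cases "nonneg a")
      case a_pos: True
      show False
      proof (cases "nonneg b")
        case True
        then have "csupp (\<lambda>k. a k + b k) = csupp a \<union> csupp b" using csupp_add_nonneg[OF a_pos] by blast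
        then show False using disconnected_eps[of _ "csupp a" "csupp b"] a_below b_pos[OF True] ne root
          by blast
      next
        case False
        then have "nonpos b" "csupp b \<subseteq> T" using b by blast+
        then obtain l where l: "l \<in> csupp b" "\<epsilon> \<le> l" using b_neg by blast
        then have "b l < 0" using nonpos_neg \<open>nonpos b\<close> by blast
        moreover have "a l = 0" using a_below l(2) by (force simp: csupp_def)
        ultimately have "a l + b l < 0" by simp
        moreover have "a k + b k > 0" using nonneg_pos[OF a_pos k(1)] bk by simp
        ultimately show False using root_not_mixed[OF root] by blast
      qed
    next
      case False
      then have a_neg: "nonpos a" "csupp a \<subseteq> T \<inter> {..<\<omega>}" using a by blast+
      have ck: "a k + b k < 0" using nonpos_neg[OF a_neg(1) k(1)] bk by simp
      show False
      proof (cases "nonneg b")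
        case True
        obtain l where l: "l \<in> csupp b" using ne by blast
        then have "b l > 0" using nonneg_pos True by blast
        moreover have "a l = 0" using a_neg(2) b_above l by (force simp: csupp_def)
        ultimately have "a l + b l > 0" by simp
        then show False using root_not_mixed[OF root] ck by blast
      next
        case False
        then have b_T: "nonpos b" "csupp b \<subseteq> T" using b by blast+
        then have supp: "csupp (\<lambda>k. a k + b k) = csupp a \<union> csupp b" using csupp_add_nonpos[OF a_neg(1)] by blast
        then have "csupp (\<lambda>k. a k + b k) \<subseteq> {..<\<omega>} \<or> csupp (\<lambda>k. a k + b k) \<subseteq> {\<omega><..}"
          using cut_T[OF root] a_neg(2) b_T(2) by blast
        then show False using supp a_neg(2) b_above ne by fastforce
      qed
    qed
    then show "(\<lambda>k. a k + b k) \<in> {}" ..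
  qed auto
  then show ?thesis by (simp add: graded_span_empty)
qed

end

section \<open>The parabolic algebra\<close>

locale parabolic_cut = cut_algebra G \<epsilon> \<omega> U for G :: "'a::complex_lie_algebra pinned_algebra" and \<epsilon> \<omega> U +
  assumes eps_notin: "\<epsilon> \<notin> U"
begin

text \<open>The complement of \<open>\<ll>\<close> in \<open>\<aa>\<^sub>U\<close>, the nilradical of \<open>\<aa>\<^sub>U\<close> and \<open>\<dd>\<^sub>U\<close>. In contrast to the seaweed,
  \<open>upper_rest\<close> now contains all positive roots supported above \<open>\<omega>\<close> and outside \<open>\<ll>\<close>.\<close>

abbreviation "upper_roots \<equiv> {c \<in> root_coeffs G. nonneg c \<and> csupp c \<subseteq> {\<omega><..} \<and> \<not> csupp c \<subseteq> {..<\<epsilon>}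
  \<or> nonpos c \<and> csupp c \<subseteq> U \<inter> {\<epsilon><..}}"

abbreviation "upper_nil_roots \<equiv> {c \<in> root_coeffs G. nonneg c \<and> csupp c \<subseteq> {\<omega><..} \<and> \<not> csupp c \<subseteq> U}"

abbreviation "mixed_roots \<equiv>
  {c \<in> root_coeffs G. nonneg c \<and> \<not> csupp c \<subseteq> {\<omega><..} \<and> \<not> csupp c \<subseteq> {..<\<epsilon>}}"

definition "upper_rest = graded_span G {i \<in> simples G. \<epsilon> \<le> i} upper_roots"

definition "upper_nil = graded_span G {} upper_nil_roots"

definition "mixed = graded_span G {} mixed_roots"

lemma par_nil_a_upper: "par_nil_a G \<omega> U = upper_nil"
  unfolding par_nil_a_graded upper_nil_def
  by (rule arg_cong[of _ _ "graded_span _ _"]) (use root_coeffs_csupp in \<open>force simp: above_def\<close>)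

lemma par_d_mixed: "par_d G \<epsilon> \<omega> U = mixed"
proof -
  have "csupp c \<subseteq> above (simples G) \<omega> \<longleftrightarrow> csupp c \<subseteq> {\<omega><..}"
    "csupp c \<subseteq> below (simples G) \<epsilon> \<longleftrightarrow> csupp c \<subseteq> {..<\<epsilon>}" if "c \<in> root_coeffs G" for c
    using root_coeffs_csupp[OF that] by (auto simp: above_def below_def)
  then show ?thesis
    unfolding par_d_graded mixed_def by (intro arg_cong[of _ _ "graded_span _ _"]) auto
qed

lemma upper_nil_roots_eps: "c \<in> upper_nil_roots \<Longrightarrow> \<not> csupp c \<subseteq> {..<\<epsilon>}"
  using between by fastforce

lemma cut_U:
  assumes "c \<in> root_coeffs G" "csupp c \<subseteq> U"
  shows "csupp c \<subseteq> {..<\<omega>} \<or> csupp c \<subseteq> {\<omega><..<\<epsilon>} \<or> csupp c \<subseteq> {\<epsilon><..}"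
proof -
  have "csupp c \<subseteq> {..<\<omega>} \<or> csupp c \<subseteq> {\<omega><..}"
    using assms by (intro cut_omega) (auto simp: csupp_def)
  moreover have "csupp c \<subseteq> {..<\<epsilon>} \<or> csupp c \<subseteq> {\<epsilon><..}"
    using assms eps_notin by (intro cut_eps) (auto simp: csupp_def)
  ultimately show ?thesis by auto
qed

lemma par_a_decomposition: "par_a G \<omega> U = {x + y | x y. x \<in> upper_rest \<and> y \<in> levi}"
proof -
  have "{i \<in> simples G. i \<ge> \<omega>} = {i \<in> simples G. \<epsilon> \<le> i} \<union> {i \<in> simples G. \<omega> \<le> i \<and> i < \<epsilon>}"
    using omega_less by auto
  moreover have "{c \<in> root_coeffs G. csupp c \<subseteq> above U \<omega> \<and> nonpos c \<or> csupp c \<subseteq> above (simples G) \<omega> \<and> nonneg c}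
    = upper_roots \<union> levi_roots" (is "?P = _")
  proof (intro equalityI subsetI)
    fix c assume c: "c \<in> ?P"
    then have root: "c \<in> root_coeffs G" by blast
    from c consider "csupp c \<subseteq> U" "csupp c \<subseteq> {\<omega><..}" "nonpos c" | "csupp c \<subseteq> {\<omega><..}" "nonneg c"
      by (auto simp: above_def)
    then show "c \<in> upper_roots \<union> levi_roots"
    proof cases
      case 1
      then show ?thesis using root cut_U[OF root] root_coeffs_nonzero[OF root] by fastforce
    next
      case 2
      then show ?thesis using root by auto
    qed
  next
    fix c assume c: "c \<in> upper_roots \<union> levi_roots"
    then have root: "c \<in> root_coeffs G" by blast
    have simple: "csupp c \<subseteq> simples G" using root_coeffs_csupp[OF root] .
    show "c \<in> ?P"
    proof (cases "c \<in> levi_roots")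
      case True
      then have "csupp c \<subseteq> above U \<omega>" "csupp c \<subseteq> above (simples G) \<omega>"
        using simple between by (auto simp: above_def)
      then show ?thesis using root root_sign[OF root] by blast
    next
      case False
      then show ?thesis using c simple omega_less by (fastforce simp: above_def)
    qed
  qed
  ultimately show ?thesis
    by (simp only: par_a_graded graded_span_Un upper_rest_def levi_def)
qed

lemma parabolic_decomposition:
  "parabolic G U = {x + y | x y. x \<in> {x + y | x y. x \<in> par_a G \<omega> U \<and> y \<in> lower_rest} \<and> y \<in> mixed}"
proof -
  have "simples G = ({i \<in> simples G. i \<ge> \<omega>} \<union> {i \<in> simples G. i < \<omega>}) \<union> {}" by auto
  moreover have "{c \<in> root_coeffs G. nonneg c \<or> csupp c \<subseteq> U \<and> nonpos c}
    = ({c \<in> root_coeffs G. csupp c \<subseteq> above U \<omega> \<and> nonpos c \<or> csupp c \<subseteq> above (simples G) \<omega> \<and> nonneg c}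
      \<union> lower_roots) \<union> mixed_roots" (is "?P = (?Q \<union> _) \<union> _")
  proof (intro equalityI subsetI)
    fix c assume c: "c \<in> ?P"
    then have root: "c \<in> root_coeffs G" by blast
    show "c \<in> (?Q \<union> lower_roots) \<union> mixed_roots"
    proof (cases "nonneg c")
      case True
      then show ?thesis using root root_coeffs_csupp[OF root] by (auto simp: above_def)
    next
      case False
      then have "nonpos c" "csupp c \<subseteq> U" using c by blast+
      moreover have "csupp c \<subseteq> {..<\<omega>} \<or> csupp c \<subseteq> {\<omega><..}"
        using cut_U[OF root \<open>csupp c \<subseteq> U\<close>] omega_less by auto
      ultimately show ?thesis using root by (auto simp: above_def)
    qed
  next
    fix c assume "c \<in> (?Q \<union> lower_roots) \<union> mixed_roots"
    then show "c \<in> ?P" by (auto simp: above_def)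
  qed
  ultimately have "parabolic G U = graded_span G (({i \<in> simples G. i \<ge> \<omega>} \<union> {i \<in> simples G. i < \<omega>}) \<union> {})
      ((?Q \<union> lower_roots) \<union> mixed_roots)"
    by (simp only: parabolic_graded)
  then show ?thesis
    by (simp only: par_a_graded graded_span_Un lower_rest_def mixed_def)
qed

lemma lower_nil_parabolic_nil: "lower_nil \<subseteq> parabolic_nil G U"
  unfolding lower_nil_def parabolic_nil_graded by (rule graded_span_mono) auto

lemma upper_rest_compl: "upper_rest \<subseteq> compl_l G \<epsilon> \<omega>"
  unfolding upper_rest_def compl_l_graded
proof (rule graded_span_mono)
  show "upper_roots \<subseteq> {c \<in> root_coeffs G. \<not> csupp c \<subseteq> {i \<in> simples G. \<omega> < i \<and> i < \<epsilon>}}"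
  proof
    fix c assume c: "c \<in> upper_roots"
    then show "c \<in> {c \<in> root_coeffs G. \<not> csupp c \<subseteq> {i \<in> simples G. \<omega> < i \<and> i < \<epsilon>}}"
      using root_coeffs_nonzero[of c] by fastforce
  qed
qed auto

lemma bracket_upper_nil:
  assumes "x \<in> par_a G \<omega> U" "y \<in> upper_nil"
  shows "bracket x y \<in> upper_nil"
  unfolding upper_nil_def
proof (rule parabolic_ideal)
  show "x \<in> graded_span G {i \<in> simples G. i \<ge> \<omega>}
      {c \<in> root_coeffs G. nonneg c \<and> csupp c \<subseteq> {\<omega><..} \<or> nonpos c \<and> csupp c \<subseteq> {\<omega><..} \<inter> U}"
    using assms(1) unfolding par_a_graded
    by (rule graded_span_subsetD) (auto simp: above_def)
qed (use assms(2) in \<open>auto simp: upper_nil_def\<close>)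

text \<open>By connectedness, a root in \<open>mixed\<close> has positive coefficients at \<open>\<epsilon>\<close> and at some vertex up to \<open>\<omega>\<close>
  outside \<open>U\<close>. Neither can be decreased by a root of the parabolic algebra.\<close>

lemma bracket_mixed:
  assumes "x \<in> parabolic G U" "y \<in> mixed"
  shows "bracket x y \<in> mixed"
  unfolding mixed_def
proof (rule bracket_graded_span[OF assms[unfolded parabolic_graded mixed_def]])
  fix a b
  assume a: "a \<in> {c \<in> root_coeffs G. nonneg c \<or> csupp c \<subseteq> U \<and> nonpos c}" and b: "b \<in> mixed_roots"
  then have rb: "b \<in> root_coeffs G" and b_pos: "nonneg b"
    and b_low: "\<exists>k\<in>csupp b. k \<le> \<omega>" and b_high: "\<exists>l\<in>csupp b. \<epsilon> \<le> l"
    by (auto simp: not_less subset_iff)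
  let ?c = "\<lambda>k. a k + b k"
  have "\<epsilon> \<in> csupp b"
  proof (rule ccontr)
    assume "\<epsilon> \<notin> csupp b"
    then have "csupp b \<subseteq> {..<\<epsilon>} \<or> csupp b \<subseteq> {\<epsilon><..}" using cut_eps[OF rb] by (simp add: csupp_def)
    then show False using b_low b_high omega_less by force
  qed
  moreover have "\<exists>k\<in>csupp b. k \<le> \<omega> \<and> k \<notin> U"
  proof (rule ccontr)
    assume "\<not> ?thesis"
    then have "csupp b \<subseteq> {..<\<omega>} \<or> csupp b \<subseteq> {\<omega><..}"
      by (intro cut_omega[OF rb]) (auto simp: csupp_def)
    then show False using b_low b_high omega_less by force
  qed
  ultimately obtain k where k: "k \<in> csupp b" "k \<le> \<omega>" "k \<notin> U" and eps: "\<epsilon> \<in> csupp b" by blast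
  have pos: "?c j > 0" if "j \<in> csupp b" "j \<notin> U" for j
  proof -
    have "a j \<ge> 0"
    proof (cases "nonneg a")
      case False
      then have "a j = 0" using a that(2) by (auto simp: csupp_def)
      then show ?thesis by simp
    qed (simp add: nonneg_def)
    then show ?thesis using nonneg_pos[OF b_pos that(1)] by simp
  qed
  have ck: "?c k > 0" and ce: "?c \<epsilon> > 0" using pos k eps eps_notin by blast+
  then show "\<exists>k. a k + b k \<noteq> 0" by (intro exI[of _ k]) simp
  assume root: "?c \<in> root_coeffs G"
  have "k \<in> csupp ?c" "\<epsilon> \<in> csupp ?c" using ck ce by (auto simp: csupp_def)
  moreover have "nonneg ?c" using root_nonneg[OF root ck] .
  ultimately show "?c \<in> mixed_roots" using root k(2) by force
qed auto

text \<open>If the sum of a positive root reaching up to \<open>\<epsilon>\<close> and a positive root reaching down to \<open>\<omega>\<close> is a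
  root, then it is one of \<open>mixed\<close>; a sum with a negative root has coefficients of both signs, since the supports are disjoint. The same applies to
  \<open>lower_rest\<close> and \<open>upper_nil\<close>.\<close>

lemma upper_rest_lower_nil:
  assumes "x \<in> upper_rest" "y \<in> lower_nil"
  shows "bracket x y \<in> mixed"
  unfolding mixed_def
proof (rule bracket_graded_span[OF assms[unfolded upper_rest_def lower_nil_def]])
  fix i b assume "i \<in> {i \<in> simples G. \<epsilon> \<le> i}" "b \<in> lower_nil_roots"
  then show "b \<in> mixed_roots \<or> simple_comb G b (hvec G i) = 0" using hvec_above_eps[of i b] by auto
next
  fix a b assume a: "a \<in> upper_roots" and b: "b \<in> lower_nil_roots"
  let ?c = "\<lambda>k. a k + b k"
  obtain k where k: "k \<in> csupp b" "k \<le> \<omega>" using lower_nil_roots_omega[OF b] by blast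
  have "a k = 0" using a k(2) omega_less by (fastforce simp: csupp_def)
  then have ck: "?c k > 0" using nonneg_pos[of b k] b k by auto
  then show "\<exists>k. a k + b k \<noteq> 0" by (intro exI[of _ k]) simp
  assume root: "?c \<in> root_coeffs G"
  show "?c \<in> mixed_roots"
  proof (cases "nonneg a")
    case True
    then have "csupp ?c = csupp a \<union> csupp b" using csupp_add_nonneg[of a b] b by blast
    moreover have "\<not> csupp a \<subseteq> {..<\<epsilon>}" using a True nonneg_nonpos[of a] by blast
    ultimately show ?thesis using root root_nonneg[OF root ck] k by force
  next
    case False
    then have a_neg: "nonpos a" "csupp a \<subseteq> {\<epsilon><..}" using a by blast+
    obtain l where l: "l \<in> csupp a" using a root_coeffs_nonzero[of a] by blast
    have "b l = 0" using b a_neg(2) l by (force simp: csupp_def)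
    then have "?c l < 0" using nonpos_neg[OF a_neg(1) l] by simp
    then show ?thesis using root_not_mixed[OF root ck] by blast
  qed
qed auto

lemma lower_rest_upper_nil:
  assumes "x \<in> lower_rest" "y \<in> upper_nil"
  shows "bracket x y \<in> mixed"
  unfolding mixed_def
proof (rule bracket_graded_span[OF assms[unfolded lower_rest_def upper_nil_def]])
  fix i b assume "i \<in> {i \<in> simples G. i < \<omega>}" "b \<in> upper_nil_roots"
  then show "b \<in> mixed_roots \<or> simple_comb G b (hvec G i) = 0" using hvec_below_omega[of i b] by auto
next
  fix a b assume a: "a \<in> lower_roots" and b: "b \<in> upper_nil_roots"
  let ?c = "\<lambda>k. a k + b k"
  obtain l where l: "l \<in> csupp b" "\<epsilon> \<le> l" using upper_nil_roots_eps[OF b]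
    by (meson lessThan_iff not_le subsetI)
  have "a l = 0" using a l(2) omega_less by (force simp: csupp_def)
  then have cl: "?c l > 0" using nonneg_pos[of b l] b l by auto
  then show "\<exists>k. a k + b k \<noteq> 0" by (intro exI[of _ l]) simp
  assume root: "?c \<in> root_coeffs G"
  show "?c \<in> mixed_roots"
  proof (cases "nonneg a")
    case True
    then have "csupp ?c = csupp a \<union> csupp b" using csupp_add_nonneg[of a b] b by blast
    moreover have "\<not> csupp a \<subseteq> {\<omega><..}" using a True nonneg_nonpos[of a] by blast
    ultimately show ?thesis using root root_nonneg[OF root cl] l by force
  next
    case False
    then have a_neg: "nonpos a" "csupp a \<subseteq> {..<\<omega>}" using a by blast+
    obtain k where k: "k \<in> csupp a" using a root_coeffs_nonzero[of a] by blast
    have "b k = 0" using b a_neg(2) k by (force simp: csupp_def)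
    then have "?c k < 0" using nonpos_neg[OF a_neg(1) k] by simp
    then show ?thesis using root_not_mixed[OF root cl] by blast
  qed
qed auto

end

section \<open>Gluing Richardson elements\<close>

context parabolic_cut
begin

lemma proj_l_par: "a \<in> upper_rest \<Longrightarrow> l \<in> levi \<Longrightarrow> proj_l G \<epsilon> \<omega> (a + l) = l"
  using upper_rest_compl by (intro proj_l_eq) (auto simp: alg_l_levi)

lemma nil_components_independent:
  assumes "u \<in> upper_nil" "v \<in> lower_nil" "w \<in> mixed" "u + v + w = 0"
  shows "u = 0 \<and> v = 0"
proof -
  have sub: "cvec.subspace upper_nil" "cvec.subspace lower_nil" "cvec.subspace mixed"
    by (simp_all add: upper_nil_def lower_nil_def mixed_def)
  have "- v - w \<in> graded_span G {} (lower_nil_roots \<union> mixed_roots)"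
  proof (rule cvec.subspace_diff)
    show "- v \<in> graded_span G {} (lower_nil_roots \<union> mixed_roots)"
      using cvec.subspace_neg[OF sub(2) assms(2)] unfolding lower_nil_def
      by (rule graded_span_subsetD) auto
    show "w \<in> graded_span G {} (lower_nil_roots \<union> mixed_roots)"
      using assms(3) unfolding mixed_def by (rule graded_span_subsetD) auto
  qed simp
  moreover have "u = - (v + w)"
    using assms(4) by (simp only: eq_neg_iff_add_eq_0 add.assoc)
  then have "- v - w = u" by simp
  ultimately have u: "u = 0"
    using assms(1) upper_nil_roots_eps unfolding upper_nil_def
    by (intro graded_span_disjoint[of u "{}" upper_nil_roots "{}" "lower_nil_roots \<union> mixed_roots"]) auto
  then have "v = - w" using assms(4) by (simp add: eq_neg_iff_add_eq_0)
  then have "v \<in> mixed" using cvec.subspace_neg[OF sub(3) assms(3)] by simp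
  then have "v = 0"
    using assms(2) unfolding mixed_def lower_nil_def
    by (intro graded_span_disjoint[of v "{}" lower_nil_roots "{}" mixed_roots]) auto
  then show ?thesis using u by blast
qed

text \<open>Modulo the ideal \<open>mixed\<close>, the action of the parabolic algebra on its Richardson element splits
  into the action of the upper part on \<open>r\<^sub>2\<close> and that of the lower part on \<open>r\<^sub>1\<close>, which are only
  coupled by their common Levi component. An element that produces \<open>v\<close> in the lower part has to
  produce \<open>0\<close> in the upper part.\<close>

lemma lower_nil_by_stabilizer:
  assumes r: "is_richardson (parabolic G U) (parabolic_nil G U) (r\<^sub>1 + r\<^sub>2 + r\<^sub>d)"
    and r1: "r\<^sub>1 \<in> lower_nil" and r2: "r\<^sub>2 \<in> upper_nil" and rd: "r\<^sub>d \<in> mixed" and v: "v \<in> lower_nil"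
  obtains a l c where "a \<in> upper_rest" "l \<in> levi" "c \<in> lower_rest"
    "bracket (a + l) r\<^sub>2 = 0" "bracket (l + c) r\<^sub>1 = v"
proof -
  have "v \<in> (\<lambda>y. bracket y (r\<^sub>1 + r\<^sub>2 + r\<^sub>d)) ` parabolic G U"
    using r v lower_nil_parabolic_nil unfolding is_richardson_def by blast
  then obtain y where y: "y \<in> parabolic G U" "bracket y (r\<^sub>1 + r\<^sub>2 + r\<^sub>d) = v" by blast
  then obtain a l c d where a: "a \<in> upper_rest" and l: "l \<in> levi" and c: "c \<in> lower_rest"
    and d: "d \<in> mixed" and y_eq: "y = a + l + c + d"
    unfolding parabolic_decomposition par_a_decomposition by blast
  have sub: "cvec.subspace upper_nil" "cvec.subspace lower_nil" "cvec.subspace mixed"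
    by (simp_all add: upper_nil_def lower_nil_def mixed_def)
  have al: "bracket (a + l) r\<^sub>2 \<in> upper_nil"
    using a l r2 by (intro bracket_upper_nil) (auto simp: par_a_decomposition)
  have lc: "bracket (l + c) r\<^sub>1 \<in> lower_nil" using bracket_lower_nil[OF l c r1] .
  have "bracket r\<^sub>1 d \<in> mixed" "bracket r\<^sub>2 d \<in> mixed"
  proof -
    have "lower_nil \<subseteq> parabolic G U" "upper_nil \<subseteq> parabolic G U"
      unfolding lower_nil_def upper_nil_def parabolic_graded by (intro graded_span_mono; auto)+
    then show "bracket r\<^sub>1 d \<in> mixed" "bracket r\<^sub>2 d \<in> mixed"
      using r1 r2 d bracket_mixed by blast+
  qed
  then have "bracket d r\<^sub>1 \<in> mixed" "bracket d r\<^sub>2 \<in> mixed"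
    using cvec.subspace_neg[OF sub(3)] bracket_antisym by metis+
  moreover have "bracket a r\<^sub>1 \<in> mixed" "bracket c r\<^sub>2 \<in> mixed" "bracket y r\<^sub>d \<in> mixed"
    using upper_rest_lower_nil[OF a r1] lower_rest_upper_nil[OF c r2] bracket_mixed[OF y(1) rd] .
  ultimately have w: "bracket a r\<^sub>1 + bracket c r\<^sub>2 + bracket d r\<^sub>1 + bracket d r\<^sub>2 + bracket y r\<^sub>d \<in> mixed"
    (is "?w \<in> _") using sub(3) by (intro cvec.subspace_add)
  have "v = bracket (a + l + c + d) (r\<^sub>1 + r\<^sub>2) + bracket y r\<^sub>d"
    using y by (simp add: y_eq bracket_add_right)
  also have "\<dots> = bracket (a + l) r\<^sub>2 + bracket (l + c) r\<^sub>1 + ?w"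
    by (simp add: bracket_add_left bracket_add_right algebra_simps)
  finally have "bracket (a + l) r\<^sub>2 + (bracket (l + c) r\<^sub>1 - v) + ?w = 0" by simp
  with al _ w have "bracket (a + l) r\<^sub>2 = 0 \<and> bracket (l + c) r\<^sub>1 - v = 0"
    by (rule nil_components_independent) (use lc v sub(2) in \<open>simp add: cvec.subspace_diff\<close>)
  then show ?thesis using that[OF a l c] by simp
qed

end

context seaweed_cut
begin

lemma proj_l_alg_a: "a \<in> upper_rest \<Longrightarrow> l \<in> levi \<Longrightarrow> proj_l G \<epsilon> \<omega> (a + l) = l"
  using upper_rest_compl by (intro proj_l_eq) (auto simp: alg_l_levi)

text \<open>Given a target \<open>u + v\<close>, a preimage of \<open>u\<close> under the Richardson element \<open>r\<^sub>2\<close> determines the Levi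
  component up to the stabilizer of \<open>r\<^sub>2\<close>, and this freedom suffices to reach \<open>v\<close>.\<close>

lemma richardson_sum:
  assumes r2: "is_richardson (alg_a G \<omega> S T) (nil_a G \<omega> S T) r\<^sub>2" and r1: "r\<^sub>1 \<in> lower_nil"
    and stabilizer: "\<And>v. v \<in> lower_nil \<Longrightarrow> \<exists>a\<in>upper_rest. \<exists>l\<in>levi. \<exists>c\<in>lower_rest.
      bracket (a + l) r\<^sub>2 = 0 \<and> bracket (l + c) r\<^sub>1 = v"
  shows "is_richardson (seaweed G S T) (seaweed_nil G S T) (r\<^sub>2 + r\<^sub>1)"
proof -
  have sub: "cvec.subspace upper_rest" "cvec.subspace levi" "cvec.subspace lower_rest" "cvec.subspace lower_nil"
    by (simp_all add: upper_rest_def levi_def lower_rest_def lower_nil_def)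
  have r2_nil: "r\<^sub>2 \<in> upper_nil" and r2_image: "(\<lambda>y. bracket y r\<^sub>2) ` alg_a G \<omega> S T = upper_nil"
    using r2 by (simp_all add: is_richardson_def nil_a_upper)
  have split: "bracket (a + l + c) (r\<^sub>2 + r\<^sub>1) = bracket (a + l) r\<^sub>2 + bracket (l + c) r\<^sub>1"
    if "a \<in> upper_rest" "c \<in> lower_rest" for a l c
    using upper_rest_lower_nil[OF that(1) r1] lower_rest_upper_nil[OF that(2) r2_nil]
    by (simp add: bracket_add_left bracket_add_right)
  have "bracket y (r\<^sub>2 + r\<^sub>1) \<in> seaweed_nil G S T" if y_in: "y \<in> seaweed G S T" for y
  proof -
    obtain a l c where y: "a \<in> upper_rest" "l \<in> levi" "c \<in> lower_rest" "y = a + l + c"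
      using y_in unfolding seaweed_decomposition alg_a_decomposition by blast
    then have "bracket (a + l) r\<^sub>2 \<in> upper_nil"
      using r2_image alg_a_decomposition by blast
    then show ?thesis
      using split[OF y(1,3)] bracket_lower_nil[OF y(2,3) r1] y(4) unfolding seaweed_nil_decomposition by blast
  qed
  moreover have "z \<in> (\<lambda>y. bracket y (r\<^sub>2 + r\<^sub>1)) ` seaweed G S T" if z_in: "z \<in> seaweed_nil G S T" for z
  proof -
    obtain u v where u: "u \<in> upper_nil" and v: "v \<in> lower_nil" and z: "z = u + v"
      using z_in unfolding seaweed_nil_decomposition by blast
    obtain y\<^sub>0 where y0: "y\<^sub>0 \<in> alg_a G \<omega> S T" "bracket y\<^sub>0 r\<^sub>2 = u"
      using u r2_image by (metis (mono_tags, lifting) imageE)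
    then obtain a\<^sub>0 l\<^sub>0 where a0: "a\<^sub>0 \<in> upper_rest" and l0: "l\<^sub>0 \<in> levi" and u_eq: "bracket (a\<^sub>0 + l\<^sub>0) r\<^sub>2 = u"
      unfolding alg_a_decomposition by blast
    have "bracket (l\<^sub>0 + 0) r\<^sub>1 \<in> lower_nil"
      using bracket_lower_nil[OF l0 cvec.subspace_0[OF sub(3)] r1] .
    then have "v - bracket l\<^sub>0 r\<^sub>1 \<in> lower_nil" using v sub(4) by (simp add: cvec.subspace_diff)
    then obtain a l c where a: "a \<in> upper_rest" and l: "l \<in> levi" and c: "c \<in> lower_rest"
      and eqs: "bracket (a + l) r\<^sub>2 = 0" "bracket (l + c) r\<^sub>1 = v - bracket l\<^sub>0 r\<^sub>1"
      using stabilizer by blast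
    have al: "a\<^sub>0 + a \<in> upper_rest" "l\<^sub>0 + l \<in> levi"
      using a a0 l l0 sub by (simp_all add: cvec.subspace_add)
    have "bracket ((a\<^sub>0 + a) + (l\<^sub>0 + l) + c) (r\<^sub>2 + r\<^sub>1)
        = bracket ((a\<^sub>0 + a) + (l\<^sub>0 + l)) r\<^sub>2 + bracket ((l\<^sub>0 + l) + c) r\<^sub>1"
      by (rule split[OF al(1) c])
    also have "\<dots> = bracket (a\<^sub>0 + l\<^sub>0) r\<^sub>2 + bracket (a + l) r\<^sub>2 + (bracket l\<^sub>0 r\<^sub>1 + bracket (l + c) r\<^sub>1)"
      by (simp add: bracket_add_left algebra_simps)
    also have "\<dots> = z" using eqs u_eq z by simp
    finally have "z = bracket ((a\<^sub>0 + a) + (l\<^sub>0 + l) + c) (r\<^sub>2 + r\<^sub>1)" by simp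
    moreover have "(a\<^sub>0 + a) + (l\<^sub>0 + l) + c \<in> seaweed G S T"
      using al c unfolding seaweed_decomposition alg_a_decomposition by blast
    ultimately show ?thesis by (rule image_eqI)
  qed
  ultimately have "(\<lambda>y. bracket y (r\<^sub>2 + r\<^sub>1)) ` seaweed G S T = seaweed_nil G S T" by blast
  moreover have "r\<^sub>2 + r\<^sub>1 \<in> seaweed_nil G S T"
    using r2_nil r1 unfolding seaweed_nil_decomposition by blast
  ultimately show ?thesis by (simp add: is_richardson_def)
qed

end

text \<open>Everything supported below the vertex \<open>\<epsilon>\<close> is common to both Lie algebras, since both contain the
  corresponding generators.\<close>

lemma cut_algebra_agree:
  assumes "cut_algebra G \<epsilon> \<omega> T" "cut_algebra G' \<epsilon> \<omega> U"
    and type: "lie_type G = lie_type G'" and TU: "{..<\<epsilon>} \<inter> T = {..<\<epsilon>} \<inter> U"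
    and gens: "\<And>i. i \<in> simples G \<Longrightarrow> i \<in> simples G' \<Longrightarrow> egen G i = egen G' i \<and> fgen G i = fgen G' i"
  shows "cut_algebra.levi G \<epsilon> \<omega> = cut_algebra.levi G' \<epsilon> \<omega>"
    and "cut_algebra.lower_rest G \<epsilon> \<omega> T = cut_algebra.lower_rest G' \<epsilon> \<omega> U"
    and "cut_algebra.lower_nil G \<epsilon> T = cut_algebra.lower_nil G' \<epsilon> U"
proof -
  interpret G: cut_algebra G \<epsilon> \<omega> T by fact
  interpret G': cut_algebra G' \<epsilon> \<omega> U by fact
  have below: "i \<in> simples G \<longleftrightarrow> i \<in> simples G'" if "i < \<epsilon>" for i
    using that G.eps_simple G'.eps_simple by (auto simp: simples_def)
  have hvec: "hvec G i = hvec G' i" if "i < \<epsilon>" for i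
  proof (rule hvec_agree[OF type])
    fix j assume "1 \<le> j" "j \<le> max 2 i"
    then have "j \<in> simples G" "j \<in> simples G'"
      using that G.eps_simple G'.eps_simple G.rank_ge G'.rank_ge
      by (auto simp: simples_def split: if_splits)
    then show "egen G j = egen G' j \<and> fgen G j = fgen G' j" by (rule gens)
  qed
  have supp: "csupp c \<subseteq> simples G \<and> csupp c \<subseteq> simples G'"
    if "csupp c \<subseteq> {..<\<epsilon>}" "c \<in> root_coeffs G \<or> c \<in> root_coeffs G'" for c
    using that below G.root_coeffs_csupp[of c] G'.root_coeffs_csupp[of c] by (auto simp: subset_iff)
  have root: "c \<in> root_coeffs G \<longleftrightarrow> c \<in> root_coeffs G'" if c: "csupp c \<subseteq> {..<\<epsilon>}" for c
  proof
    assume root: "c \<in> root_coeffs G"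
    then have "csupp c \<subseteq> simples G" "csupp c \<subseteq> simples G'" using supp[OF c] by blast+
    then show "c \<in> root_coeffs G'"
      using gens by (intro root_coeffs_agree[OF G.classical_axioms G'.classical_axioms root]) blast+
  next
    assume root: "c \<in> root_coeffs G'"
    then have sub: "csupp c \<subseteq> simples G" "csupp c \<subseteq> simples G'" using supp[OF c] by blast+
    have "egen G' i = egen G i \<and> fgen G' i = fgen G i" if "i \<in> csupp c" for i
      using gens[OF subsetD[OF sub(1) that] subsetD[OF sub(2) that]] by (elim conjE) (intro conjI; rule sym)
    then show "c \<in> root_coeffs G"
      by (rule root_coeffs_agree[OF G'.classical_axioms G.classical_axioms root sub(1)])
  qed
  have span: "graded_span G I P = graded_span G' I Q"
    if "\<And>i. i \<in> I \<Longrightarrow> i < \<epsilon>" "\<And>c. c \<in> P \<Longrightarrow> c \<in> root_coeffs G \<and> csupp c \<subseteq> {..<\<epsilon>}" "P = Q" for I P Q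
    unfolding that(3)[symmetric]
  proof (rule graded_span_agree[OF G.classical_axioms G'.classical_axioms])
    fix c i assume "c \<in> P" "i \<in> csupp c"
    then have "i \<in> simples G" "i \<in> simples G'" using supp[of c] that(2)[of c] by blast+
    then show "egen G i = egen G' i \<and> fgen G i = fgen G' i" by (rule gens)
  next
    fix i assume "i \<in> I"
    then show "hvec G i = hvec G' i" using that(1) hvec by blast
  next
    fix c assume "c \<in> P"
    then show "c \<in> root_coeffs G \<and> csupp c \<subseteq> simples G'" using that(2)[of c] supp[of c] by blast
  qed
  have mid: "{\<omega><..<\<epsilon>} \<subseteq> {..<\<epsilon>}" by auto
  have sets: "{i \<in> simples G. \<omega> \<le> i \<and> i < \<epsilon>} = {i \<in> simples G'. \<omega> \<le> i \<and> i < \<epsilon>}"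
    "{i \<in> simples G. i < \<omega>} = {i \<in> simples G'. i < \<omega>}"
    using below G.omega_less by auto
  have low: "i < \<epsilon>" if "csupp c \<subseteq> {..<\<omega>}" "i \<in> csupp c" for c i
    using that G.omega_less by fastforce
  have TU_iff: "i \<in> T \<longleftrightarrow> i \<in> U" if "i < \<epsilon>" for i
    using equalityD1[OF TU] equalityD2[OF TU] that by (auto simp: subset_iff)
  then have TU_low: "T \<inter> {..<\<omega>} = U \<inter> {..<\<omega>}" using G.omega_less by auto
  have T_iff: "csupp c \<subseteq> T \<longleftrightarrow> csupp c \<subseteq> U" if "csupp c \<subseteq> {..<\<epsilon>}" for c
    using TU_iff that by (auto simp: subset_iff)
  have coeffs: "{c \<in> root_coeffs G. P c} = {c \<in> root_coeffs G'. Q c}"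
    if "\<And>c. P c \<Longrightarrow> csupp c \<subseteq> {..<\<epsilon>}" "\<And>c. Q c \<Longrightarrow> csupp c \<subseteq> {..<\<epsilon>}"
      "\<And>c. csupp c \<subseteq> {..<\<epsilon>} \<Longrightarrow> P c \<longleftrightarrow> Q c" for P Q
  proof (rule Collect_cong)
    fix c show "c \<in> root_coeffs G \<and> P c \<longleftrightarrow> c \<in> root_coeffs G' \<and> Q c"
    proof (cases "csupp c \<subseteq> {..<\<epsilon>}")
      case True
      then show ?thesis by (simp only: root[OF True] that(3)[OF True])
    next
      case False
      then show ?thesis using that(1)[of c] that(2)[of c] by blast
    qed
  qed
  show "G.levi = G'.levi"
    unfolding G.levi_def G'.levi_def sets
  proof (rule span)
    show "{c \<in> root_coeffs G. csupp c \<subseteq> {\<omega><..<\<epsilon>}} = {c \<in> root_coeffs G'. csupp c \<subseteq> {\<omega><..<\<epsilon>}}"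
      by (rule coeffs) (use mid in \<open>blast+\<close>)
  qed (use mid in blast)+
  show "G.lower_rest = G'.lower_rest"
    unfolding G.lower_rest_def G'.lower_rest_def sets TU_low
  proof (rule span)
    show "{c \<in> root_coeffs G. nonneg c \<and> csupp c \<subseteq> {..<\<epsilon>} \<and> \<not> csupp c \<subseteq> {\<omega><..} \<or> nonpos c \<and> csupp c \<subseteq> U \<inter> {..<\<omega>}}
      = {c \<in> root_coeffs G'. nonneg c \<and> csupp c \<subseteq> {..<\<epsilon>} \<and> \<not> csupp c \<subseteq> {\<omega><..} \<or> nonpos c \<and> csupp c \<subseteq> U \<inter> {..<\<omega>}}"
      by (rule coeffs) (auto dest: low)
    fix i assume "i \<in> {i \<in> simples G'. i < \<omega>}"
    then show "i < \<epsilon>" using G.omega_less by simp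
  qed (auto dest: low)
  show "G.lower_nil = G'.lower_nil"
    unfolding G.lower_nil_def G'.lower_nil_def
  proof (rule span)
    show "{c \<in> root_coeffs G. nonneg c \<and> csupp c \<subseteq> {..<\<epsilon>} \<and> \<not> csupp c \<subseteq> T}
      = {c \<in> root_coeffs G'. nonneg c \<and> csupp c \<subseteq> {..<\<epsilon>} \<and> \<not> csupp c \<subseteq> U}"
      by (rule coeffs) (use T_iff in \<open>blast+\<close>)
  qed blast+
qed

theorem lemma2p12:
  fixes G G' :: "'a::complex_lie_algebra pinned_algebra"
    and S T U :: "nat set"
    and \<epsilon> \<eta> \<omega> :: nat
    and r r\<^sub>1 r\<^sub>2 r\<^sub>2' r\<^sub>d :: 'a
  assumes G: "classical_lie_algebra G"
    and S: "S \<subseteq> simples G" "S \<noteq> {}" "S \<noteq> simples G"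
    and T: "T \<subseteq> simples G" "T \<noteq> {}" "T \<noteq> simples G"
    and eps: "\<epsilon> = eps_index G S"
    and eta: "\<eta> = eps_index G T"
    and omega: "\<omega> = omega_index G S T"
    and eta_le: "\<eta> \<le> \<epsilon>"
    and omega_less: "\<omega> < \<epsilon>"
    and typeD1: "lie_type G = TypeD \<Longrightarrow> (\<epsilon>, \<omega>) \<noteq> (2, 1)"
    and typeD2: "lie_type G = TypeD \<Longrightarrow> \<epsilon> > 2 \<Longrightarrow> \<eta> \<noteq> 2"
    and G': "classical_lie_algebra G'" "lie_type G' = lie_type G" "\<epsilon> \<le> rank G'"
    and incl: "diagram_inclusion G G' \<or> diagram_inclusion G' G"
    and U: "U \<subseteq> simples G'" "\<epsilon> \<notin> U" "{i. i < \<epsilon>} \<inter> U = {i. i < \<epsilon>} \<inter> T"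
    and r\<^sub>2: "is_richardson (alg_a G \<omega> S T) (nil_a G \<omega> S T) r\<^sub>2"
    and r: "is_richardson (parabolic G' U) (parabolic_nil G' U) r"
    and decomp: "r = r\<^sub>1 + r\<^sub>2' + r\<^sub>d"
      "r\<^sub>1 \<in> nil_c G \<epsilon> T" "r\<^sub>2' \<in> par_nil_a G' \<omega> U" "r\<^sub>d \<in> par_d G' \<epsilon> \<omega> U"
    and stab_eq: "proj_l G' \<epsilon> \<omega> ` stab (par_a G' \<omega> U) r\<^sub>2' = proj_l G \<epsilon> \<omega> ` stab (alg_a G \<omega> S T) r\<^sub>2"
  shows "\<exists>x. is_richardson (seaweed G S T) (seaweed_nil G S T) x"
proof -
  let ?N = "{i \<in> simples G. i \<notin> S}" and ?M = "{i \<in> simples G. i \<notin> T}"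
    and ?K = "{i \<in> simples G. i \<le> \<epsilon> \<and> i \<notin> T}"
  have fin: "finite ?N" "finite ?M" "finite ?K" by simp_all
  have "\<not> simples G \<subseteq> S" "\<not> simples G \<subseteq> T"
    using S(3) T(3) subset_antisym[OF S(1)] subset_antisym[OF T(1)] by auto
  then have ne: "?N \<noteq> {}" "?M \<noteq> {}" by (simp_all add: subset_iff)
  have eps_Min: "\<epsilon> = Min ?N" and eta_Min: "\<eta> = Min ?M" using eps eta by (simp_all add: eps_index_def)
  have eps_in: "\<epsilon> \<in> ?N" and eta_in: "\<eta> \<in> ?M"
    using Min_in[OF fin(1) ne(1)] Min_in[OF fin(2) ne(2)] unfolding eps_Min[symmetric] eta_Min[symmetric]
    by blast+
  have below_S: "i \<in> S" if "i \<in> simples G" "i < \<epsilon>" for i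
  proof (rule ccontr)
    assume "i \<notin> S"
    then have "\<epsilon> \<le> i" using that(1) Min_le[OF fin(1), of i] unfolding eps_Min[symmetric] by blast
    then show False using that(2) by simp
  qed
  have "?K \<noteq> {}" using eta_in eta_le by blast
  moreover have omega_Max: "\<omega> = Max ?K" using omega eps by (simp add: omega_index_def)
  ultimately have omega_in: "\<omega> \<in> ?K" using Max_in[OF fin(3)] by simp
  have between: "i \<in> T" if "\<omega> < i" "i < \<epsilon>" for i
  proof (rule ccontr)
    assume "i \<notin> T"
    moreover have "i \<in> simples G" using that eps_in by (auto simp: simples_def)
    ultimately have "i \<le> \<omega>" using Max_ge[OF fin(3), of i] that(2) omega_Max by simp
    then show False using that(1) by simp
  qed
  have typeD_eps: "3 \<le> \<epsilon>" if "lie_type G = TypeD"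
    using typeD1[OF that] omega_less omega_in by (cases "\<epsilon> \<le> 2") (auto simp: simples_def)
  have typeD_omega: "1 \<notin> T" if "lie_type G = TypeD" "\<omega> = 2"
  proof -
    have "\<eta> \<le> \<omega>" using Max_ge[OF fin(3), of \<eta>] eta_in eta_le omega_Max by simp
    moreover have "\<eta> \<noteq> 2" using typeD2 typeD_eps that(1) by auto
    ultimately have "\<eta> = 1" using eta_in that(2) by (auto simp: simples_def)
    then show ?thesis using eta_in by auto
  qed
  have omega_U: "i \<in> U \<longleftrightarrow> i \<in> T" if "i < \<epsilon>" for i using U(3) that by blast
  interpret G: seaweed_cut G \<epsilon> \<omega> T S
    using G eps_in omega_in omega_less between typeD_eps typeD_omega below_S
    by unfold_locales auto
  interpret G': parabolic_cut G' \<epsilon> \<omega> U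
  proof unfold_locales
    show "\<epsilon> \<in> simples G'" "\<omega> \<in> simples G'"
      using eps_in omega_in omega_less G'(3) by (auto simp: simples_def)
    show "1 \<notin> U" if "lie_type G' = TypeD" "\<omega> = 2"
      using that G'(2) typeD_omega omega_less omega_U[of 1] by simp
  qed (use G' U(2) omega_less omega_in between typeD_eps omega_U in auto)
  have gens: "egen G i = egen G' i \<and> fgen G i = fgen G' i"
    if "i \<in> simples G" "i \<in> simples G'" for i
    using incl that unfolding diagram_inclusion_def by metis
  have "{..<\<epsilon>} \<inter> T = {..<\<epsilon>} \<inter> U" using omega_U by blast
  note agree = cut_algebra_agree[OF G.cut_algebra_axioms G'.cut_algebra_axioms G'(2)[symmetric] this gens]
  have r1: "r\<^sub>1 \<in> G.lower_nil" using decomp(2) by (simp add: G.nil_c_lower)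
  have "\<exists>a\<in>G.upper_rest. \<exists>l\<in>G.levi. \<exists>c\<in>G.lower_rest. bracket (a + l) r\<^sub>2 = 0 \<and> bracket (l + c) r\<^sub>1 = v"
    if v: "v \<in> G.lower_nil" for v
  proof -
    have "r\<^sub>2' \<in> G'.upper_nil" "r\<^sub>d \<in> G'.mixed"
      using decomp by (simp_all add: G'.par_nil_a_upper G'.par_d_mixed)
    then obtain a' l c where a': "a' \<in> G'.upper_rest" and l: "l \<in> G'.levi" and c: "c \<in> G'.lower_rest"
      and eqs: "bracket (a' + l) r\<^sub>2' = 0" "bracket (l + c) r\<^sub>1 = v"
      using G'.lower_nil_by_stabilizer[of r\<^sub>1 r\<^sub>2' r\<^sub>d v] r decomp(1) r1 v agree(3) by metis
    have "a' + l \<in> stab (par_a G' \<omega> U) r\<^sub>2'"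
      using a' l eqs(1) by (auto simp: stab_def G'.par_a_decomposition)
    then have "l \<in> proj_l G \<epsilon> \<omega> ` stab (alg_a G \<omega> S T) r\<^sub>2"
      unfolding stab_eq[symmetric] using G'.proj_l_par[OF a' l] by (metis image_eqI)
    then obtain y where y: "y \<in> alg_a G \<omega> S T" "bracket y r\<^sub>2 = 0" "proj_l G \<epsilon> \<omega> y = l"
      by (auto simp: stab_def)
    then obtain a l' where a: "a \<in> G.upper_rest" "l' \<in> G.levi" "y = a + l'"
      using G.alg_a_decomposition by blast
    then have "l' = l" using G.proj_l_alg_a y(3) by simp
    then show ?thesis using a y(2) eqs(2) c agree(2) by blast
  qed
  then show ?thesis using G.richardson_sum[OF r\<^sub>2 r1] by blast
qed

end
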